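(* Let $f\in L^2(I)$. For each integer $n\ge 0$ let $k_n$ be the solution to PBEP(n), and let $g_0$ be the solution to ABEP. Then, as $n\to\infty$, $(k_n)_{|_I}$ converges to $(g_0)_{|_I}$ in $L^2(I)$, and $(k_n)_{|_J}$ converges to $(g_0)_{|_J}$ in the weak-* topology of $L^\infty(J)$, as well as in $L^p(J)$-norm for every $1\le p<\infty$ if $f$ is not the trace on $I$ of an $H^2$-function which is at most $1$ in modulus a.e. on $J$. Altogether: $$\lim_{n\to\infty}\|g_0-k_n\|_{L^p(I)}=0,\qquad 1\le p\le 2,$$ $$\lim_{n\to\infty}\langle k_n,h\rangle_J=\langle g_0,h\rangle_J\qquad\text{for all }h\in L^1(J),$$ $$\text{if } f\ne g_0 \text{ on } I \text{ (as elements of } L^2(I)),\qquad \lim_{n\to\infty}\|g_0-k_n\|_{L^p(J)}=0,\qquad 1\le p<\infty.$$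
   Context: $\mathbb{T}$ is the unit circle, $I\subset\mathbb{T}$ is a finite union of nonempty open arcs whose complement $J=\mathbb{T}\setminus I$ has nonempty interior (in $\mathbb{T}$). All functions are complex-valued. For measurable $E\subset\mathbb{T}$ and $1\le p<\infty$, $\|f\|_{L^p(E)}=\left(\frac1{2\pi}\int_E|f(e^{i\theta})|^p\,d\theta\right)^{1/p}$, and $\langle u,v\rangle_E=\frac1{2\pi}\int_E u(e^{i\theta})\overline{v(e^{i\theta})}\,d\theta$; restrictions are implicit in these notations when functions are defined on a larger set. $H^2$ is the Hardy space of the disk, viewed as the closed subspace of $L^2(\mathbb{T})$ of functions whose Fourier coefficients of strictly negative index vanish. $P_n$ is the space of complex algebraic polynomials of degree at most $n$. The trace of a function on $I$ is its restriction to $I$. Problem PBEP(n): given $f\in L^2(I)$, find $k_n\in P_n$ with $|k_n|\le 1$ a.e. on $J$ such that $\|f-k_n\|_{L^2(I)}=\inf\{\|f-g\|_{L^2(I)}:\ g\in P_n,\ |g|\le 1\text{ a.e. on }J\}$. Problem ABEP: given $f\in L^2(I)$, find $g_0\in H^2$ with $|g_0|\le 1$ a.e. on $J$ such that $\|f-g_0\|_{L^2(I)}=\inf\{\|f-g\|_{L^2(I)}:\ g\in H^2,\ |g|\le 1\text{ a.e. on }J\}$. Both problems have a unique solution. *)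

theory Defs
  imports "HOL-Analysis.Analysis" "HOL-Computational_Algebra.Polynomial"
begin

(* Functions on the unit circle are represented by functions on the whole complex plane.  The
   complement of the circle is a null set of the complete measure below, so their values there
   affect neither measurability nor integrals nor almost-everywhere statements. *)
definition circle_measure :: "complex measure" where
  "circle_measure = completion (distr (uniform_measure lborel {0..<2 * pi}) borel cis)"

lemma integral_circle_measure:
  fixes f :: "complex \<Rightarrow> complex"
  assumes [measurable]: "f \<in> borel_measurable borel"
  shows "(LINT z|circle_measure. f z) = (LINT t:{0..<2 * pi}|lborel. f (cis t)) /\<^sub>R (2 * pi)"
proof -
  have [measurable]: "cis \<in> borel_measurable borel"
    by (intro borel_measurable_continuous_onI continuous_intros)
  have "(LINT z|circle_measure. f z) = (LINT t|uniform_measure lborel {0..<2 * pi}. f (cis t))"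
    by (simp add: circle_measure_def integral_completion integral_distr)
  also have "uniform_measure lborel {0..<2 * pi} =
      density lborel (\<lambda>t. ennreal (indicator {0..<2 * pi} t / (2 * pi)))"
    unfolding uniform_measure_def
    by (intro density_cong) (auto simp: divide_ennreal ennreal_indicator[symmetric] indicator_def)
  also have "(LINT t|\<dots>. f (cis t)) =
      (LINT t|lborel. (indicator {0..<2 * pi} t / (2 * pi)) *\<^sub>R f (cis t))"
    by (intro integral_density) auto
  also have "\<dots> = (LINT t|lborel. (1 / (2 * pi)) *\<^sub>R (indicator {0..<2 * pi} t *\<^sub>R f (cis t)))"
    by (intro Bochner_Integration.integral_cong) auto
  also have "\<dots> = (LINT t:{0..<2 * pi}|lborel. f (cis t)) /\<^sub>R (2 * pi)"
    unfolding set_lebesgue_integral_def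
    by (subst integral_scaleR_right) (simp add: inverse_eq_divide)
  finally show ?thesis .
qed

definition Lp_space :: "real \<Rightarrow> complex set \<Rightarrow> (complex \<Rightarrow> complex) set" where
  "Lp_space p E = {f. set_borel_measurable circle_measure E f \<and>
     set_integrable circle_measure E (\<lambda>z. cmod (f z) powr p)}"

definition Lp_norm :: "real \<Rightarrow> complex set \<Rightarrow> (complex \<Rightarrow> complex) \<Rightarrow> real" where
  "Lp_norm p E f = (LINT z:E|circle_measure. cmod (f z) powr p) powr (1 / p)"

definition pairing :: "complex set \<Rightarrow> (complex \<Rightarrow> complex) \<Rightarrow> (complex \<Rightarrow> complex) \<Rightarrow> complex" where
  "pairing E u v = (LINT z:E|circle_measure. u z * cnj (v z))"

definition fourier_coeff :: "(complex \<Rightarrow> complex) \<Rightarrow> int \<Rightarrow> complex" where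
  "fourier_coeff g m = pairing (sphere 0 1) g (\<lambda>z. z powi m)"

definition hardy2 :: "(complex \<Rightarrow> complex) set" where
  "hardy2 = {g \<in> Lp_space 2 (sphere 0 1). \<forall>m<0. fourier_coeff g m = 0}"

definition poly_space :: "nat \<Rightarrow> (complex \<Rightarrow> complex) set" where
  "poly_space n = {poly q | q. degree q \<le> n}"

definition open_arc :: "complex set \<Rightarrow> bool" where
  "open_arc A \<longleftrightarrow> (\<exists>a b. a < b \<and> b \<le> a + 2 * pi \<and> A = cis ` {a<..<b})"

definition finite_union_of_arcs :: "complex set \<Rightarrow> bool" where
  "finite_union_of_arcs I \<longleftrightarrow>
     (\<exists>\<A>. finite \<A> \<and> \<A> \<noteq> {} \<and> (\<forall>A\<in>\<A>. open_arc A) \<and> I = \<Union>\<A>)"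

definition bounded_by_1_on ::
    "complex set \<Rightarrow> (complex \<Rightarrow> complex) set \<Rightarrow> (complex \<Rightarrow> complex) set" where
  "bounded_by_1_on J V = {g \<in> V. AE z in circle_measure. z \<in> J \<longrightarrow> cmod (g z) \<le> 1}"

definition best_L2_approximant ::
    "complex set \<Rightarrow> (complex \<Rightarrow> complex) \<Rightarrow> (complex \<Rightarrow> complex) set \<Rightarrow> (complex \<Rightarrow> complex) \<Rightarrow> bool" where
  "best_L2_approximant I f C k \<longleftrightarrow>
     k \<in> C \<and> Lp_norm 2 I (\<lambda>z. f z - k z) = (INF g\<in>C. Lp_norm 2 I (\<lambda>z. f z - g z))"

definition solves_PBEP ::
    "complex set \<Rightarrow> complex set \<Rightarrow> (complex \<Rightarrow> complex) \<Rightarrow> nat \<Rightarrow> (complex \<Rightarrow> complex) \<Rightarrow> bool" where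
  "solves_PBEP I J f n k \<longleftrightarrow> best_L2_approximant I f (bounded_by_1_on J (poly_space n)) k"

definition solves_ABEP ::
    "complex set \<Rightarrow> complex set \<Rightarrow> (complex \<Rightarrow> complex) \<Rightarrow> (complex \<Rightarrow> complex) \<Rightarrow> bool" where
  "solves_ABEP I J f g \<longleftrightarrow> best_L2_approximant I f (bounded_by_1_on J hardy2) g"

end

(* By convexity a minimising sequence converges in L2(I), so k_n converges to g_0 there as soon as
   polynomials bounded by 1 on J are L2-dense in the constraint set.  For this density, and for the
   convergence on J, the tool is an outer function w with prescribed modulus exp(-v), v >= 0 in L2: it is the
   a.e. limit of exp(-F) for polynomials F whose real parts are the Fejer means of v, and
   |w - 1|^2 has mean at most twice that of v.

   Density: multiply g by an outer factor making it at most 1 in modulus on a neighbourhood of J,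
   then take Fejer means.  Weak-* convergence on J: a test function is, up to a small L1-error on J,
   the trace of a bounded s in H2 with s(0) = 0, and the integral of (k_n - g_0) s over the circle
   vanishes.  Strong convergence: the first order optimality condition forces |g_0| = 1 a.e. on J
   unless f = g_0 on I, and then |k_n - g_0|^2 <= -2 Re ((k_n - g_0) cnj g_0) on J. *)

theory Submission
  imports Defs
begin

section \<open>The normalised arc length measure\<close>

text \<open>The constraint on J is pointwise, while approximation is in mean. A Fejer mean at a
  point of J averages values of g from off J, where |g| may be large, so the bound on J alone is not
  inherited; it has to be forced on a neighbourhood first. Since J is closed, these neighbourhoods
  shrink to J, which is why the correction is cheap.

  No function inside the disk is used: H2 is a condition on Fourier coefficients, the value at 0 is
  the coefficient of index 0, and products are reached by replacing one factor with polynomials.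

  One density statement serves twice: bounded H2 functions are L2-dense off every set E of positive
  measure. With E = I it gives weak convergence on J. With E a subset of J on which |g_0| stays
  below 1 it gives |g_0| = 1 on J: on such an E small perturbations are free, hence the admissible
  directions are rich enough to approximate the residual f - g_0, which would then have to
  vanish.\<close>

abbreviation (input) "M \<equiv> circle_measure"

lemma cis_borel_measurable [measurable]: "cis \<in> borel_measurable borel"
  by (intro borel_measurable_continuous_onI continuous_intros)

lemma space_circle_measure [simp]: "space M = UNIV"
  by (simp add: circle_measure_def)

lemma sets_circle_measure_borel: "A \<in> sets borel \<Longrightarrow> A \<in> sets M"
  by (simp add: circle_measure_def)

lemma Compl_sets_circle_measure: "A \<in> sets M \<Longrightarrow> - A \<in> sets M"
  using sets.compl_sets[of A M] by (simp add: Compl_eq_Diff_UNIV)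

lemma emeasure_circle_measure:
  assumes "A \<in> sets borel"
  shows "emeasure M A = emeasure lborel ({0..<2 * pi} \<inter> cis -` A) / ennreal (2 * pi)"
proof -
  have "cis -` A \<in> sets borel"
    using measurable_sets[OF cis_borel_measurable assms] by simp
  then show ?thesis
    using assms by (simp add: circle_measure_def emeasure_distr Int_commute)
qed

lemma emeasure_circle_measure_UNIV: "emeasure M UNIV = 1"
proof -
  have "emeasure M UNIV = ennreal (2 * pi) / ennreal (2 * pi)"
    by (subst emeasure_circle_measure) auto
  then show ?thesis
    by (simp add: divide_ennreal)
qed

interpretation circle: finite_measure M
  by standard (simp add: emeasure_circle_measure_UNIV)

lemma measure_circle_measure_UNIV [simp]: "measure M UNIV = 1"
  by (simp add: measure_def emeasure_circle_measure_UNIV)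

lemma measurable_circle_borel: "f \<in> borel_measurable borel \<Longrightarrow> f \<in> borel_measurable M"
  by (simp add: circle_measure_def measurable_completion)

lemma measurable_circle_continuous:
  fixes f :: "complex \<Rightarrow> 'b::topological_space"
  shows "continuous_on UNIV f \<Longrightarrow> f \<in> borel_measurable M"
  by (intro measurable_circle_borel borel_measurable_continuous_onI)

lemma continuous_bounded_on_circle:
  fixes c :: "complex \<Rightarrow> 'b::real_normed_vector"
  assumes "continuous_on UNIV c"
  obtains B where "\<And>z. cmod z = 1 \<Longrightarrow> norm (c z) \<le> B"
proof -
  have "compact (c ` sphere 0 1)"
    by (rule compact_continuous_image[OF continuous_on_subset[OF assms]]) auto
  then obtain B where "\<forall>x\<in>c ` sphere 0 1. norm x \<le> B"
    using compact_imp_bounded bounded_iff by blast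
  then show ?thesis using that[of B] by auto
qed

lemma AE_circle_borel:
  assumes "{z. P z} \<in> sets borel" "\<And>t. P (cis t)"
  shows "AE z in M. P z"
proof -
  have "emeasure M {z. \<not> P z} = 0"
  proof -
    have "{z. \<not> P z} = - {z. P z}" by auto
    then have "{z. \<not> P z} \<in> sets borel" using assms(1) by auto
    then show ?thesis
      using assms(2) by (subst emeasure_circle_measure) auto
  qed
  moreover have "{z. \<not> P z} \<in> sets M"
  proof -
    have "{z. \<not> P z} = - {z. P z}" by auto
    then show ?thesis using assms(1) by (auto intro: sets_circle_measure_borel)
  qed
  ultimately show ?thesis
    by (intro AE_I[where N = "{z. \<not> P z}"]) auto
qed

lemma AE_circle_norm: "AE z in M. cmod z = 1"
proof (rule AE_circle_borel)
  have "{z::complex. cmod z = 1} = sphere 0 1" by auto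
  then show "{z::complex. cmod z = 1} \<in> sets borel" by simp
qed simp

lemma complete_circle_measure: "complete_measure M"
  unfolding circle_measure_def by (rule completion.complete_measure_axioms)

text \<open>Completeness makes measurability insensitive to null sets. Functions live on the whole
  plane but are constrained only on the circle, so this is what turns measurability on the circle
  into plain measurability.\<close>

lemma borel_measurable_circle_cong_AE:
  fixes f g :: "complex \<Rightarrow> 'b::topological_space"
  assumes g: "g \<in> borel_measurable M" and eq: "AE z in M. f z = g z"
  shows "f \<in> borel_measurable M"
proof (rule measurableI)
  interpret complete_measure M by (rule complete_circle_measure)
  fix A :: "'b set" assume A: "A \<in> sets borel"
  have "g -` A \<in> sets M" using measurable_sets[OF g A] by simp
  moreover have "AE z in M. z \<in> g -` A \<longleftrightarrow> z \<in> f -` A"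
    using eq by eventually_elim auto
  ultimately show "f -` A \<inter> space M \<in> sets M"
    using in_sets_AE[of "g -` A" "f -` A"] by simp
qed auto

lemma set_measurable_sphere:
  fixes g :: "complex \<Rightarrow> complex"
  shows "set_borel_measurable M (sphere 0 1) g \<longleftrightarrow> g \<in> borel_measurable M"
proof -
  have eq: "AE z in M. g z = indicator (sphere 0 1) z *\<^sub>R g z"
    using AE_circle_norm by eventually_elim auto
  then have eq': "AE z in M. indicator (sphere 0 1) z *\<^sub>R g z = g z"
    by eventually_elim auto
  show ?thesis
    unfolding set_borel_measurable_def
    by (rule iffI) (erule borel_measurable_circle_cong_AE[OF _ eq] borel_measurable_circle_cong_AE[OF _ eq'])+
qed

lemma set_integral_sphere:
  fixes f :: "complex \<Rightarrow> 'b::{banach,second_countable_topology}"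
  assumes "f \<in> borel_measurable M"
  shows "(LINT z:sphere 0 1|M. f z) = (LINT z|M. f z)"
    and "set_integrable M (sphere 0 1) f \<longleftrightarrow> integrable M f"
proof -
  have eq: "AE z in M. indicator (sphere 0 1) z *\<^sub>R f z = f z"
    using AE_circle_norm by eventually_elim auto
  have [measurable]: "sphere 0 1 \<in> sets M" by (rule sets_circle_measure_borel) simp
  note assms[measurable]
  show "(LINT z:sphere 0 1|M. f z) = (LINT z|M. f z)"
    unfolding set_lebesgue_integral_def by (rule integral_cong_AE) (use eq in auto)
  show "set_integrable M (sphere 0 1) f \<longleftrightarrow> integrable M f"
    unfolding set_integrable_def by (rule integrable_cong_AE) (use eq in auto)
qed

lemma integral_cis_powi:
  "(LINT z|M. z powi m) = (if m = 0 then 1 else 0)"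
proof (cases "m = 0")
  case False
  define F where "F t = cis (of_int m * t) / (\<i> * of_int m)" for t :: real
  have [measurable]: "(\<lambda>z::complex. z powi m) \<in> borel_measurable borel"
    unfolding power_int_def by measurable
  have "(LINT z|M. z powi m) = (LINT t:{0..<2 * pi}|lborel. cis t powi m) /\<^sub>R (2 * pi)"
    by (rule integral_circle_measure) measurable
  \<comment> \<open>The fundamental theorem of calculus asks for a closed interval; the added
    endpoint is a null set.\<close>
  also have "(LINT t:{0..<2 * pi}|lborel. cis t powi m) = (LINT t:{0..2 * pi}|lborel. cis t powi m)"
  proof (rule set_integral_cong_set)
    show "set_borel_measurable lborel {0..2 * pi} (\<lambda>t. cis t powi m)"
      "set_borel_measurable lborel {0..<2 * pi} (\<lambda>t. cis t powi m)"
      unfolding set_borel_measurable_def by measurable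
    show "AE t in lborel. (t \<in> {0..2 * pi}) = (t \<in> {0..<2 * pi})"
      using AE_lborel_singleton[of "2 * pi"] by eventually_elim auto
  qed
  also have "\<dots> = (LINT t:{0..2 * pi}|lborel. cis (of_int m * t))"
    by (simp add: cis_power_int)
  also have "\<dots> = F (2 * pi) - F 0"
  proof -
    have "((\<lambda>t. F t) has_vector_derivative cis (of_int m * t)) (at t within {0..2*pi})" for t
    proof -
      have "(F has_vector_derivative cis (of_int m * t)) (at t)"
      proof -
        define A where "A = \<i> * of_int m"
        have A: "A \<noteq> 0" using False by (simp add: A_def)
        have cis: "cis (of_int m * u) = exp (u *\<^sub>R A)" for u
          by (simp add: cis_conv_exp A_def scaleR_conv_of_real mult_ac)
        have "((\<lambda>u. exp (u *\<^sub>R A) / A) has_vector_derivative exp (t *\<^sub>R A) * A / A) (at t)"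
          by (intro has_vector_derivative_divide exp_scaleR_has_vector_derivative_right)
        then show ?thesis
          using A unfolding F_def cis A_def[symmetric] by simp
      qed
      then show ?thesis by (rule has_vector_derivative_at_within)
    qed
    then show ?thesis
      unfolding set_lebesgue_integral_def
      by (intro integral_FTC_atLeastAtMost) (auto intro!: continuous_intros)
  qed
  also have "\<dots> = 0"
  proof -
    have "cis (of_int m * (2 * pi)) = 1"
      using cis_multiple_2pi[of "of_int m"] by (simp add: mult.commute mult.left_commute)
    then show ?thesis by (simp add: F_def)
  qed
  finally show ?thesis using False by simp
qed simp

section \<open>Square integrable functions\<close>

lemma integral_Cauchy_Schwarz:
  fixes f g :: "'a \<Rightarrow> real"
  assumes [measurable]: "f \<in> borel_measurable N" "g \<in> borel_measurable N"
    and f: "integrable N (\<lambda>x. (f x)\<^sup>2)" and g: "integrable N (\<lambda>x. (g x)\<^sup>2)"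
  shows "integrable N (\<lambda>x. f x * g x)"
    and "(LINT x|N. f x * g x)\<^sup>2 \<le> (LINT x|N. (f x)\<^sup>2) * (LINT x|N. (g x)\<^sup>2)"
proof -
  show fg: "integrable N (\<lambda>x. f x * g x)"
  proof (rule Bochner_Integration.integrable_bound)
    show "integrable N (\<lambda>x. (f x)\<^sup>2 + (g x)\<^sup>2)" using f g by simp
    have "\<bar>a * b\<bar> \<le> a\<^sup>2 + b\<^sup>2" for a b :: real
      using sum_squares_bound[of "\<bar>a\<bar>" "\<bar>b\<bar>"] abs_ge_zero[of "a*b"] unfolding abs_mult power2_abs by linarith
    then show "AE x in N. norm (f x * g x) \<le> norm ((f x)\<^sup>2 + (g x)\<^sup>2)" by simp
  qed measurable
  define A B C where "A = (LINT x|N. (f x)\<^sup>2)" and "B = (LINT x|N. f x * g x)"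
    and "C = (LINT x|N. (g x)\<^sup>2)"
  have quad: "0 \<le> A - 2 * t * B + t\<^sup>2 * C" for t
  proof -
    have "0 \<le> (LINT x|N. (f x - t * g x)\<^sup>2)" by simp
    also have "\<dots> = (LINT x|N. (f x)\<^sup>2 - 2 * t * (f x * g x) + t\<^sup>2 * (g x)\<^sup>2)"
      by (intro Bochner_Integration.integral_cong) (auto simp: power2_eq_square algebra_simps)
    also have "\<dots> = A - 2 * t * B + t\<^sup>2 * C"
      using f g fg by (simp add: A_def B_def C_def)
    finally show ?thesis .
  qed
  have "C \<ge> 0" by (simp add: C_def)
  have "B\<^sup>2 \<le> A * C"
  proof (cases "C = 0")
    case True
    have "B = 0"
    proof (rule ccontr)
      assume "B \<noteq> 0"
      \<comment> \<open>With \<open>C = 0\<close> the quadratic is linear in \<open>t\<close>; this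
        choice of \<open>t\<close> makes it equal to -1.\<close>
      then show False using quad[of "(A + 1) / (2 * B)"] True by simp
    qed
    then show ?thesis using True by simp
  next
    case False
    then show ?thesis
      using quad[of "B / C"] \<open>C \<ge> 0\<close> by (simp add: field_simps power2_eq_square)
  qed
  then show "(LINT x|N. f x * g x)\<^sup>2 \<le> (LINT x|N. (f x)\<^sup>2) * (LINT x|N. (g x)\<^sup>2)"
    by (simp add: A_def B_def C_def)
qed

definition sq_int :: "(complex \<Rightarrow> complex) \<Rightarrow> bool" where
  "sq_int g \<longleftrightarrow> g \<in> borel_measurable M \<and> integrable M (\<lambda>z. (cmod (g z))\<^sup>2)"

text \<open>This is the squared norm. Without the root the expansion of a difference stays
  polynomial; the price is a factor 2 in place of the triangle inequality, the source of most
  fractions of \<open>e\<close> below.\<close>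

definition norm2 :: "(complex \<Rightarrow> complex) \<Rightarrow> real" where
  "norm2 g = (LINT z|M. (cmod (g z))\<^sup>2)"

lemma norm2_nonneg [simp]: "0 \<le> norm2 g"
  by (simp add: norm2_def)

lemma sq_int_measurable: "sq_int g \<Longrightarrow> g \<in> borel_measurable M"
  by (simp add: sq_int_def)

lemma sq_int_bounded:
  assumes [measurable]: "g \<in> borel_measurable M" and "AE z in M. cmod (g z) \<le> B"
  shows "sq_int g"
proof -
  have "integrable M (\<lambda>z. (cmod (g z))\<^sup>2)"
  proof (rule circle.integrable_const_bound[where B = "B\<^sup>2"])
    show "AE z in M. norm ((cmod (g z))\<^sup>2) \<le> B\<^sup>2"
      using assms(2) by eventually_elim (auto intro: power_mono)
  qed measurable
  then show ?thesis by (simp add: sq_int_def)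
qed

lemma sq_int_constant: "sq_int (\<lambda>z. c)"
  by (rule sq_int_bounded[where B = "cmod c"]) auto

lemma sq_int_mult_bounded:
  assumes [measurable]: "g \<in> borel_measurable M" "h \<in> borel_measurable M"
    and "sq_int g" and "AE z in M. cmod (h z) \<le> B"
  shows "sq_int (\<lambda>z. h z * g z)"
proof -
  have "integrable M (\<lambda>z. (cmod (h z * g z))\<^sup>2)"
  proof (rule Bochner_Integration.integrable_bound)
    show "integrable M (\<lambda>z. B\<^sup>2 * (cmod (g z))\<^sup>2)" using assms(3) by (simp add: sq_int_def)
    show "AE z in M. norm ((cmod (h z * g z))\<^sup>2) \<le> norm (B\<^sup>2 * (cmod (g z))\<^sup>2)"
      using assms(4)
      by eventually_elim (auto simp: norm_mult power_mult_distrib intro!: mult_right_mono power_mono)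
  qed measurable
  then show ?thesis by (simp add: sq_int_def)
qed

lemma norm_add_power2_le:
  fixes a b :: "'a::real_normed_vector"
  shows "(norm (a + b))\<^sup>2 \<le> 2 * (norm a)\<^sup>2 + 2 * (norm b)\<^sup>2"
proof -
  have "(norm (a + b))\<^sup>2 \<le> (norm a + norm b)\<^sup>2"
    by (intro power_mono norm_triangle_ineq) auto
  also have "\<dots> \<le> 2 * (norm a)\<^sup>2 + 2 * (norm b)\<^sup>2"
    using sum_squares_bound[of "norm a" "norm b"] by (simp add: power2_sum)
  finally show ?thesis .
qed

lemma sq_int_add:
  assumes "sq_int f" "sq_int g"
  shows "sq_int (\<lambda>z. f z + g z)" "norm2 (\<lambda>z. f z + g z) \<le> 2 * norm2 f + 2 * norm2 g"
proof -
  have [measurable]: "f \<in> borel_measurable M" "g \<in> borel_measurable M"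
    and i: "integrable M (\<lambda>z. (cmod (f z))\<^sup>2)" "integrable M (\<lambda>z. (cmod (g z))\<^sup>2)"
    using assms by (auto simp: sq_int_def)
  have int: "integrable M (\<lambda>z. (cmod (f z + g z))\<^sup>2)"
  proof (rule Bochner_Integration.integrable_bound)
    show "integrable M (\<lambda>z. 2 * (cmod (f z))\<^sup>2 + 2 * (cmod (g z))\<^sup>2)" using i by simp
    show "AE z in M. norm ((cmod (f z + g z))\<^sup>2) \<le> norm (2 * (cmod (f z))\<^sup>2 + 2 * (cmod (g z))\<^sup>2)"
      using norm_add_power2_le by (intro AE_I2) (auto intro: order_trans)
  qed measurable
  then show "sq_int (\<lambda>z. f z + g z)" by (simp add: sq_int_def)
  have "norm2 (\<lambda>z. f z + g z) \<le> (LINT z|M. 2 * (cmod (f z))\<^sup>2 + 2 * (cmod (g z))\<^sup>2)"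
    unfolding norm2_def using i int by (intro integral_mono norm_add_power2_le) auto
  then show "norm2 (\<lambda>z. f z + g z) \<le> 2 * norm2 f + 2 * norm2 g"
    using i by (simp add: norm2_def)
qed

lemma sq_int_cmult:
  assumes "sq_int f"
  shows "sq_int (\<lambda>z. c * f z)" "norm2 (\<lambda>z. c * f z) = (cmod c)\<^sup>2 * norm2 f"
  using assms by (auto simp: sq_int_def norm2_def norm_mult power_mult_distrib)

lemma sq_int_diff:
  assumes "sq_int f" "sq_int g"
  shows "sq_int (\<lambda>z. f z - g z)" "norm2 (\<lambda>z. f z - g z) \<le> 2 * norm2 f + 2 * norm2 g"
  using sq_int_add[OF assms(1) sq_int_cmult(1)[OF assms(2), of "-1"]] sq_int_cmult(2)[OF assms(2), of "-1"]
  by auto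

lemma norm2_triangle:
  assumes "sq_int f" "sq_int g" "sq_int h"
  shows "norm2 (\<lambda>z. f z - h z) \<le> 2 * norm2 (\<lambda>z. f z - g z) + 2 * norm2 (\<lambda>z. g z - h z)"
  using sq_int_add(2)[OF sq_int_diff(1)[OF assms(1,2)] sq_int_diff(1)[OF assms(2,3)]] by simp

lemma norm2_commute: "norm2 (\<lambda>z. f z - g z) = norm2 (\<lambda>z. g z - f z)"
  by (simp add: norm2_def norm_minus_commute)

lemma sq_int_cnj:
  assumes "sq_int f"
  shows "sq_int (\<lambda>z. cnj (f z))"
proof -
  have [measurable]: "f \<in> borel_measurable M" using assms by (simp add: sq_int_def)
  have "(\<lambda>z. cnj (f z)) \<in> borel_measurable M"
    by (rule borel_measurable_continuous_on) (auto intro: continuous_intros)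
  then show ?thesis using assms by (simp add: sq_int_def)
qed

lemma sq_int_dominated:
  assumes "sq_int f" "g \<in> borel_measurable M" "\<And>z. cmod (g z) \<le> cmod (f z)"
  shows "sq_int g" "norm2 g \<le> norm2 f"
proof -
  have le: "(cmod (g z))\<^sup>2 \<le> (cmod (f z))\<^sup>2" for z
    using assms(3) by (intro power_mono) auto
  note assms(2)[measurable]
  have f: "integrable M (\<lambda>z. (cmod (f z))\<^sup>2)" using assms(1) by (simp add: sq_int_def)
  have int: "integrable M (\<lambda>z. (cmod (g z))\<^sup>2)"
    by (rule Bochner_Integration.integrable_bound[OF f]) (use le in auto)
  then show "sq_int g" using assms(2) by (simp add: sq_int_def)
  show "norm2 g \<le> norm2 f" unfolding norm2_def
    by (rule integral_mono[OF int f le])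
qed

lemma sq_int_indicator:
  assumes [measurable]: "E \<in> sets M" and g: "sq_int g"
  shows "sq_int (\<lambda>z. indicator E z * g z)" "norm2 (\<lambda>z. indicator E z * g z) \<le> norm2 g"
proof -
  have [measurable]: "g \<in> borel_measurable M" using g by (rule sq_int_measurable)
  have "(\<lambda>z. indicator E z * g z) \<in> borel_measurable M" by measurable
  then show "sq_int (\<lambda>z. indicator E z * g z)" "norm2 (\<lambda>z. indicator E z * g z) \<le> norm2 g"
    using sq_int_dominated[OF g] by (auto simp: indicator_def)
qed

lemma sq_int_mult_integrable:
  assumes "sq_int f" "sq_int g"
  shows "integrable M (\<lambda>z. f z * g z)" "integrable M (\<lambda>z. cmod (f z) * cmod (g z))"
    "(LINT z|M. cmod (f z) * cmod (g z)) \<le> sqrt (norm2 f) * sqrt (norm2 g)"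
    "cmod (LINT z|M. f z * g z) \<le> sqrt (norm2 f) * sqrt (norm2 g)"
proof -
  have [measurable]: "f \<in> borel_measurable M" "g \<in> borel_measurable M"
    and i: "integrable M (\<lambda>z. (cmod (f z))\<^sup>2)" "integrable M (\<lambda>z. (cmod (g z))\<^sup>2)"
    using assms by (auto simp: sq_int_def)
  have cs: "integrable M (\<lambda>z. cmod (f z) * cmod (g z))"
    "(LINT z|M. cmod (f z) * cmod (g z))\<^sup>2 \<le> norm2 f * norm2 g"
    using integral_Cauchy_Schwarz[OF _ _ i] by (auto simp: norm2_def)
  show "integrable M (\<lambda>z. cmod (f z) * cmod (g z))" by fact
  show int: "integrable M (\<lambda>z. f z * g z)"
    by (rule Bochner_Integration.integrable_bound[OF cs(1)]) (auto simp: norm_mult)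
  show le: "(LINT z|M. cmod (f z) * cmod (g z)) \<le> sqrt (norm2 f) * sqrt (norm2 g)"
    using real_le_rsqrt[OF cs(2)] by (simp add: real_sqrt_mult)
  have "cmod (LINT z|M. f z * g z) \<le> (LINT z|M. cmod (f z * g z))"
    by (rule integral_norm_bound)
  with le show "cmod (LINT z|M. f z * g z) \<le> sqrt (norm2 f) * sqrt (norm2 g)"
    by (simp add: norm_mult)
qed

lemma sq_int_integrable:
  assumes "sq_int f"
  shows "integrable M f" "integrable M (\<lambda>z. cmod (f z))" "(LINT z|M. cmod (f z)) \<le> sqrt (norm2 f)"
proof -
  have 1: "sq_int (\<lambda>z. 1)" by (rule sq_int_constant)
  show "integrable M f" using sq_int_mult_integrable(1)[OF assms 1] by simp
  show "integrable M (\<lambda>z. cmod (f z))" using sq_int_mult_integrable(2)[OF assms 1] by simp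
  show "(LINT z|M. cmod (f z)) \<le> sqrt (norm2 f)"
    using sq_int_mult_integrable(3)[OF assms 1] by (simp add: norm2_def)
qed

section \<open>Density of continuous functions in L1 and L2\<close>

lemma indicator_continuous_approx:
  assumes A: "A \<in> sets M" and e: "0 < e"
  shows "\<exists>c::complex \<Rightarrow> real. continuous_on UNIV c \<and> (\<forall>z. 0 \<le> c z \<and> c z \<le> 1) \<and>
    (LINT z|M. \<bar>indicator A z - c z\<bar>) < e"
proof -
  define B where "B = distr (uniform_measure lborel {0..<2 * pi}) borel cis"
  have M: "M = completion B" by (simp add: circle_measure_def B_def)
  have sB: "sets B = sets borel" by (simp add: B_def)
  have spB: "space B = UNIV" by (simp add: B_def)
  have emB: "emeasure B X = emeasure M X" if "X \<in> sets borel" for X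
    using that sB by (simp add: M emeasure_completion)
  have fin: "emeasure B (space B) \<noteq> \<infinity>"
    using emB[of UNIV] by (simp add: spB emeasure_circle_measure_UNIV)
  \<comment> \<open>\<open>A\<close> is measurable only for the completion, whereas inner regularity
    is about Borel measures; the Borel part of \<open>A\<close> loses no measure. The indicator of a
    compact subset of it is then a limit of tent functions of the distance.\<close>
  define S where "S = main_part B A"
  have S: "S \<in> sets borel" "S \<subseteq> A" "emeasure M S = emeasure M A"
  proof -
    have A': "A \<in> sets (completion B)" using A by (simp add: M)
    show S: "S \<in> sets borel" using main_part_sets[OF A'] sB by (simp add: S_def)
    show "S \<subseteq> A" using main_part_null_part_Un[OF A'] by (auto simp: S_def)
    show "emeasure M S = emeasure M A"
      using A' emB[OF S] by (simp add: M emeasure_completion S_def)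
  qed
  have "\<exists>K. K \<subseteq> S \<and> compact K \<and> measure M S - e / 2 < measure M K"
  \<comment> \<open>\<open>ennreal\<close> sends negative reals to 0, so the strict comparison below
    needs a nonnegative left side; in the other case the empty set suffices.\<close>
  proof (cases "measure M S - e / 2 < 0")
    case True
    then show ?thesis by (intro exI[of _ "{}"]) auto
  next
    case False
    have "emeasure B S = ennreal (measure M S)"
      using emB[OF S(1)] by (simp add: circle.emeasure_eq_measure)
    moreover have "ennreal (measure M S - e / 2) < ennreal (measure M S)"
      using e False by (simp add: ennreal_less_iff)
    ultimately have "ennreal (measure M S - e / 2) < (SUP K \<in> {K. K \<subseteq> S \<and> compact K}. emeasure B K)"
      using inner_regular[OF sB fin S(1)] by simp
    then obtain K where K: "K \<subseteq> S" "compact K" "ennreal (measure M S - e / 2) < emeasure B K"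
      by (auto simp: less_SUP_iff)
    then have "ennreal (measure M S - e / 2) < ennreal (measure M K)"
      using emB[of K] by (simp add: circle.emeasure_eq_measure compact_imp_closed)
    with K False show ?thesis by (auto simp: ennreal_less_iff)
  qed
  then obtain K where K: "K \<subseteq> S" "compact K" "measure M S - e / 2 < measure M K" by blast
  have closedK: "closed K" using K(2) by (rule compact_imp_closed)
  have KM: "K \<in> sets M" using closedK by (intro sets_circle_measure_borel) simp
  have AK: "(LINT z|M. \<bar>indicat_real A z - indicat_real K z\<bar>) < e / 2"
  proof -
    have "(LINT z|M. \<bar>indicat_real A z - indicat_real K z\<bar>) = (LINT z|M. indicat_real (A - K) z)"
      by (intro Bochner_Integration.integral_cong) (use K S in \<open>auto simp: indicator_def\<close>)
    also have "\<dots> = measure M (A - K)" using A KM by simp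
    also have "\<dots> = measure M A - measure M K"
      using A KM K(1) S(2) by (intro circle.finite_measure_Diff) auto
    also have "measure M A = measure M S" using S(3) by (simp add: measure_def)
    finally show ?thesis using K(3) by simp
  qed
  have "\<exists>c::complex \<Rightarrow> real. continuous_on UNIV c \<and> (\<forall>z. 0 \<le> c z \<and> c z \<le> 1) \<and>
    (LINT z|M. \<bar>indicator K z - c z\<bar>) < e / 2"
  \<comment> \<open>The distance to the empty set is 0 by convention, so the tents below would be
    constantly 1.\<close>
  proof (cases "K = {}")
    case True
    then show ?thesis using e by (intro exI[of _ "\<lambda>_. 0"]) auto
  next
    case False
    define c where "c n z = max 0 (1 - real n * infdist z K)" for n z
    have cont: "continuous_on UNIV (c n)" for n
      unfolding c_def by (intro continuous_intros)
    have range: "0 \<le> c n z \<and> c n z \<le> 1" for n z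
      by (auto simp: c_def infdist_nonneg)
    have [measurable]: "c n \<in> borel_measurable M" for n
      using cont by (rule measurable_circle_continuous)
    note KM[measurable]
    have "(\<lambda>n. LINT z|M. \<bar>indicator K z - c n z\<bar>) \<longlonglongrightarrow> (LINT z|M. 0)"
    proof (rule integral_dominated_convergence[where w = "\<lambda>_. 1"])
      have "(\<lambda>n. c n z) \<longlonglongrightarrow> indicator K z" for z
      proof (cases "z \<in> K")
        case True
        then show ?thesis by (simp add: c_def)
      next
        case zK: False
        then have pos: "infdist z K > 0"
          using in_closed_iff_infdist_zero[OF closedK False, of z] infdist_nonneg[of z K] by linarith
        then obtain n0 where n0: "real n0 * infdist z K > 1"
          using reals_Archimedean3 by blast
        have "eventually (\<lambda>n. c n z = 0) sequentially"
          using eventually_ge_at_top[of n0]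
        proof eventually_elim
          case (elim n)
          then have "real n0 * infdist z K \<le> real n * infdist z K"
            using pos by (intro mult_right_mono) auto
          then show ?case using n0 by (simp add: c_def)
        qed
        then show ?thesis using zK by (simp add: tendsto_eventually)
      qed
      then have "(\<lambda>n. \<bar>indicator K z - c n z\<bar>) \<longlonglongrightarrow> 0" for z
        using tendsto_rabs_zero[OF Lim_null[THEN iffD1, of "\<lambda>n. c n z"]] by (simp add: abs_minus_commute)
      then show "AE z in M. (\<lambda>n. \<bar>indicator K z - c n z\<bar>) \<longlonglongrightarrow> 0" by simp
      show "AE z in M. norm \<bar>indicator K z - c n z\<bar> \<le> 1" for n
      proof (rule AE_I2)
        fix z show "norm \<bar>indicator K z - c n z\<bar> \<le> 1"
          using range[of n z] by (auto simp: indicator_def)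
      qed
    qed auto
    then have "eventually (\<lambda>n. (LINT z|M. \<bar>indicator K z - c n z\<bar>) < e / 2) sequentially"
      using e by (intro order_tendstoD(2)) auto
    then obtain n where "(LINT z|M. \<bar>indicator K z - c n z\<bar>) < e / 2"
      by (auto simp: eventually_sequentially)
    then show ?thesis using cont range by blast
  qed
  then obtain c :: "complex \<Rightarrow> real" where c: "continuous_on UNIV c" "\<And>z. 0 \<le> c z \<and> c z \<le> 1"
    "(LINT z|M. \<bar>indicator K z - c z\<bar>) < e / 2" by blast
  note A[measurable] KM[measurable]
  have [measurable]: "c \<in> borel_measurable M"
    using c(1) by (rule measurable_circle_continuous)
  have int: "integrable M (\<lambda>z. \<bar>indicator A z - c z\<bar>)" "integrable M (\<lambda>z. \<bar>indicator K z - c z\<bar>)"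
  proof -
    have "\<bar>indicator X z - c z\<bar> \<le> 1" for X z
      using c(2)[of z] by (auto simp: indicator_def)
    then show "integrable M (\<lambda>z. \<bar>indicator A z - c z\<bar>)" "integrable M (\<lambda>z. \<bar>indicator K z - c z\<bar>)"
      by (auto intro!: circle.integrable_const_bound[where B = 1])
  qed
  have intAK: "integrable M (\<lambda>z. \<bar>indicator A z - indicator K z :: real\<bar>)"
    by (rule circle.integrable_const_bound[where B = 1]) (auto simp: indicator_def)
  have "(LINT z|M. \<bar>indicator A z - c z\<bar>)
      \<le> (LINT z|M. \<bar>indicator A z - indicator K z\<bar> + \<bar>indicator K z - c z\<bar>)"
    using int intAK by (intro integral_mono) auto
  also have "\<dots> < e" using int intAK AK c(3) by simp
  finally show ?thesis using c by blast
qed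

lemma L1_continuous_approx:
  fixes f :: "complex \<Rightarrow> complex"
  assumes "integrable M f"
  shows "\<And>e. 0 < e \<Longrightarrow> \<exists>c. continuous_on UNIV c \<and> integrable M c \<and> (LINT z|M. cmod (f z - c z)) < e"
  using assms
proof (induction f rule: integrable_induct)
  case (base A w)
  \<comment> \<open>Dividing by \<open>1 + cmod w\<close> instead of \<open>cmod w\<close> covers
    \<open>w = 0\<close>.\<close>
  have w: "0 < 1 + cmod w" by (simp add: add_pos_nonneg)
  then have "0 < e / (1 + cmod w)" using base by simp
  then obtain c :: "complex \<Rightarrow> real" where c: "continuous_on UNIV c" "\<And>z. 0 \<le> c z \<and> c z \<le> 1"
    "(LINT z|M. \<bar>indicator A z - c z\<bar>) < e / (1 + cmod w)"
    using indicator_continuous_approx[OF base(1)] by blast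
  have [measurable]: "c \<in> borel_measurable M"
    using c(1) by (rule measurable_circle_continuous)
  have "integrable M (\<lambda>z. c z *\<^sub>R w)"
    using c(2) by (intro circle.integrable_const_bound[where B = "cmod w"])
      (auto intro!: AE_I2 mult_left_le_one_le)
  moreover have "continuous_on UNIV (\<lambda>z. c z *\<^sub>R w)" using c(1) by (intro continuous_intros)
  moreover have "(LINT z|M. cmod (indicator A z *\<^sub>R w - c z *\<^sub>R w)) < e"
  proof -
    have "cmod (indicator A z *\<^sub>R w - c z *\<^sub>R w) = \<bar>indicator A z - c z\<bar> * cmod w" for z
      by (simp flip: scaleR_left_diff_distrib)
    then have "(LINT z|M. cmod (indicator A z *\<^sub>R w - c z *\<^sub>R w)) = (LINT z|M. \<bar>indicator A z - c z\<bar>) * cmod w"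
      by simp
    also have "\<dots> \<le> (LINT z|M. \<bar>indicator A z - c z\<bar>) * (1 + cmod w)"
      by (intro mult_left_mono) auto
    also have "\<dots> < e" using c(3) w by (simp add: pos_less_divide_eq)
    finally show ?thesis .
  qed
  ultimately show ?case by blast
next
  case (add f g)
  obtain c where c: "continuous_on UNIV c" "integrable M c" "(LINT z|M. cmod (f z - c z)) < e / 2"
    using add.IH(1)[of "e / 2"] add.prems by auto
  obtain d where d: "continuous_on UNIV d" "integrable M d" "(LINT z|M. cmod (g z - d z)) < e / 2"
    using add.IH(2)[of "e / 2"] add.prems by auto
  have "(LINT z|M. cmod (f z + g z - (c z + d z))) \<le> (LINT z|M. cmod (f z - c z) + cmod (g z - d z))"
    using add.hyps c(2) d(2)
    by (intro integral_mono) (auto simp: add_diff_add intro: norm_triangle_ineq)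
  also have "\<dots> < e" using add.hyps c d by simp
  finally show ?case using c d
    by (intro exI[of _ "\<lambda>z. c z + d z"]) (auto intro: continuous_intros)
next
  case (lim f s)
  have "(\<lambda>i. LINT z|M. cmod (f z - s i z)) \<longlonglongrightarrow> (LINT z|M. 0)"
  \<comment> \<open>The induction rule supplies approximants with |s i| \<le> 2 |f|; hence the
    factor 3.\<close>
  proof (rule integral_dominated_convergence[where w = "\<lambda>z. 3 * cmod (f z)"])
    show "AE z in M. (\<lambda>i. cmod (f z - s i z)) \<longlonglongrightarrow> 0"
    proof (rule AE_I2)
      fix z assume "z \<in> space M"
      from lim.hyps(2)[OF this] have "(\<lambda>i. f z - s i z) \<longlonglongrightarrow> f z - f z" by (intro tendsto_intros)
      then show "(\<lambda>i. cmod (f z - s i z)) \<longlonglongrightarrow> 0" by (simp add: tendsto_norm_zero)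
    qed
    show "AE z in M. norm (cmod (f z - s i z)) \<le> 3 * cmod (f z)" for i
    proof (rule AE_I2)
      fix z assume "z \<in> space M"
      from lim.hyps(3)[OF this, of i] show "norm (cmod (f z - s i z)) \<le> 3 * cmod (f z)"
        using norm_triangle_ineq4[of "f z" "s i z"] by simp
    qed
  qed (use lim.hyps in auto)
  then have "eventually (\<lambda>i. (LINT z|M. cmod (f z - s i z)) < e / 2) sequentially"
    using lim.prems by (intro order_tendstoD(2)) auto
  then obtain i where i: "(LINT z|M. cmod (f z - s i z)) < e / 2"
    by (auto simp: eventually_sequentially)
  obtain c where c: "continuous_on UNIV c" "integrable M c" "(LINT z|M. cmod (s i z - c z)) < e / 2"
    using lim.IH(1)[of "e / 2" i] lim.prems by auto
  have "(LINT z|M. cmod (f z - c z)) \<le> (LINT z|M. cmod (f z - s i z) + cmod (s i z - c z))"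
    using lim.hyps c by (intro integral_mono) (auto intro: norm_diff_triangle_le)
  also have "\<dots> < e" using lim.hyps c i by simp
  finally show ?case using c by blast
qed

text \<open>Nearest-point projection onto a disk is 1-Lipschitz because the disk is convex, so
  clipping an approximant of an already clipped function can only bring it closer.\<close>

definition clip :: "real \<Rightarrow> complex \<Rightarrow> complex" where
  "clip R = closest_point (cball 0 R)"

lemma clip:
  assumes "0 \<le> R"
  shows "cmod (clip R z) \<le> R" "cmod (clip R z - clip R w) \<le> cmod (z - w)"
    "continuous_on UNIV (clip R)" "cmod z \<le> R \<Longrightarrow> clip R z = z" "cmod (z - clip R z) \<le> cmod z"
proof -
  have ne: "cball (0::complex) R \<noteq> {}" using assms by simp
  show "cmod (clip R z) \<le> R"
    using closest_point_in_set[OF closed_cball ne, of z] by (simp add: clip_def)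
  show "cmod (clip R z - clip R w) \<le> cmod (z - w)"
    using closest_point_lipschitz[OF convex_cball closed_cball ne, of z w] by (simp add: clip_def dist_norm)
  show "continuous_on UNIV (clip R)"
    unfolding clip_def by (rule continuous_on_closest_point[OF convex_cball closed_cball ne])
  show "cmod z \<le> R \<Longrightarrow> clip R z = z"
    by (simp add: clip_def closest_point_self)
  show "cmod (z - clip R z) \<le> cmod z"
    using closest_point_le[OF closed_cball, of 0 0 R z] assms by (simp add: clip_def dist_norm)
qed

lemma clip_measurable:
  assumes "g \<in> borel_measurable M" "0 \<le> R"
  shows "(\<lambda>z. clip R (g z)) \<in> borel_measurable M"
  using borel_measurable_continuous_on[OF clip(3)[OF assms(2)] assms(1)] .

lemma clip_tendsto: "(\<lambda>n. clip (real n) z) \<longlonglongrightarrow> z"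
proof -
  obtain n0 where n0: "cmod z \<le> real n0" using real_arch_simple by blast
  have "eventually (\<lambda>n. clip (real n) z = z) sequentially"
    using eventually_ge_at_top[of n0]
    by eventually_elim (rule clip(4), use n0 in auto)
  then show ?thesis by (rule tendsto_eventually)
qed

lemma L2_clip_approx:
  assumes "sq_int g" "0 < e"
  shows "\<exists>n. norm2 (\<lambda>z. g z - clip (real n) (g z)) < e"
proof -
  have [measurable]: "g \<in> borel_measurable M" and g: "integrable M (\<lambda>z. (cmod (g z))\<^sup>2)"
    using assms by (auto simp: sq_int_def)
  have [measurable]: "(\<lambda>z. clip (real n) (g z)) \<in> borel_measurable M" for n
    by (rule clip_measurable) auto
  have "(\<lambda>n. norm2 (\<lambda>z. g z - clip (real n) (g z))) \<longlonglongrightarrow> (LINT z|M. 0)"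
    unfolding norm2_def
  proof (rule integral_dominated_convergence[where w = "\<lambda>z. (cmod (g z))\<^sup>2"])
    have "(\<lambda>n. (cmod (g z - clip (real n) (g z)))\<^sup>2) \<longlonglongrightarrow> (cmod (g z - g z))\<^sup>2" for z
      by (intro tendsto_intros clip_tendsto)
    then show "AE z in M. (\<lambda>n. (cmod (g z - clip (real n) (g z)))\<^sup>2) \<longlonglongrightarrow> 0" by simp
    show "AE z in M. norm ((cmod (g z - clip (real n) (g z)))\<^sup>2) \<le> (cmod (g z))\<^sup>2" for n
      using clip(5)[of "real n"] by (intro AE_I2) (auto intro: power_mono)
  qed (use g in auto)
  then have "eventually (\<lambda>n. norm2 (\<lambda>z. g z - clip (real n) (g z)) < e) sequentially"
    using assms by (intro order_tendstoD(2)) auto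
  then show ?thesis by (auto simp: eventually_sequentially)
qed

lemma L1_clip_approx:
  assumes "integrable M g" "0 < e"
  shows "\<exists>n. (LINT z|M. cmod (g z - clip (real n) (g z))) < e"
proof -
  have [measurable]: "g \<in> borel_measurable M" using assms by auto
  have [measurable]: "(\<lambda>z. clip (real n) (g z)) \<in> borel_measurable M" for n
    by (rule clip_measurable) auto
  have "(\<lambda>n. LINT z|M. cmod (g z - clip (real n) (g z))) \<longlonglongrightarrow> (LINT z|M. 0)"
  proof (rule integral_dominated_convergence[where w = "\<lambda>z. cmod (g z)"])
    have "(\<lambda>n. cmod (g z - clip (real n) (g z))) \<longlonglongrightarrow> cmod (g z - g z)" for z
      by (intro tendsto_intros clip_tendsto)
    then show "AE z in M. (\<lambda>n. cmod (g z - clip (real n) (g z))) \<longlonglongrightarrow> 0" by simp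
    show "AE z in M. norm (cmod (g z - clip (real n) (g z))) \<le> cmod (g z)" for n
      using clip(5)[of "real n"] by (intro AE_I2) auto
  qed (use assms in auto)
  then have "eventually (\<lambda>n. (LINT z|M. cmod (g z - clip (real n) (g z))) < e) sequentially"
    using assms by (intro order_tendstoD(2)) auto
  then show ?thesis by (auto simp: eventually_sequentially)
qed

text \<open>For two functions bounded by n the square of the difference is at most 2n times the
  difference, so L1-approximation of a truncated function suffices.\<close>

lemma L2_continuous_approx:
  assumes g: "sq_int g" and e: "0 < e"
  shows "\<exists>c. continuous_on UNIV c \<and> sq_int c \<and> norm2 (\<lambda>z. g z - c z) < e"
proof -
  obtain n where n: "norm2 (\<lambda>z. g z - clip (real n) (g z)) < e / 4"
    using L2_clip_approx[OF g, of "e/4"] e by auto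
  define G where "G z = clip (real n) (g z)" for z
  have G: "G \<in> borel_measurable M" "\<And>z. cmod (G z) \<le> real n"
    using clip_measurable[of g "real n"] g clip(1)[of "real n"] by (auto simp: G_def[abs_def] sq_int_def)
  have sG: "sq_int G" using G by (intro sq_int_bounded[where B = "real n"]) auto
  \<comment> \<open>After the factor \<open>2 * real n\<close> at most e / 4 is left; the summand 1
    covers \<open>n = 0\<close>.\<close>
  have "0 < e / (8 * (1 + real n))" using e by simp
  then obtain c0 where c0: "continuous_on UNIV c0" "integrable M c0"
    "(LINT z|M. cmod (G z - c0 z)) < e / (8 * (1 + real n))"
    using L1_continuous_approx[OF sq_int_integrable(1)[OF sG]] by blast
  define c where "c z = clip (real n) (c0 z)" for z
  have c: "continuous_on UNIV c" "\<And>z. cmod (c z) \<le> real n"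
    using continuous_on_compose2[OF clip(3) c0(1)] clip(1)[of "real n"] by (auto simp: c_def)
  have [measurable]: "c \<in> borel_measurable M" using c(1) by (rule measurable_circle_continuous)
  have sc: "sq_int c" using c by (intro sq_int_bounded[where B = "real n"]) auto
  have d: "cmod (G z - c z) \<le> cmod (G z - c0 z)" for z
    using clip(2)[of "real n" "G z" "c0 z"] clip(4)[of "real n" "G z"] G(2)[of z] by (simp add: c_def)
  have "norm2 (\<lambda>z. G z - c z) \<le> (LINT z|M. 2 * real n * cmod (G z - c0 z))"
    unfolding norm2_def
  proof (rule integral_mono)
    show "integrable M (\<lambda>z. (cmod (G z - c z))\<^sup>2)"
      using sq_int_diff(1)[OF sG sc] by (simp add: sq_int_def)
    show "integrable M (\<lambda>z. 2 * real n * cmod (G z - c0 z))"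
      using c0 sq_int_integrable(1)[OF sG] by auto
    fix z
    have "cmod (G z - c z) \<le> 2 * real n"
      using norm_triangle_ineq4[of "G z" "c z"] G(2)[of z] c(2)[of z] by simp
    then show "(cmod (G z - c z))\<^sup>2 \<le> 2 * real n * cmod (G z - c0 z)"
      unfolding power2_eq_square using d by (intro mult_mono) auto
  qed
  also have "\<dots> = 2 * real n * (LINT z|M. cmod (G z - c0 z))" by simp
  also have "\<dots> \<le> 2 * (1 + real n) * (e / (8 * (1 + real n)))"
    using c0(3) by (intro mult_mono) auto
  also have "\<dots> = e / 4" by (simp add: field_simps)
  finally have "norm2 (\<lambda>z. G z - c z) \<le> e / 4" .
  with norm2_triangle[OF g sG sc] n have "norm2 (\<lambda>z. g z - c z) < e"
    by (simp add: G_def)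
  with c sc show ?thesis by blast
qed

section \<open>Fourier coefficients and Fejer means\<close>

declare complex_cnj_power_int [simp del]

lemma cnj_borel_measurable [measurable]:
  "g \<in> borel_measurable N \<Longrightarrow> (\<lambda>z. cnj (g z)) \<in> borel_measurable N"
  by (rule borel_measurable_continuous_on[OF continuous_on_cnj[OF continuous_on_id]])

lemma norm_powi_circle: "cmod z = 1 \<Longrightarrow> cmod (z powi m) = 1"
  by (simp add: norm_power_int)

lemma cnj_powi_circle:
  assumes "cmod z = 1"
  shows "cnj (z powi m) = z powi (- m)"
proof -
  have "z powi m * cnj (z powi m) = 1"
    using norm_powi_circle[OF assms, of m] unfolding complex_norm_square[symmetric] by simp
  moreover have "z powi m * z powi (- m) = 1"
    using assms by (subst power_int_add[symmetric]) auto
  ultimately show ?thesis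
    by (metis mult_cancel_left mult_zero_left zero_neq_one)
qed

lemma powi_measurable [measurable]: "(\<lambda>z::complex. z powi m) \<in> borel_measurable M"
proof (rule measurable_circle_borel)
  show "(\<lambda>z::complex. z powi m) \<in> borel_measurable borel"
    unfolding power_int_def by measurable
qed

lemma fourier_coeff_eq:
  assumes [measurable]: "g \<in> borel_measurable M"
  shows "fourier_coeff g m = (LINT z|M. g z * cnj (z powi m))"
  unfolding fourier_coeff_def pairing_def by (rule set_integral_sphere) measurable

lemma integrable_mult_bounded:
  fixes g h :: "complex \<Rightarrow> complex"
  assumes "integrable M g" and [measurable]: "h \<in> borel_measurable M" and "AE z in M. cmod (h z) \<le> B"
  shows "integrable M (\<lambda>z. g z * h z)"
proof (rule Bochner_Integration.integrable_bound)
  have [measurable]: "g \<in> borel_measurable M" using assms(1) by auto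
  show "(\<lambda>z. g z * h z) \<in> borel_measurable M" by measurable
  show "integrable M (\<lambda>z. B * cmod (g z))" using assms(1) by auto
  show "AE z in M. norm (g z * h z) \<le> norm (B * cmod (g z))"
    using assms(3)
  proof eventually_elim
    case (elim z)
    have "norm (g z * h z) = cmod (h z) * cmod (g z)" by (simp add: norm_mult)
    also have "\<dots> \<le> B * cmod (g z)" using elim by (intro mult_right_mono) auto
    finally show ?case by simp
  qed
qed

lemma integrable_fourier:
  assumes "integrable M g"
  shows "integrable M (\<lambda>z. g z * cnj (z powi m))" "integrable M (\<lambda>z. g z * z powi m)"
proof -
  have *: "AE z in M. cmod (cnj (z powi m)) \<le> 1" "AE z in M. cmod (z powi m) \<le> 1"
    using AE_circle_norm by (eventually_elim, simp add: norm_powi_circle)+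
  show "integrable M (\<lambda>z. g z * cnj (z powi m))"
    by (rule integrable_mult_bounded[OF assms _ *(1)]) measurable
  show "integrable M (\<lambda>z. g z * z powi m)"
    by (rule integrable_mult_bounded[OF assms _ *(2)]) measurable
qed

lemma fourier_coeff_lin:
  assumes "integrable M f" "integrable M g"
  shows "fourier_coeff (\<lambda>z. f z + g z) m = fourier_coeff f m + fourier_coeff g m"
    and "fourier_coeff (\<lambda>z. f z - g z) m = fourier_coeff f m - fourier_coeff g m"
proof -
  have [measurable]: "f \<in> borel_measurable M" "g \<in> borel_measurable M" using assms by auto
  show "fourier_coeff (\<lambda>z. f z + g z) m = fourier_coeff f m + fourier_coeff g m"
    using integrable_fourier(1)[OF assms(1), of m] integrable_fourier(1)[OF assms(2), of m]
    by (simp add: fourier_coeff_eq distrib_right)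
  show "fourier_coeff (\<lambda>z. f z - g z) m = fourier_coeff f m - fourier_coeff g m"
    using integrable_fourier(1)[OF assms(1), of m] integrable_fourier(1)[OF assms(2), of m]
    by (simp add: fourier_coeff_eq left_diff_distrib)
qed

lemma fourier_coeff_cmult:
  assumes [measurable]: "f \<in> borel_measurable M"
  shows "fourier_coeff (\<lambda>z. c * f z) m = c * fourier_coeff f m"
  by (simp add: fourier_coeff_eq mult.assoc)

lemma fourier_coeff_sum:
  assumes "finite A" "\<And>i. i \<in> A \<Longrightarrow> integrable M (g i)"
  shows "fourier_coeff (\<lambda>z. \<Sum>i\<in>A. g i z) m = (\<Sum>i\<in>A. fourier_coeff (g i) m)"
  using assms
proof (induction rule: finite_induct)
  case empty
  then show ?case by (simp add: fourier_coeff_eq)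
next
  case (insert x F)
  then show ?case using fourier_coeff_lin(1)[of "g x" "\<lambda>z. \<Sum>i\<in>F. g i z" m]
    by (auto simp: insert)
qed

lemma fourier_coeff_0:
  assumes [measurable]: "g \<in> borel_measurable M"
  shows "fourier_coeff g 0 = (LINT z|M. g z)"
  by (simp add: fourier_coeff_eq)

lemma fourier_coeff_mult_powi:
  assumes [measurable]: "g \<in> borel_measurable M"
  shows "fourier_coeff (\<lambda>z. g z * z powi j) m = fourier_coeff g (m - j)"
proof -
  have "fourier_coeff (\<lambda>z. g z * z powi j) m = (LINT z|M. g z * z powi j * cnj (z powi m))"
    by (rule fourier_coeff_eq) measurable
  also have "\<dots> = (LINT z|M. g z * cnj (z powi (m - j)))"
  proof (rule integral_cong_AE)
    show "AE z in M. g z * z powi j * cnj (z powi m) = g z * cnj (z powi (m - j))"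
      using AE_circle_norm
    proof eventually_elim
      case (elim z)
      then have "z \<noteq> 0" by auto
      then show ?case using elim
        by (simp add: cnj_powi_circle mult.assoc power_int_add[symmetric])
    qed
  qed measurable
  also have "\<dots> = fourier_coeff g (m - j)"
    by (simp add: fourier_coeff_eq)
  finally show ?thesis .
qed

lemma fourier_coeff_const: "fourier_coeff (\<lambda>z. c) m = (if m = 0 then c else 0)"
proof -
  have "fourier_coeff (\<lambda>z. c) m = c * (LINT z|M. cnj (z powi m))"
    by (simp add: fourier_coeff_eq)
  also have "(LINT z|M. cnj (z powi m)) = cnj (LINT z|M. z powi m)"
    by (rule Bochner_Integration.integral_cnj)
  finally show ?thesis by (simp add: integral_cis_powi)
qed

lemma fourier_coeff_norm_le:
  assumes "integrable M g"
  shows "cmod (fourier_coeff g m) \<le> (LINT z|M. cmod (g z))"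
proof -
  have [measurable]: "g \<in> borel_measurable M" using assms by auto
  have "cmod (fourier_coeff g m) \<le> (LINT z|M. cmod (g z * cnj (z powi m)))"
    unfolding fourier_coeff_eq[OF \<open>g \<in> borel_measurable M\<close>] by (rule integral_norm_bound)
  also have "\<dots> = (LINT z|M. cmod (g z))"
    by (rule integral_cong_AE, measurable)
      (use AE_circle_norm in \<open>eventually_elim, simp add: norm_mult norm_powi_circle\<close>)
  finally show ?thesis .
qed

lemma fourier_coeff_cnj:
  assumes [measurable]: "g \<in> borel_measurable M" and real: "\<And>z. g z \<in> \<real>"
  shows "fourier_coeff g (- m) = cnj (fourier_coeff g m)"
proof -
  have "cnj (fourier_coeff g m) = (LINT z|M. cnj (g z * cnj (z powi m)))"
    by (simp add: fourier_coeff_eq del: complex_cnj_mult)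
  also have "\<dots> = (LINT z|M. g z * cnj (z powi (- m)))"
  proof (rule integral_cong_AE)
    show "AE z in M. cnj (g z * cnj (z powi m)) = g z * cnj (z powi (- m))"
      using AE_circle_norm
    proof eventually_elim
      case (elim z)
      show ?case
        using cnj_powi_circle[OF elim, of m] cnj_powi_circle[OF elim, of "-m"] Reals_cnj_iff[of "g z"] real[of z]
        by (simp)
    qed
  qed measurable
  finally show ?thesis by (simp add: fourier_coeff_eq)
qed

text \<open>The difference m = a - b occurs N + 1 - |m| times, so these are the classical means with
  weights 1 - |m| / (N + 1). Summing over pairs exhibits the kernel as a squared modulus, hence as
  nonnegative.\<close>

definition fejer :: "nat \<Rightarrow> (complex \<Rightarrow> complex) \<Rightarrow> complex \<Rightarrow> complex" where
  "fejer N g z = (\<Sum>a\<le>N. \<Sum>b\<le>N. fourier_coeff g (int a - int b) * z powi (int a - int b)) / of_nat (Suc N)"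

definition fejer_kernel :: "nat \<Rightarrow> complex \<Rightarrow> complex \<Rightarrow> real" where
  "fejer_kernel N z s = (cmod (\<Sum>a\<le>N. (z * cnj s) ^ a))\<^sup>2 / Suc N"

lemma fejer_kernel_nonneg [simp]: "0 \<le> fejer_kernel N z s"
  by (simp add: fejer_kernel_def)

lemma fejer_kernel_measurable [measurable]: "fejer_kernel N z \<in> borel_measurable M"
  unfolding fejer_kernel_def by (intro measurable_circle_continuous continuous_intros) auto

lemma fejer_kernel_expand:
  assumes "cmod z = 1" "cmod s = 1"
  shows "complex_of_real (fejer_kernel N z s) =
    (\<Sum>a\<le>N. \<Sum>b\<le>N. z powi (int a - int b) * cnj (s powi (int a - int b))) / of_nat (Suc N)"
proof -
  have nz: "z \<noteq> 0" "s \<noteq> 0" using assms by auto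
  have q: "cmod (z * cnj s) = 1" using assms by (simp add: norm_mult)
  have "complex_of_real ((cmod (\<Sum>a\<le>N. (z * cnj s) ^ a))\<^sup>2) =
      (\<Sum>a\<le>N. (z * cnj s) ^ a) * cnj (\<Sum>a\<le>N. (z * cnj s) ^ a)"
    by (rule complex_norm_square)
  also have "\<dots> = (\<Sum>a\<le>N. \<Sum>b\<le>N. (z * cnj s) ^ a * cnj ((z * cnj s) ^ b))"
    by (simp add: sum_product)
  also have "\<dots> = (\<Sum>a\<le>N. \<Sum>b\<le>N. z powi (int a - int b) * cnj (s powi (int a - int b)))"
  proof (intro sum.cong refl)
    fix a b
    have "cnj ((z * cnj s) ^ b) = (z * cnj s) powi (- int b)"
      using cnj_powi_circle[OF q, of "int b"] by simp
    then have "(z * cnj s) ^ a * cnj ((z * cnj s) ^ b) = (z * cnj s) powi (int a) * (z * cnj s) powi (- int b)"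
      by simp
    also have "\<dots> = (z * cnj s) powi (int a - int b)"
      using nz by (subst power_int_add[symmetric]) auto
    also have "\<dots> = z powi (int a - int b) * cnj (s powi (int a - int b))"
      by (simp add: power_int_mult_distrib complex_cnj_power_int)
    finally show "(z * cnj s) ^ a * cnj ((z * cnj s) ^ b) = z powi (int a - int b) * cnj (s powi (int a - int b))" .
  qed
  finally show ?thesis by (simp add: fejer_kernel_def)
qed

lemma fejer_integral:
  assumes g: "integrable M g" and z: "cmod z = 1"
  shows "integrable M (\<lambda>s. g s * of_real (fejer_kernel N z s))"
    "fejer N g z = (LINT s|M. g s * of_real (fejer_kernel N z s))"
proof -
  have [measurable]: "g \<in> borel_measurable M" using g by auto
  define G where "G s = (\<Sum>a\<le>N. \<Sum>b\<le>N. z powi (int a - int b) * (g s * cnj (s powi (int a - int b)))) / of_nat (Suc N)" for s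
  have G: "AE s in M. G s = g s * of_real (fejer_kernel N z s)"
    using AE_circle_norm
  proof eventually_elim
    case (elim s)
    show ?case
      unfolding G_def fejer_kernel_expand[OF z elim] times_divide_eq_right sum_distrib_left
      by (simp only: mult.left_commute)
  qed
  have iG: "integrable M G" unfolding G_def
    by (intro integrable_fourier g Bochner_Integration.integrable_sum integrable_mult_right integrable_divide)
  have mK: "(\<lambda>s. g s * of_real (fejer_kernel N z s)) \<in> borel_measurable M" by measurable
  show "integrable M (\<lambda>s. g s * of_real (fejer_kernel N z s))"
    using integrable_cong_AE[OF _ mK G] iG by auto
  have "(LINT s|M. g s * of_real (fejer_kernel N z s)) = (LINT s|M. G s)"
    using G iG mK by (intro integral_cong_AE) auto
  also have "\<dots> = fejer N g z" unfolding G_def fejer_def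
    by (simp add: Bochner_Integration.integral_sum integrable_fourier[OF g] fourier_coeff_eq
        Bochner_Integration.integrable_sum mult.commute del: of_nat_Suc)
  finally show "fejer N g z = (LINT s|M. g s * of_real (fejer_kernel N z s))" ..
qed

lemma fejer_const: "fejer N (\<lambda>z. c) z = c"
proof -
  have "(\<Sum>a\<le>N. \<Sum>b\<le>N. fourier_coeff (\<lambda>z. c) (int a - int b) * z powi (int a - int b)) = (\<Sum>a\<le>N. \<Sum>b\<le>N. if b = a then c else 0)"
    by (intro sum.cong refl) (auto simp: fourier_coeff_const)
  also have "\<dots> = c * of_nat (Suc N)" by simp
  finally show ?thesis unfolding fejer_def by (simp del: of_nat_Suc)
qed

text \<open>Both claims come from applying \<open>fejer_integral\<close> to the constant 1, which is
  its own Fejer mean.\<close>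

lemma fejer_kernel_integral:
  assumes z: "cmod z = 1"
  shows "integrable M (fejer_kernel N z)" "(LINT s|M. fejer_kernel N z s) = 1"
proof -
  have 1: "integrable M (\<lambda>s. 1::complex)" by simp
  have i: "integrable M (\<lambda>s. complex_of_real (fejer_kernel N z s))"
    using fejer_integral(1)[OF 1 z, of N] by simp
  then show i': "integrable M (fejer_kernel N z)" by (simp add: complex_of_real_integrable_eq)
  have "complex_of_real (LINT s|M. fejer_kernel N z s) = 1"
    using fejer_integral(2)[OF 1 z, of N] by (simp add: fejer_const)
  then show "(LINT s|M. fejer_kernel N z s) = 1" by (simp only: of_real_eq_1_iff)
qed

text \<open>With q = z cnj(s) one has |1 - q| = |s - z|, and the geometric sum is (1 - q^(N+1)) / (1
  - q) with numerator at most 2 in modulus; the constant 4 is the square of that 2.\<close>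

lemma fejer_kernel_le:
  assumes "cmod z = 1" "cmod s = 1" "0 < d" "d \<le> cmod (z - s)"
  shows "fejer_kernel N z s \<le> 4 / (d\<^sup>2 * Suc N)"
proof -
  define q where "q = z * cnj s"
  have q: "cmod q = 1" using assms by (simp add: q_def norm_mult)
  have "cmod (1 - q) = cmod (s * (1 - q))" using assms by (simp add: norm_mult)
  also have "s * (1 - q) = s - z"
    using assms(2) complex_norm_square[of s] by (simp add: q_def algebra_simps)
  finally have d: "d \<le> cmod (1 - q)" using assms(4) by (simp add: norm_minus_commute)
  have "(1 - q) * (\<Sum>a\<le>N. q ^ a) = 1 - q ^ Suc N"
    by (rule sum_gp_basic)
  then have "cmod (1 - q) * cmod (\<Sum>a\<le>N. q ^ a) = cmod (1 - q ^ Suc N)"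
    by (simp only: norm_mult[symmetric])
  also have "\<dots> \<le> 2"
    using norm_triangle_ineq4[of 1 "q ^ Suc N"] q by (simp add: norm_power norm_mult)
  finally have "d * cmod (\<Sum>a\<le>N. q ^ a) \<le> 2"
    using mult_right_mono[OF d, of "cmod (\<Sum>a\<le>N. q ^ a)"] by simp
  then have "(d * cmod (\<Sum>a\<le>N. q ^ a))\<^sup>2 \<le> 2\<^sup>2"
    using assms(3) by (intro power_mono) auto
  then have "(cmod (\<Sum>a\<le>N. q ^ a))\<^sup>2 \<le> 4 / d\<^sup>2"
    using assms(3) by (simp add: field_simps power_mult_distrib)
  then have "(cmod (\<Sum>a\<le>N. q ^ a))\<^sup>2 / Suc N \<le> 4 / d\<^sup>2 / Suc N"
    by (intro divide_right_mono) auto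
  then show ?thesis by (simp add: fejer_kernel_def q_def)
qed

text \<open>Only the part of \<open>g\<close> away from \<open>z\<close>, where the kernel is small, can exceed the bound
  \<open>B\<close>.\<close>

lemma fejer_local_bound:
  assumes g: "integrable M g" and z: "cmod z = 1" and d: "0 < d"
    and loc: "AE s in M. cmod (z - s) < d \<longrightarrow> cmod (g s) \<le> B" and B: "0 \<le> B"
  shows "cmod (fejer N g z) \<le> B + 4 / d\<^sup>2 * (LINT s|M. cmod (g s)) / Suc N"
proof -
  have [measurable]: "g \<in> borel_measurable M" using g by auto
  have "cmod (fejer N g z) \<le> (LINT s|M. cmod (g s * of_real (fejer_kernel N z s)))"
    unfolding fejer_integral(2)[OF g z] by (rule integral_norm_bound)
  also have "\<dots> \<le> (LINT s|M. B * fejer_kernel N z s + 4 / (d\<^sup>2 * Suc N) * cmod (g s))"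
  proof (rule integral_mono_AE)
    show "AE s in M. cmod (g s * of_real (fejer_kernel N z s)) \<le> B * fejer_kernel N z s + 4 / (d\<^sup>2 * Suc N) * cmod (g s)"
      using loc AE_circle_norm
    proof eventually_elim
      case (elim s)
      show ?case
      proof (cases "cmod (z - s) < d")
        case True
        then have "cmod (g s) * fejer_kernel N z s \<le> B * fejer_kernel N z s"
          using elim by (intro mult_right_mono) auto
        then show ?thesis by (simp add: norm_mult add_increasing2)
      next
        case False
        then have "fejer_kernel N z s * cmod (g s) \<le> 4 / (d\<^sup>2 * Suc N) * cmod (g s)"
          using elim z d by (intro mult_right_mono fejer_kernel_le) auto
        then show ?thesis using B by (simp add: norm_mult add_increasing mult.commute)
      qed
    qed
  qed (use fejer_integral(1)[OF g z] fejer_kernel_integral(1)[OF z] g in auto)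
  also have "\<dots> = B + 4 / d\<^sup>2 * (LINT s|M. cmod (g s)) / Suc N"
    using fejer_kernel_integral[OF z] g by simp
  finally show ?thesis .
qed

lemma fejer_lin:
  assumes "integrable M f" "integrable M g"
  shows "fejer N (\<lambda>z. f z - g z) z = fejer N f z - fejer N g z"
  using assms unfolding fejer_def
  by (simp add: fourier_coeff_lin sum_subtractf left_diff_distrib diff_divide_distrib del: of_nat_Suc)

text \<open>The local bound is applied to \<open>c s - c z\<close> as a function of
  \<open>s\<close>; uniform continuity supplies one radius for all \<open>z\<close>.\<close>

lemma fejer_continuous_uniform:
  assumes c: "continuous_on UNIV c" and e: "0 < e"
  shows "\<exists>N0. \<forall>N\<ge>N0. \<forall>z. cmod z = 1 \<longrightarrow> cmod (fejer N c z - c z) \<le> e"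
proof -
  have "uniformly_continuous_on (sphere 0 1) c"
    by (rule compact_uniformly_continuous[OF continuous_on_subset[OF c]]) auto
  then obtain d where d: "0 < d"
    "\<And>z s. cmod z = 1 \<Longrightarrow> cmod s = 1 \<Longrightarrow> cmod (s - z) < d \<Longrightarrow> cmod (c s - c z) < e / 2"
    unfolding uniformly_continuous_on_def dist_norm using e
    by (metis (no_types, lifting) half_gt_zero mem_sphere_0)
  obtain B where B: "\<And>z. cmod z = 1 \<Longrightarrow> cmod (c z) \<le> B"
    using continuous_bounded_on_circle[OF c] by blast
  have B0: "0 \<le> B" using B[of 1] order_trans[OF norm_ge_zero[of "c 1"]] by simp
  have mc[measurable]: "c \<in> borel_measurable M" using c by (rule measurable_circle_continuous)
  have ic: "integrable M c"
    by (rule circle.integrable_const_bound[where B = B]) (use AE_circle_norm B in \<open>auto elim!: eventually_mono\<close>)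
  \<comment> \<open>Makes the contribution of far points, at most 8 B / (d^2 (N + 1)), no larger
    than e / 2.\<close>
  obtain N0 :: nat where N0: "16 * B / (d\<^sup>2 * e) < real N0" using reals_Archimedean2 by blast
  show ?thesis
  proof (intro exI[of _ N0] allI impI)
    fix N z assume N: "N0 \<le> N" and z: "cmod z = 1"
    have i: "integrable M (\<lambda>s. c s - c z)" using ic by simp
    have "fejer N c z - c z = fejer N (\<lambda>s. c s - c z) z"
      using fejer_lin[OF ic, of "\<lambda>_. c z" N z] by (simp add: fejer_const)
    also have "cmod \<dots> \<le> e / 2 + 4 / d\<^sup>2 * (LINT s|M. cmod (c s - c z)) / Suc N"
    proof (rule fejer_local_bound[OF i z d(1)])
      show "AE s in M. cmod (z - s) < d \<longrightarrow> cmod (c s - c z) \<le> e / 2"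
        using AE_circle_norm
        by eventually_elim (use d(2)[OF z] in \<open>auto simp: norm_minus_commute less_imp_le\<close>)
    qed (use e in auto)
    also have "(LINT s|M. cmod (c s - c z)) \<le> (LINT s|M. 2 * B)"
    proof (rule integral_mono_AE)
      show "AE s in M. cmod (c s - c z) \<le> 2 * B"
        using AE_circle_norm
      proof eventually_elim
        case (elim s)
        show ?case using norm_triangle_ineq4[of "c s" "c z"] B[OF elim] B[OF z] by simp
      qed
    qed (use i in auto)
    then have "4 / d\<^sup>2 * (LINT s|M. cmod (c s - c z)) / Suc N \<le> 4 / d\<^sup>2 * (2 * B) / Suc N"
      by (intro divide_right_mono mult_left_mono) auto
    also have "4 / d\<^sup>2 * (2 * B) / Suc N \<le> e / 2"
    proof -
      have "16 * B / (d\<^sup>2 * e) < Suc N" using N0 N by simp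
      then have "16 * B < Suc N * (d\<^sup>2 * e)"
        using d(1) e by (simp add: pos_divide_less_eq del: of_nat_Suc)
      then show ?thesis using d(1)
        by (simp add: pos_divide_le_eq field_simps del: of_nat_Suc)
    qed
    finally show "cmod (fejer N c z - c z) \<le> e" by simp
  qed
qed

lemma integral_fejer:
  assumes "integrable M g"
  shows "integrable M (fejer N g)" "(LINT z|M. fejer N g z) = (LINT z|M. g z)"
proof -
  have [measurable]: "g \<in> borel_measurable M" using assms by auto
  have p: "integrable M (\<lambda>z. z powi m)" for m
    using integrable_fourier(2)[of "\<lambda>_. 1" m] by simp
  show "integrable M (fejer N g)" unfolding fejer_def
    by (intro integrable_divide Bochner_Integration.integrable_sum integrable_mult_right p)
  have "(LINT z|M. fejer N g z) = (\<Sum>a\<le>N. \<Sum>b\<le>N. fourier_coeff g (int a - int b) * (LINT z|M. z powi (int a - int b))) / of_nat (Suc N)"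
    unfolding fejer_def
    by (simp add: Bochner_Integration.integral_sum Bochner_Integration.integrable_sum p del: of_nat_Suc)
  also have "(\<Sum>a\<le>N. \<Sum>b\<le>N. fourier_coeff g (int a - int b) * (LINT z|M. z powi (int a - int b)))
      = (\<Sum>a\<le>N. \<Sum>b\<le>N. if b = a then fourier_coeff g 0 else 0)"
    by (intro sum.cong refl) (auto simp: integral_cis_powi)
  also have "\<dots> = fourier_coeff g 0 * of_nat (Suc N)" by simp
  finally show "(LINT z|M. fejer N g z) = (LINT z|M. g z)"
    by (simp add: fourier_coeff_0 del: of_nat_Suc)
qed

lemma fejer_measurable [measurable]: "fejer N g \<in> borel_measurable M"
  unfolding fejer_def by measurable

lemma sq_int_sum:
  assumes "finite A" "\<And>i. i \<in> A \<Longrightarrow> sq_int (g i)"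
  shows "sq_int (\<lambda>z. \<Sum>i\<in>A. g i z)"
  using assms
proof (induction rule: finite_induct)
  case empty
  then show ?case by (auto intro: sq_int_bounded[where B = 0])
qed (auto intro: sq_int_add)

lemma sq_int_powi: "sq_int (\<lambda>z. z powi m)"
  by (rule sq_int_bounded[where B = 1])
    (use AE_circle_norm in \<open>auto simp: norm_powi_circle elim!: eventually_mono\<close>)

lemma sq_int_fejer: "sq_int (fejer N g)"
proof -
  have "sq_int (\<lambda>z. (1 / of_nat (Suc N)) * (\<Sum>a\<le>N. \<Sum>b\<le>N. fourier_coeff g (int a - int b) * z powi (int a - int b)))"
    by (intro sq_int_cmult(1) sq_int_sum sq_int_powi) auto
  then show ?thesis by (simp add: fejer_def[abs_def] del: of_nat_Suc)
qed

text \<open>The kernel is a probability density, so Cauchy-Schwarz with the weight split into two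
  square roots is Jensen's inequality. The right-hand side is again a Fejer mean, so its integral
  over \<open>z\<close> is known, and contractivity in L2 follows.\<close>

lemma fejer_Jensen:
  assumes g: "sq_int g" and z: "cmod z = 1"
  shows "(cmod (fejer N g z))\<^sup>2 \<le> Re (fejer N (\<lambda>s. of_real ((cmod (g s))\<^sup>2)) z)"
proof -
  have [measurable]: "g \<in> borel_measurable M" and gi: "integrable M (\<lambda>s. (cmod (g s))\<^sup>2)"
    using g by (auto simp: sq_int_def)
  have gi': "integrable M (\<lambda>s. complex_of_real ((cmod (g s))\<^sup>2))"
    using gi by (simp only: complex_of_real_integrable_eq)
  let ?K = "fejer_kernel N z"
  have gK: "integrable M (\<lambda>s. (cmod (g s))\<^sup>2 * ?K s)"
    using fejer_integral(1)[OF gi' z, of N] unfolding of_real_mult[symmetric] by (simp only: complex_of_real_integrable_eq)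
  have "cmod (fejer N g z) \<le> (LINT s|M. cmod (g s * of_real (?K s)))"
    unfolding fejer_integral(2)[OF sq_int_integrable(1)[OF g] z] by (rule integral_norm_bound)
  also have "\<dots> = (LINT s|M. (cmod (g s) * sqrt (?K s)) * sqrt (?K s))"
    by (simp add: norm_mult mult.assoc)
  finally have "(cmod (fejer N g z))\<^sup>2 \<le> (LINT s|M. (cmod (g s) * sqrt (?K s)) * sqrt (?K s))\<^sup>2"
    by (intro power_mono) auto
  also have "\<dots> \<le> (LINT s|M. (cmod (g s) * sqrt (?K s))\<^sup>2) * (LINT s|M. (sqrt (?K s))\<^sup>2)"
    by (rule integral_Cauchy_Schwarz(2))
      (use gK fejer_kernel_integral[OF z] in \<open>auto simp: power_mult_distrib\<close>)
  also have "\<dots> = (LINT s|M. (cmod (g s))\<^sup>2 * ?K s)"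
    using fejer_kernel_integral[OF z] by (simp add: power_mult_distrib)
  also have "\<dots> = Re (fejer N (\<lambda>s. of_real ((cmod (g s))\<^sup>2)) z)"
    unfolding fejer_integral(2)[OF gi' z] of_real_mult[symmetric] integral_complex_of_real by simp
  finally show ?thesis .
qed

lemma norm2_fejer_le:
  assumes g: "sq_int g"
  shows "norm2 (fejer N g) \<le> norm2 g"
proof -
  let ?G = "\<lambda>s. complex_of_real ((cmod (g s))\<^sup>2)"
  have gi: "integrable M (\<lambda>s. (cmod (g s))\<^sup>2)" using g by (auto simp: sq_int_def)
  have gi': "integrable M ?G"
    using gi by (simp only: complex_of_real_integrable_eq)
  have "norm2 (fejer N g) \<le> (LINT z|M. Re (fejer N ?G z))" unfolding norm2_def
  proof (rule integral_mono_AE)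
    show "integrable M (\<lambda>z. (cmod (fejer N g z))\<^sup>2)" using sq_int_fejer by (simp add: sq_int_def)
    show "integrable M (\<lambda>z. Re (fejer N ?G z))" using integral_fejer(1)[OF gi'] by (rule integrable_Re)
    show "AE z in M. (cmod (fejer N g z))\<^sup>2 \<le> Re (fejer N ?G z)"
      using AE_circle_norm by eventually_elim (rule fejer_Jensen[OF g])
  qed
  also have "\<dots> = Re (LINT z|M. fejer N ?G z)"
    by (rule integral_Re[OF integral_fejer(1)[OF gi']])
  also have "\<dots> = norm2 g"
    unfolding integral_fejer(2)[OF gi'] integral_complex_of_real by (simp add: norm2_def)
  finally show ?thesis .
qed

text \<open>Contractivity of the means carries the uniform convergence for continuous functions over
  to L2.\<close>

theorem fejer_L2_convergence:
  assumes g: "sq_int g"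
  shows "(\<lambda>N. norm2 (\<lambda>z. fejer N g z - g z)) \<longlonglongrightarrow> 0"
proof (rule LIMSEQ_I)
  fix e :: real assume e: "0 < e"
  \<comment> \<open>Two uses of the inequality with factor 2 add up to 2/16 + 4/16 + 4/16 of
    \<open>e\<close>.\<close>
  obtain c where c: "continuous_on UNIV c" "sq_int c" "norm2 (\<lambda>z. g z - c z) < e / 16"
    using L2_continuous_approx[OF g, of "e / 16"] e by auto
  have "0 < sqrt (e / 16)" using e by simp
  then obtain N0 where N0: "\<And>N z. N \<ge> N0 \<Longrightarrow> cmod z = 1 \<Longrightarrow> cmod (fejer N c z - c z) \<le> sqrt (e / 16)"
    using fejer_continuous_uniform[OF c(1)] by metis
  have "norm2 (\<lambda>z. fejer N g z - g z) < e" if N: "N \<ge> N0" for N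
  proof -
    have gc: "sq_int (\<lambda>z. g z - c z)" using g c by (intro sq_int_diff)
    have 1: "norm2 (\<lambda>z. fejer N g z - fejer N c z) \<le> norm2 (\<lambda>z. g z - c z)"
      using norm2_fejer_le[OF gc, of N]
      by (simp only: fejer_lin[OF sq_int_integrable(1)[OF g] sq_int_integrable(1)[OF c(2)], symmetric])
    have fc: "sq_int (\<lambda>z. fejer N c z - c z)" by (intro sq_int_diff sq_int_fejer c)
    have "norm2 (\<lambda>z. fejer N c z - c z) \<le> (LINT z|M. e / 16)" unfolding norm2_def
    proof (rule integral_mono_AE)
      show "AE z in M. (cmod (fejer N c z - c z))\<^sup>2 \<le> e / 16"
        using AE_circle_norm
      proof eventually_elim
        case (elim z)
        have "(cmod (fejer N c z - c z))\<^sup>2 \<le> (sqrt (e / 16))\<^sup>2"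
          by (intro power_mono N0 N elim) auto
        then show ?case using e by simp
      qed
    qed (use fc in \<open>auto simp: sq_int_def\<close>)
    then have 2: "norm2 (\<lambda>z. fejer N c z - c z) \<le> e / 16" by simp
    have "norm2 (\<lambda>z. fejer N g z - g z)
        \<le> 2 * norm2 (\<lambda>z. fejer N g z - fejer N c z) + 2 * norm2 (\<lambda>z. fejer N c z - g z)"
      by (intro norm2_triangle sq_int_fejer g)
    also have "norm2 (\<lambda>z. fejer N c z - g z) \<le> 2 * norm2 (\<lambda>z. fejer N c z - c z) + 2 * norm2 (\<lambda>z. c z - g z)"
      by (intro norm2_triangle sq_int_fejer g c)
    finally show ?thesis using 1 2 c(3) norm2_commute[of c g] e by simp
  qed
  then show "\<exists>N0. \<forall>N\<ge>N0. norm (norm2 (\<lambda>z. fejer N g z - g z) - 0) < e" by auto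
qed

section \<open>The Hardy space\<close>

lemma hardy2_iff: "g \<in> hardy2 \<longleftrightarrow> sq_int g \<and> (\<forall>m<0. fourier_coeff g m = 0)"
proof -
  have sq: "cmod (g z) powr 2 = (cmod (g z))\<^sup>2" for z by simp
  have "g \<in> Lp_space 2 (sphere 0 1) \<longleftrightarrow> sq_int g"
  proof (cases "g \<in> borel_measurable M")
    case True
    then have "(\<lambda>z. (cmod (g z))\<^sup>2) \<in> borel_measurable M" by measurable
    with True show ?thesis
      unfolding Lp_space_def sq_int_def sq by (simp add: set_measurable_sphere set_integral_sphere(2))
  qed (simp add: Lp_space_def sq_int_def set_measurable_sphere)
  then show ?thesis by (auto simp: hardy2_def)
qed

lemma hardy2D: "g \<in> hardy2 \<Longrightarrow> sq_int g" "g \<in> hardy2 \<Longrightarrow> m < 0 \<Longrightarrow> fourier_coeff g m = 0"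
  by (auto simp: hardy2_iff)

lemma hardy2_add: "f \<in> hardy2 \<Longrightarrow> g \<in> hardy2 \<Longrightarrow> (\<lambda>z. f z + g z) \<in> hardy2"
  by (simp add: hardy2_iff sq_int_add(1) fourier_coeff_lin(1) sq_int_integrable(1))

lemma hardy2_diff: "f \<in> hardy2 \<Longrightarrow> g \<in> hardy2 \<Longrightarrow> (\<lambda>z. f z - g z) \<in> hardy2"
  by (simp add: hardy2_iff sq_int_diff(1) fourier_coeff_lin(2) sq_int_integrable(1))

lemma hardy2_cmult: "f \<in> hardy2 \<Longrightarrow> (\<lambda>z. c * f z) \<in> hardy2"
  by (simp add: hardy2_iff sq_int_cmult(1) fourier_coeff_cmult sq_int_measurable)

lemma sq_int_poly: "sq_int (poly p)"
proof -
  have c: "continuous_on UNIV (poly p)" by (intro continuous_intros)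
  obtain B where "\<And>z. cmod z = 1 \<Longrightarrow> cmod (poly p z) \<le> B"
    using continuous_bounded_on_circle[OF c] by blast
  then show ?thesis
    using measurable_circle_continuous[OF c] AE_circle_norm
    by (intro sq_int_bounded[where B = B]) (auto elim!: eventually_mono)
qed

lemma fourier_coeff_mult_poly:
  assumes g: "integrable M g"
  shows "fourier_coeff (\<lambda>z. g z * poly p z) m = (\<Sum>i\<le>degree p. coeff p i * fourier_coeff g (m - int i))"
proof -
  have [measurable]: "g \<in> borel_measurable M" using g by auto
  have "fourier_coeff (\<lambda>z. g z * poly p z) m = fourier_coeff (\<lambda>z. \<Sum>i\<le>degree p. coeff p i * (g z * z powi int i)) m"
    by (simp add: poly_altdef sum_distrib_left mult.left_commute)
  also have "\<dots> = (\<Sum>i\<le>degree p. fourier_coeff (\<lambda>z. coeff p i * (g z * z powi int i)) m)"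
    by (rule fourier_coeff_sum) (intro finite_atMost integrable_mult_right integrable_fourier(2)[OF g])+
  also have "\<dots> = (\<Sum>i\<le>degree p. coeff p i * fourier_coeff g (m - int i))"
    by (simp add: fourier_coeff_cmult fourier_coeff_mult_powi del: power_int_of_nat)
  finally show ?thesis .
qed

lemma fourier_coeff_poly:
  "fourier_coeff (poly p) m = (if 0 \<le> m then coeff p (nat m) else 0)"
proof -
  have "fourier_coeff (\<lambda>z. 1 * poly p z) m = (\<Sum>i\<le>degree p. coeff p i * fourier_coeff (\<lambda>z. 1) (m - int i))"
    by (rule fourier_coeff_mult_poly) simp
  also have "\<dots> = (\<Sum>i\<le>degree p. if i = nat m \<and> 0 \<le> m then coeff p i else 0)"
    by (intro sum.cong refl) (auto simp: fourier_coeff_const)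
  also have "\<dots> = (if 0 \<le> m then coeff p (nat m) else 0)"
    by (auto simp: coeff_eq_0)
  finally show ?thesis by simp
qed

lemma poly_hardy2: "poly p \<in> hardy2"
  by (simp add: hardy2_iff sq_int_poly fourier_coeff_poly)

text \<open>Restricting to b \<le> a keeps the analytic half of the Fejer mean, which is all of it
  when the coefficients of negative index vanish. On this range the natural number subtraction
  \<open>a - b\<close> never truncates.\<close>

definition fejer_poly :: "nat \<Rightarrow> (complex \<Rightarrow> complex) \<Rightarrow> complex poly" where
  "fejer_poly N g = (\<Sum>a\<le>N. \<Sum>b\<le>a. monom (fourier_coeff g (int a - int b) / of_nat (Suc N)) (a - b))"

lemma coeff_0_fejer_poly: "coeff (fejer_poly N g) 0 = fourier_coeff g 0"
proof -
  have "coeff (fejer_poly N g) 0 = (\<Sum>a\<le>N. \<Sum>b\<le>a. if b = a then fourier_coeff g 0 / of_nat (Suc N) else 0)"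
    unfolding fejer_poly_def coeff_sum by (intro sum.cong refl) (auto simp del: of_nat_Suc)
  also have "\<dots> = fourier_coeff g 0"
    by (simp del: of_nat_Suc) 
  finally show ?thesis .
qed

lemma poly_fejer_poly:
  assumes "g \<in> hardy2"
  shows "poly (fejer_poly N g) z = fejer N g z"
proof -
  have "(\<Sum>a\<le>N. \<Sum>b\<le>N. fourier_coeff g (int a - int b) * z powi (int a - int b))
      = (\<Sum>a\<le>N. \<Sum>b\<le>a. fourier_coeff g (int a - int b) * z ^ (a - b))"
  proof (rule sum.cong[OF refl])
    fix a assume a: "a \<in> {..N}"
    have "(\<Sum>b\<le>N. fourier_coeff g (int a - int b) * z powi (int a - int b))
        = (\<Sum>b\<le>a. fourier_coeff g (int a - int b) * z powi (int a - int b))"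
      using a hardy2D(2)[OF assms] by (intro sum.mono_neutral_right) auto
    also have "\<dots> = (\<Sum>b\<le>a. fourier_coeff g (int a - int b) * z ^ (a - b))"
      by (intro sum.cong refl) (simp flip: of_nat_diff)
    finally show "(\<Sum>b\<le>N. fourier_coeff g (int a - int b) * z powi (int a - int b))
        = (\<Sum>b\<le>a. fourier_coeff g (int a - int b) * z ^ (a - b))" .
  qed
  then show ?thesis
    unfolding fejer_def fejer_poly_def
    by (simp add: poly_sum poly_monom sum_divide_distrib del: of_nat_Suc)
qed

lemma hardy2_poly_approx:
  assumes "g \<in> hardy2"
  shows "(\<lambda>N. norm2 (\<lambda>z. poly (fejer_poly N g) z - g z)) \<longlonglongrightarrow> 0"
  using fejer_L2_convergence[OF hardy2D(1)[OF assms]] by (simp add: poly_fejer_poly[OF assms])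

section \<open>Products and exponentials in the Hardy space\<close>

lemma fourier_coeff_tendsto:
  assumes "\<And>n. integrable M (g n)" "integrable M h"
    and "(\<lambda>n. LINT z|M. cmod (g n z - h z)) \<longlonglongrightarrow> 0"
  shows "(\<lambda>n. fourier_coeff (g n) m) \<longlonglongrightarrow> fourier_coeff h m"
proof -
  have "(\<lambda>n. fourier_coeff (g n) m - fourier_coeff h m) \<longlonglongrightarrow> 0"
  proof (rule Lim_null_comparison[OF _ assms(3)])
    have "norm (fourier_coeff (g n) m - fourier_coeff h m) \<le> (LINT z|M. cmod (g n z - h z))" for n
      using fourier_coeff_norm_le[of "\<lambda>z. g n z - h z" m] assms(1,2)
      by (simp add: fourier_coeff_lin(2))
    then show "\<forall>\<^sub>F n in sequentially. norm (fourier_coeff (g n) m - fourier_coeff h m) \<le> (LINT z|M. cmod (g n z - h z))"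
      by simp
  qed
  then show ?thesis by (simp add: LIM_zero_iff)
qed

lemma hardy2_mult_tendsto:
  assumes g: "g \<in> hardy2" and u: "sq_int u"
  shows "(\<lambda>N. fourier_coeff (\<lambda>z. u z * poly (fejer_poly N g) z) m) \<longlonglongrightarrow> fourier_coeff (\<lambda>z. u z * g z) m"
proof (rule fourier_coeff_tendsto)
  let ?p = "\<lambda>N. poly (fejer_poly N g)"
  have sg: "sq_int g" using g by (rule hardy2D)
  show "integrable M (\<lambda>z. u z * ?p N z)" for N
    by (rule sq_int_mult_integrable(1)[OF u sq_int_poly])
  show "integrable M (\<lambda>z. u z * g z)"
    by (rule sq_int_mult_integrable(1)[OF u sg])
  have lim: "(\<lambda>N. sqrt (norm2 u) * sqrt (norm2 (\<lambda>z. ?p N z - g z))) \<longlonglongrightarrow> 0"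
    using tendsto_mult[OF tendsto_const tendsto_real_sqrt[OF hardy2_poly_approx[OF g]], of "sqrt (norm2 u)"] by simp
  show "(\<lambda>N. LINT z|M. cmod (u z * ?p N z - u z * g z)) \<longlonglongrightarrow> 0"
  proof (rule Lim_null_comparison[OF always_eventually lim], rule allI)
    fix N
    have "0 \<le> (LINT z|M. cmod (u z * ?p N z - u z * g z))" by simp
    then show "norm (LINT z|M. cmod (u z * ?p N z - u z * g z)) \<le> sqrt (norm2 u) * sqrt (norm2 (\<lambda>z. ?p N z - g z))"
      using sq_int_mult_integrable(3)[OF u sq_int_diff(1)[OF sq_int_poly sg], of "fejer_poly N g"]
      by (simp add: norm_mult flip: right_diff_distrib)
  qed
qed

text \<open>The product is in general only integrable and need not lie in H2, but its coefficients
  still depend continuously on \<open>g\<close>. The polynomials replacing \<open>g\<close> all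
  share its coefficient of index 0, so for \<open>m \<le> 0\<close> the coefficients of the product
  do not depend on N.\<close>

theorem hardy2_mult:
  assumes g: "g \<in> hardy2" and u: "u \<in> hardy2"
  shows "m < 0 \<Longrightarrow> fourier_coeff (\<lambda>z. u z * g z) m = 0"
    and "fourier_coeff (\<lambda>z. u z * g z) 0 = fourier_coeff u 0 * fourier_coeff g 0"
proof -
  have su: "sq_int u" using u by (rule hardy2D)
  have eq: "fourier_coeff (\<lambda>z. u z * poly (fejer_poly N g) z) m =
      (if m = 0 then fourier_coeff u 0 * fourier_coeff g 0 else 0)" if "m \<le> 0" for N m
  proof -
    have "fourier_coeff (\<lambda>z. u z * poly (fejer_poly N g) z) m
        = (\<Sum>i\<le>degree (fejer_poly N g). if i = 0 \<and> m = 0 then fourier_coeff u 0 * fourier_coeff g 0 else 0)"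
      unfolding fourier_coeff_mult_poly[OF sq_int_integrable(1)[OF su]]
      using that by (intro sum.cong refl) (auto simp: hardy2D(2)[OF u] coeff_0_fejer_poly)
    also have "\<dots> = (if m = 0 then fourier_coeff u 0 * fourier_coeff g 0 else 0)"
      by (cases "m = 0") auto
    finally show ?thesis .
  qed
  have lim: "fourier_coeff (\<lambda>z. u z * g z) m = (if m = 0 then fourier_coeff u 0 * fourier_coeff g 0 else 0)"
    if "m \<le> 0" for m
    using hardy2_mult_tendsto[OF g su, of m] unfolding eq[OF that]
    by (simp add: LIMSEQ_const_iff)
  show "m < 0 \<Longrightarrow> fourier_coeff (\<lambda>z. u z * g z) m = 0"
    and "fourier_coeff (\<lambda>z. u z * g z) 0 = fourier_coeff u 0 * fourier_coeff g 0"
    using lim[of m] lim[of 0] by auto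
qed

lemma hardy2_mult_bounded:
  assumes "g \<in> hardy2" "u \<in> hardy2" "AE z in M. cmod (u z) \<le> B"
  shows "(\<lambda>z. u z * g z) \<in> hardy2"
proof -
  have "sq_int (\<lambda>z. u z * g z)"
    using assms hardy2D(1) by (intro sq_int_mult_bounded) (auto simp: sq_int_def)
  then show ?thesis using hardy2_mult(1)[OF assms(1,2)] by (simp add: hardy2_iff)
qed

text \<open>The partial sums of the exponential series in \<open>p\<close> are polynomials, bounded
  on the circle by one constant \<open>exp B\<close>, so dominated convergence transfers their
  coefficients to the limit.\<close>

lemma fourier_coeff_exp_poly:
  "fourier_coeff (\<lambda>z. exp (poly p z)) 0 = exp (coeff p 0)"
  "m < 0 \<Longrightarrow> fourier_coeff (\<lambda>z. exp (poly p z)) m = 0"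
proof -
  define q where "q n = (\<Sum>k<n. smult (inverse (fact k)) (p ^ k))" for n
  have q: "poly (q n) z = (\<Sum>k<n. poly p z ^ k /\<^sub>R fact k)" for n z
    by (simp add: q_def poly_sum scaleR_conv_of_real)
  have lim: "(\<lambda>n. poly (q n) z) \<longlonglongrightarrow> exp (poly p z)" for z
    using exp_converges[of "poly p z"] unfolding q sums_def .
  have c: "continuous_on UNIV (poly p)" by (intro continuous_intros)
  obtain B where "\<And>z. cmod z = 1 \<Longrightarrow> cmod (poly p z) \<le> B"
    using continuous_bounded_on_circle[OF c] by blast
  then have B: "cmod (poly p z) \<le> B" if "cmod z = 1" for z using that by auto
  have qB: "cmod (poly (q n) z) \<le> exp B" if "cmod z = 1" for n z
  proof -
    have "cmod (poly (q n) z) \<le> (\<Sum>k<n. cmod (poly p z ^ k /\<^sub>R fact k))"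
      unfolding q by (rule norm_sum)
    also have "\<dots> = (\<Sum>k<n. cmod (poly p z) ^ k /\<^sub>R fact k)"
      by (simp add: norm_power)
    also have "\<dots> \<le> exp (cmod (poly p z))"
      unfolding exp_def by (intro sum_le_suminf summable_exp_generic) auto
    also have "\<dots> \<le> exp B" using B[OF that] by simp
    finally show ?thesis .
  qed
  have me[measurable]: "(\<lambda>z. exp (poly p z)) \<in> borel_measurable M"
    by (intro measurable_circle_continuous continuous_intros)
  have mq[measurable]: "poly (q n) \<in> borel_measurable M" for n
    using sq_int_poly by (rule sq_int_measurable)
  have conv: "(\<lambda>n. fourier_coeff (poly (q n)) m) \<longlonglongrightarrow> fourier_coeff (\<lambda>z. exp (poly p z)) m" for m
    unfolding fourier_coeff_eq[OF mq] fourier_coeff_eq[OF me]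
  proof (rule integral_dominated_convergence[where w = "\<lambda>_. exp B"])
    show "AE z in M. (\<lambda>n. poly (q n) z * cnj (z powi m)) \<longlonglongrightarrow> exp (poly p z) * cnj (z powi m)"
      by (intro AE_I2 tendsto_intros lim)
    show "AE z in M. norm (poly (q n) z * cnj (z powi m)) \<le> exp B" for n
      using AE_circle_norm by eventually_elim (simp add: norm_mult norm_powi_circle qB)
  qed auto
  show "fourier_coeff (\<lambda>z. exp (poly p z)) m = 0" if "m < 0"
    using conv[of m] that by (simp add: fourier_coeff_poly LIMSEQ_const_iff)
  have "coeff (q n) 0 = (\<Sum>k<n. coeff p 0 ^ k /\<^sub>R fact k)" for n
    using q[of n 0] by (simp add: poly_0_coeff_0)
  then have "(\<lambda>n. coeff (q n) 0) \<longlonglongrightarrow> exp (coeff p 0)"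
    using exp_converges[of "coeff p 0"] unfolding sums_def by simp
  then show "fourier_coeff (\<lambda>z. exp (poly p z)) 0 = exp (coeff p 0)"
    using conv[of 0] by (simp add: fourier_coeff_poly LIMSEQ_unique)
qed

section \<open>Outer functions\<close>

text \<open>Tonelli for series. It upgrades fast L1-convergence of a sequence to convergence almost
  everywhere.\<close>

lemma AE_summable_of_summable_L1:
  fixes h :: "nat \<Rightarrow> 'a \<Rightarrow> real"
  assumes int: "\<And>k. integrable N (h k)" and nonneg: "\<And>k x. 0 \<le> h k x"
    and sum: "summable (\<lambda>k. LINT x|N. h k x)"
  shows "AE x in N. summable (\<lambda>k. h k x)"
proof -
  have [measurable]: "h k \<in> borel_measurable N" for k using int[of k] by auto
  have "(\<integral>\<^sup>+x. (\<Sum>k. ennreal (h k x)) \<partial>N) = (\<Sum>k. \<integral>\<^sup>+x. ennreal (h k x) \<partial>N)"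
    by (rule nn_integral_suminf) measurable
  also have "\<dots> = (\<Sum>k. ennreal (LINT x|N. h k x))"
    using int nonneg by (simp add: nn_integral_eq_integral)
  also have "\<dots> = ennreal (\<Sum>k. LINT x|N. h k x)"
    using sum nonneg by (intro suminf_ennreal2) (auto intro: integral_nonneg_AE)
  finally have "(\<integral>\<^sup>+x. (\<Sum>k. ennreal (h k x)) \<partial>N) \<noteq> \<infinity>" by simp
  then have "AE x in N. (\<Sum>k. ennreal (h k x)) \<noteq> \<infinity>"
    by (intro nn_integral_PInf_AE) auto
  then show ?thesis
    by eventually_elim (use nonneg in \<open>auto intro: summable_suminf_not_top\<close>)
qed

text \<open>Since \<open>g\<^sup>2\<close> has mean \<open>(g(0))\<^sup>2 \<ge> 0\<close>, the imaginary part is dominated by the real part.\<close>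

lemma norm2_poly_le_Re:
  assumes "coeff p 0 \<in> \<real>"
  shows "norm2 (poly p) \<le> 2 * (LINT z|M. (Re (poly p z))\<^sup>2)"
proof -
  have sp: "sq_int (poly p)" by (rule sq_int_poly)
  have [measurable]: "poly p \<in> borel_measurable M" using sp by (rule sq_int_measurable)
  have ip: "integrable M (\<lambda>z. (cmod (poly p z))\<^sup>2)" using sp by (simp add: sq_int_def)
  have iR: "integrable M (\<lambda>z. (Re (poly p z))\<^sup>2)"
    by (rule Bochner_Integration.integrable_bound[OF ip]) (auto simp: abs_Re_le_cmod cmod_power2)
  have i2: "integrable M (\<lambda>z. poly p z * poly p z)" using sp by (intro sq_int_mult_integrable)
  obtain r where r: "coeff p 0 = complex_of_real r" using assms by (auto elim: Reals_cases)
  have "(LINT z|M. poly p z * poly p z) = coeff p 0 * coeff p 0"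
    using hardy2_mult(2)[OF poly_hardy2 poly_hardy2, of p p]
    by (simp add: fourier_coeff_0 fourier_coeff_poly)
  then have "(LINT z|M. Re (poly p z * poly p z)) = r * r"
    using integral_Re[OF i2] r by simp
  moreover have "(cmod (poly p z))\<^sup>2 = 2 * (Re (poly p z))\<^sup>2 - Re (poly p z * poly p z)" for z
    unfolding cmod_power2 by (simp add: power2_eq_square)
  ultimately have "norm2 (poly p) = 2 * (LINT z|M. (Re (poly p z))\<^sup>2) - r * r"
    unfolding norm2_def using iR integrable_Re[OF i2] by simp
  then show ?thesis by simp
qed

text \<open>A polynomial form of the Herglotz transform: doubling the analytic half of the Fejer
  mean and removing one copy of the constant term makes the real part on the circle equal to the
  Fejer mean, and the value at 0 real.\<close>

definition herglotz_poly :: "nat \<Rightarrow> (complex \<Rightarrow> real) \<Rightarrow> complex poly" where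
  "herglotz_poly N v = smult 2 (fejer_poly N (\<lambda>z. of_real (v z))) - [:fourier_coeff (\<lambda>z. of_real (v z)) 0:]"

lemma Re_herglotz_poly:
  assumes v: "integrable M v" and z: "cmod z = 1"
  shows "Re (poly (herglotz_poly N v) z) = Re (fejer N (\<lambda>z. of_real (v z)) z)"
proof -
  define c where "c = fourier_coeff (\<lambda>z. complex_of_real (v z))"
  have [measurable]: "v \<in> borel_measurable M" using v by auto
  define r where "r a b = Re (c (int a - int b) * z powi (int a - int b))" for a b
  have sym: "r a b = r b a" for a b
  proof -
    have "c (int b - int a) = cnj (c (int a - int b))"
      using fourier_coeff_cnj[of "\<lambda>z. of_real (v z)" "int a - int b"] by (simp add: c_def)
    moreover have "z powi (int b - int a) = cnj (z powi (int a - int b))"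
      using cnj_powi_circle[OF z, of "int a - int b"] by simp
    ultimately have "c (int b - int a) * z powi (int b - int a) = cnj (c (int a - int b) * z powi (int a - int b))"
      by (simp only: complex_cnj_mult)
    then show ?thesis unfolding r_def by (metis complex_cnj(1) Re_complex_of_real cnj.simps(1))
  qed
  define L where "L = (\<Sum>a\<le>N. \<Sum>b\<le>a. r a b)"
  have L: "L = (\<Sum>a\<le>N. \<Sum>b\<le>N. if b \<le> a then r a b else 0)"
    unfolding L_def by (intro sum.cong[OF refl] sum.mono_neutral_cong_left) auto
  \<comment> \<open>The square of index pairs is made of two triangles overlapping in the diagonal;
    by symmetry of \<open>r\<close> both triangles have the sum \<open>L\<close>.\<close>
  have "(\<Sum>a\<le>N. \<Sum>b\<le>N. r a b) = (\<Sum>a\<le>N. \<Sum>b\<le>N. (if b \<le> a then r a b else 0) + (if a \<le> b then r a b else 0) - (if b = a then r a a else 0))"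
    by (intro sum.cong refl) auto
  also have "\<dots> = L + (\<Sum>a\<le>N. \<Sum>b\<le>N. if a \<le> b then r a b else 0) - (\<Sum>a\<le>N. r a a)"
    by (simp add: sum.distrib sum_subtractf L)
  also have "(\<Sum>a\<le>N. \<Sum>b\<le>N. if a \<le> b then r a b else 0) = L"
    unfolding L by (subst sum.swap) (simp add: sym cong: if_cong)
  also have "(\<Sum>a\<le>N. r a a) = real (Suc N) * Re (c 0)"
    by (simp add: r_def)
  finally have tot: "(\<Sum>a\<le>N. \<Sum>b\<le>N. r a b) = 2 * L - real (Suc N) * Re (c 0)" by simp
  have "Re (fejer N (\<lambda>z. of_real (v z)) z) = (\<Sum>a\<le>N. \<Sum>b\<le>N. r a b) / real (Suc N)"
    unfolding fejer_def r_def c_def[symmetric]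
    by (simp add: Re_divide_of_nat del: of_nat_Suc)
  moreover have "Re (poly (fejer_poly N (\<lambda>z. of_real (v z))) z) = L / real (Suc N)"
  proof -
    have "poly (fejer_poly N (\<lambda>z. of_real (v z))) z = (\<Sum>a\<le>N. \<Sum>b\<le>a. c (int a - int b) * z powi (int a - int b)) / of_nat (Suc N)"
      unfolding fejer_poly_def c_def[symmetric] poly_sum poly_monom sum_divide_distrib
      by (intro sum.cong refl) (simp del: of_nat_Suc flip: of_nat_diff)
    then show ?thesis by (simp add: L_def r_def Re_divide_of_nat del: of_nat_Suc)
  qed
  ultimately show ?thesis
    by (simp add: herglotz_poly_def tot c_def[symmetric] diff_divide_distrib del: of_nat_Suc)
qed

lemma Re_herglotz_poly_nonneg:
  assumes v: "integrable M v" "\<And>z. 0 \<le> v z" and z: "cmod z = 1"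
  shows "0 \<le> Re (poly (herglotz_poly N v) z)"
proof -
  have v': "integrable M (\<lambda>z. complex_of_real (v z))" using v(1) by (simp add: complex_of_real_integrable_eq)
  have "fejer N (\<lambda>z. of_real (v z)) z = of_real (LINT s|M. v s * fejer_kernel N z s)"
    unfolding fejer_integral(2)[OF v' z] of_real_mult[symmetric] integral_complex_of_real ..
  moreover have "0 \<le> (LINT s|M. v s * fejer_kernel N z s)"
    using v(2) by (intro integral_nonneg_AE AE_I2 mult_nonneg_nonneg) auto
  ultimately show ?thesis using Re_herglotz_poly[OF v(1) z] by simp
qed

lemma coeff_0_herglotz_poly:
  assumes v: "integrable M v"
  shows "coeff (herglotz_poly N v) 0 = of_real (LINT z|M. v z)"
proof -
  have [measurable]: "v \<in> borel_measurable M" using v by auto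
  show ?thesis
    by (simp add: herglotz_poly_def coeff_0_fejer_poly fourier_coeff_0)
qed

text \<open>By \<open>norm2_poly_le_Re\<close> the imaginary parts converge along with the real
  parts, so the conjugate function needs no separate construction. Since \<open>v\<close> is
  nonnegative, so are the real parts of the polynomials; the exponentials are thus bounded by 1 on
  the circle and their coefficients pass to the limit. The last estimate combines |w - 1|^2 \<le> 2
  - 2 Re w with mean w = exp(- mean v) \<ge> 1 - mean v.\<close>

theorem outer_function:
  fixes v :: "complex \<Rightarrow> real"
  assumes mv[measurable]: "v \<in> borel_measurable M" and v2: "integrable M (\<lambda>z. (v z)\<^sup>2)"
    and nonneg: "\<And>z. 0 \<le> v z"
  obtains w where "w \<in> hardy2" "AE z in M. cmod (w z) = exp (- v z)" "AE z in M. cmod (w z) \<le> 1"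
    "fourier_coeff w 0 = of_real (exp (- (LINT z|M. v z)))"
    "norm2 (\<lambda>z. w z - 1) \<le> 2 * (LINT z|M. v z)"
proof -
  define V where "V z = complex_of_real (v z)" for z
  have sV: "sq_int V" using v2 by (simp add: sq_int_def V_def[abs_def])
  have iv: "integrable M v"
    using sq_int_integrable(1)[OF sV] by (simp add: V_def[abs_def] complex_of_real_integrable_eq)
  have conv: "(\<lambda>N. norm2 (\<lambda>z. fejer N V z - V z)) \<longlonglongrightarrow> 0"
    by (rule fejer_L2_convergence[OF sV])
  \<comment> \<open>The ratio 1/16 becomes 1/4 after the square root taken below, which is still
    summable.\<close>
  have "\<exists>n. \<forall>k\<ge>n. norm2 (\<lambda>z. fejer k V z - V z) < (1/16) ^ j" for j :: nat
    using order_tendstoD(2)[OF conv, of "(1/16)^j"] by (simp add: eventually_sequentially)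
  then obtain n where n: "\<And>j k. n j \<le> k \<Longrightarrow> norm2 (\<lambda>z. fejer k V z - V z) < (1/16) ^ j" by metis
  \<comment> \<open>The partial sums dominate \<open>n j\<close> at both \<open>j\<close> and
    \<open>Suc j\<close>, so two consecutive means obey the same bound.\<close>
  define K where "K j = (\<Sum>i\<le>j. n i)" for j
  have K: "norm2 (\<lambda>z. fejer (K j) V z - V z) < (1/16) ^ j"
    "norm2 (\<lambda>z. fejer (K (Suc j)) V z - V z) < (1/16) ^ j" for j
  proof -
    have "n j \<le> K j" unfolding K_def by (rule member_le_sum) auto
    then show "norm2 (\<lambda>z. fejer (K j) V z - V z) < (1/16) ^ j"
      "norm2 (\<lambda>z. fejer (K (Suc j)) V z - V z) < (1/16) ^ j"
      by (auto intro!: n simp: K_def)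
  qed
  define H where "H j = herglotz_poly (K j) v" for j
  have ReH: "Re (poly (H j) z) = Re (fejer (K j) V z)" if "cmod z = 1" for j z
    using Re_herglotz_poly[OF iv that] by (simp add: H_def V_def[abs_def])
  have H_step: "(LINT z|M. cmod (poly (H (Suc j)) z - poly (H j) z)) \<le> 3 * (1/4) ^ j" for j
  proof -
    define p where "p = H (Suc j) - H j"
    have "coeff p 0 \<in> \<real>" by (simp add: p_def H_def coeff_0_herglotz_poly[OF iv])
    then have "norm2 (poly p) \<le> 2 * (LINT z|M. (Re (poly p z))\<^sup>2)" by (rule norm2_poly_le_Re)
    also have "(LINT z|M. (Re (poly p z))\<^sup>2) \<le> norm2 (\<lambda>z. fejer (K (Suc j)) V z - fejer (K j) V z)"
      unfolding norm2_def
    proof (rule integral_mono_AE')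
      show "integrable M (\<lambda>z. (cmod (fejer (K (Suc j)) V z - fejer (K j) V z))\<^sup>2)"
        using sq_int_diff(1)[OF sq_int_fejer sq_int_fejer] by (simp add: sq_int_def)
      show "AE z in M. (Re (poly p z))\<^sup>2 \<le> (cmod (fejer (K (Suc j)) V z - fejer (K j) V z))\<^sup>2"
        using AE_circle_norm
      proof eventually_elim
        case (elim z)
        have "Re (poly p z) = Re (fejer (K (Suc j)) V z - fejer (K j) V z)"
          using ReH[OF elim] by (simp add: p_def)
        then show ?case by (simp add: cmod_power2)
      qed
    qed auto
    also have "\<dots> \<le> 2 * norm2 (\<lambda>z. fejer (K (Suc j)) V z - V z) + 2 * norm2 (\<lambda>z. V z - fejer (K j) V z)"
      by (intro norm2_triangle sq_int_fejer sV)
    also have "\<dots> \<le> 4 * (1/16) ^ j"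
      using K[of j] norm2_commute[of V "fejer (K j) V"] by simp
    finally have "norm2 (poly p) \<le> 8 * (1/16) ^ j" by simp
    \<comment> \<open>Using 9 in place of 8 makes the bound a perfect square.\<close>
    also have "8 * (1/16) ^ j \<le> 9 * (1/16 :: real) ^ j" by (intro mult_right_mono) auto
    also have "\<dots> = (3 * (1/4) ^ j)\<^sup>2"
      by (simp add: power2_eq_square flip: power_mult_distrib)
    finally have "sqrt (norm2 (poly p)) \<le> 3 * (1/4) ^ j"
      by (intro real_le_lsqrt) auto
    then show ?thesis using sq_int_integrable(3)[OF sq_int_poly, of p] by (simp add: p_def)
  qed
  have V_step: "(LINT z|M. cmod (fejer (K j) V z - V z)) \<le> 3 * (1/4) ^ j" for j
  proof -
    have "norm2 (\<lambda>z. fejer (K j) V z - V z) \<le> ((1/4) ^ j)\<^sup>2"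
      using K(1)[of j] by (simp add: power2_eq_square flip: power_mult_distrib)
    then have "sqrt (norm2 (\<lambda>z. fejer (K j) V z - V z)) \<le> (1/4) ^ j"
      by (intro real_le_lsqrt) auto
    then show ?thesis
      using sq_int_integrable(3)[OF sq_int_diff(1)[OF sq_int_fejer sV], of "K j" V]
        zero_le_power[of "1/4 :: real" j] by linarith
  qed
  have geo: "summable (\<lambda>j. 3 * (1/4) ^ j :: real)" by (intro summable_mult summable_geometric) simp
  have "AE z in M. summable (\<lambda>j. cmod (poly (H (Suc j)) z - poly (H j) z))"
  proof (rule AE_summable_of_summable_L1)
    show "integrable M (\<lambda>z. cmod (poly (H (Suc j)) z - poly (H j) z))" for j
      by (intro sq_int_integrable sq_int_diff sq_int_poly)
    show "summable (\<lambda>j. LINT z|M. cmod (poly (H (Suc j)) z - poly (H j) z))"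
      by (rule summable_comparison_test'[OF geo]) (use H_step in auto)
  qed auto
  moreover have "AE z in M. summable (\<lambda>j. cmod (fejer (K j) V z - V z))"
  proof (rule AE_summable_of_summable_L1)
    show "integrable M (\<lambda>z. cmod (fejer (K j) V z - V z))" for j
      by (intro sq_int_integrable sq_int_diff sq_int_fejer sV)
    show "summable (\<lambda>j. LINT z|M. cmod (fejer (K j) V z - V z))"
      by (rule summable_comparison_test'[OF geo]) (use V_step in auto)
  qed auto
  ultimately have lim: "AE z in M. \<exists>l. (\<lambda>j. poly (H j) z) \<longlonglongrightarrow> l \<and> Re l = v z"
    using AE_circle_norm
  proof eventually_elim
    case (elim z)
    have "summable (\<lambda>j. poly (H (Suc j)) z - poly (H j) z)"
      using elim(1) by (rule summable_norm_cancel)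
    then have "(\<lambda>m. \<Sum>j<m. poly (H (Suc j)) z - poly (H j) z) \<longlonglongrightarrow> (\<Sum>j. poly (H (Suc j)) z - poly (H j) z)"
      by (rule summable_LIMSEQ)
    then have "(\<lambda>m. poly (H m) z - poly (H 0) z) \<longlonglongrightarrow> (\<Sum>j. poly (H (Suc j)) z - poly (H j) z)"
      by (simp only: sum_lessThan_telescope[of "\<lambda>j. poly (H j) z"])
    from tendsto_add[OF this tendsto_const[of "poly (H 0) z"]]
    obtain l where l: "(\<lambda>j. poly (H j) z) \<longlonglongrightarrow> l" by auto
    have "(\<lambda>j. fejer (K j) V z - V z) \<longlonglongrightarrow> 0"
      using summable_LIMSEQ_zero[OF elim(2)] by (simp add: tendsto_norm_zero_iff)
    then have "(\<lambda>j. fejer (K j) V z) \<longlonglongrightarrow> V z" by (simp add: LIM_zero_iff)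
    from tendsto_Re[OF this] have "(\<lambda>j. Re (poly (H j) z)) \<longlonglongrightarrow> v z"
      by (simp add: ReH[OF elim(3)] V_def)
    then have "Re l = v z" using tendsto_Re[OF l] by (rule LIMSEQ_unique[rotated])
    with l show ?case by blast
  qed
  \<comment> \<open>Where no limit exists \<open>lim\<close> has an arbitrary value; that set is
    null, and measurability holds regardless.\<close>
  define w where "w z = lim (\<lambda>j. exp (poly (- H j) z))" for z
  have me[measurable]: "(\<lambda>z. exp (poly (- H j) z)) \<in> borel_measurable M" for j
    by (intro measurable_circle_continuous continuous_intros)
  have mw[measurable]: "w \<in> borel_measurable M"
    unfolding w_def by (intro borel_measurable_lim_metric me)
  have w: "AE z in M. (\<lambda>j. exp (poly (- H j) z)) \<longlonglongrightarrow> w z \<and> cmod (w z) = exp (- v z)"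
    using lim
  proof eventually_elim
    case (elim z)
    then obtain l where l: "(\<lambda>j. poly (H j) z) \<longlonglongrightarrow> l" "Re l = v z" by blast
    have "(\<lambda>j. exp (poly (- H j) z)) \<longlonglongrightarrow> exp (- l)"
      unfolding poly_minus by (intro tendsto_intros l)
    moreover from this have "w z = exp (- l)" unfolding w_def by (rule limI)
    ultimately show ?case using l by simp
  qed
  have wabs: "AE z in M. cmod (w z) = exp (- v z)" using w by eventually_elim simp
  then have w1: "AE z in M. cmod (w z) \<le> 1" by eventually_elim (use nonneg in auto)
  have fc: "(\<lambda>j. fourier_coeff (\<lambda>z. exp (poly (- H j) z)) m) \<longlonglongrightarrow> fourier_coeff w m" for m
    unfolding fourier_coeff_eq[OF me] fourier_coeff_eq[OF mw]
  proof (rule integral_dominated_convergence[where w = "\<lambda>_. 1"])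
    show "AE z in M. (\<lambda>j. exp (poly (- H j) z) * cnj (z powi m)) \<longlonglongrightarrow> w z * cnj (z powi m)"
      using w by eventually_elim (auto intro: tendsto_intros)
    show "AE z in M. norm (exp (poly (- H j) z) * cnj (z powi m)) \<le> 1" for j
      using AE_circle_norm
      by eventually_elim (simp add: norm_mult norm_powi_circle H_def Re_herglotz_poly_nonneg[OF iv nonneg])
    show "(\<lambda>z. exp (poly (- H j) z) * cnj (z powi m)) \<in> borel_measurable M" for j by measurable
  qed auto
  have sw: "sq_int w" by (rule sq_int_bounded[OF mw w1])
  have "fourier_coeff w m = 0" if "m < 0" for m
    using fc[of m] unfolding fourier_coeff_exp_poly(2)[OF that] by (simp add: LIMSEQ_const_iff)
  then have wH: "w \<in> hardy2"
    using sw by (simp add: hardy2_iff)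
  have w0: "fourier_coeff w 0 = of_real (exp (- (LINT z|M. v z)))"
    using fc[of 0] unfolding fourier_coeff_exp_poly(1) H_def coeff_minus coeff_0_herglotz_poly[OF iv]
    by (simp add: LIMSEQ_const_iff exp_of_real flip: of_real_minus)
  have "norm2 (\<lambda>z. w z - 1) \<le> (LINT z|M. 2 - 2 * Re (w z))" unfolding norm2_def
  proof (rule integral_mono_AE)
    show "integrable M (\<lambda>z. (cmod (w z - 1))\<^sup>2)"
      using sq_int_diff(1)[OF sw sq_int_constant[of 1]] by (simp add: sq_int_def)
    show "integrable M (\<lambda>z. 2 - 2 * Re (w z))"
      using integrable_Re[OF sq_int_integrable(1)[OF sw]] by simp
    show "AE z in M. (cmod (w z - 1))\<^sup>2 \<le> 2 - 2 * Re (w z)"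
      using w1
    proof eventually_elim
      case (elim z)
      then have "(cmod (w z))\<^sup>2 \<le> 1" by (simp add: abs_square_le_1)
      then show ?case unfolding cmod_power2 by (simp add: power2_eq_square algebra_simps)
    qed
  qed
  also have "\<dots> = 2 - 2 * Re (LINT z|M. w z)"
    using integrable_Re[OF sq_int_integrable(1)[OF sw]] integral_Re[OF sq_int_integrable(1)[OF sw]] by simp
  also have "(LINT z|M. w z) = of_real (exp (- (LINT z|M. v z)))"
    using w0 by (simp add: fourier_coeff_0)
  also have "2 - 2 * Re (of_real (exp (- (LINT z|M. v z)))) \<le> 2 * (LINT z|M. v z)"
    using exp_ge_add_one_self[of "- (LINT z|M. v z)"] by simp
  finally have "norm2 (\<lambda>z. w z - 1) \<le> 2 * (LINT z|M. v z)" .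
  with wH wabs w1 w0 show ?thesis by (rule that)
qed

section \<open>Density results\<close>

definition bounded_hardy :: "(complex \<Rightarrow> complex) set" where
  "bounded_hardy = {g \<in> hardy2. \<exists>B. AE z in M. cmod (g z) \<le> B}"

lemma bounded_hardyD: "g \<in> bounded_hardy \<Longrightarrow> g \<in> hardy2"
  by (simp add: bounded_hardy_def)

lemma bounded_hardy_bound:
  assumes "g \<in> bounded_hardy"
  obtains B where "0 < B" "AE z in M. cmod (g z) \<le> B"
proof -
  from assms obtain B where B: "AE z in M. cmod (g z) \<le> B" by (auto simp: bounded_hardy_def)
  from B have "AE z in M. cmod (g z) \<le> max 1 B" by eventually_elim auto
  then show ?thesis using that[of "max 1 B"] by auto
qed

lemma bounded_hardy_mult:
  assumes "f \<in> bounded_hardy" "g \<in> bounded_hardy"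
  shows "(\<lambda>z. f z * g z) \<in> bounded_hardy"
    and "fourier_coeff (\<lambda>z. f z * g z) 0 = fourier_coeff f 0 * fourier_coeff g 0"
proof -
  obtain B C where B: "0 < B" "AE z in M. cmod (f z) \<le> B" and C: "0 < C" "AE z in M. cmod (g z) \<le> C"
    using bounded_hardy_bound assms by metis
  have "AE z in M. cmod (f z * g z) \<le> B * C"
    using B(2) C(2) by eventually_elim (use B in \<open>auto simp: norm_mult intro!: mult_mono\<close>)
  then show "(\<lambda>z. f z * g z) \<in> bounded_hardy"
    using hardy2_mult_bounded[OF bounded_hardyD bounded_hardyD B(2)] assms by (auto simp: bounded_hardy_def)
  show "fourier_coeff (\<lambda>z. f z * g z) 0 = fourier_coeff f 0 * fourier_coeff g 0"
    using assms by (intro hardy2_mult bounded_hardyD)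
qed

lemma poly_bounded_hardy: "poly p \<in> bounded_hardy"
proof -
  have c: "continuous_on UNIV (poly p)" by (intro continuous_intros)
  obtain B where "\<And>z. cmod z = 1 \<Longrightarrow> cmod (poly p z) \<le> B"
    using continuous_bounded_on_circle[OF c] by blast
  then have "AE z in M. cmod (poly p z) \<le> B"
    using AE_circle_norm by (auto elim!: eventually_mono)
  then show ?thesis using poly_hardy2 by (auto simp: bounded_hardy_def)
qed

lemma bounded_hardy_power:
  assumes "f \<in> bounded_hardy"
  shows "(\<lambda>z. f z ^ n) \<in> bounded_hardy"
proof (induction n)
  case 0
  have "poly 1 = (\<lambda>z::complex. 1)" by auto
  then show ?case using poly_bounded_hardy[of 1] by simp
next
  case (Suc n)
  then show ?case using bounded_hardy_mult(1)[OF assms Suc] by simp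
qed

text \<open>Take v = k off E and v = 0 on E, and normalise by exp(k (1 - |E|)) to obtain the value 1
  at 0. The modulus off E becomes exp(-k |E|), as small as desired for large k; the growth is
  confined to E.\<close>

lemma outer_set:
  assumes E: "E \<in> sets M" and k: "0 \<le> k"
  obtains w where "w \<in> bounded_hardy"
    "AE z in M. z \<notin> E \<longrightarrow> cmod (w z) = exp (- k * measure M E)"
    "fourier_coeff w 0 = 1"
proof -
  note E[measurable]
  define v where "v z = k * indicator (- E) z" for z :: complex
  have CE[measurable]: "- E \<in> sets M" by (rule Compl_sets_circle_measure[OF E])
  have mv: "v \<in> borel_measurable M" unfolding v_def by measurable
  have v2: "integrable M (\<lambda>z. (v z)\<^sup>2)"
    by (rule circle.integrable_const_bound[where B = "k\<^sup>2"]) (use mv in \<open>auto simp: v_def indicator_def\<close>)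
  have v0: "0 \<le> v z" for z using k by (auto simp: v_def)
  have "measure M (- E) = 1 - measure M E"
    using circle.finite_measure_compl[OF E] by (simp add: Compl_eq_Diff_UNIV)
  then have iv: "(LINT z|M. v z) = k * (1 - measure M E)"
    using CE by (simp add: v_def)
  obtain w where w: "w \<in> hardy2" "AE z in M. cmod (w z) = exp (- v z)"
    "fourier_coeff w 0 = of_real (exp (- (k * (1 - measure M E))))"
    using outer_function[OF mv v2 v0] unfolding iv by metis
  define a where "a = exp (k * (1 - measure M E))"
  let ?w = "\<lambda>z. of_real a * w z"
  have abs: "AE z in M. cmod (of_real a * w z) = exp (k * (1 - measure M E) - v z)"
    using w(2) by eventually_elim (simp add: a_def norm_mult mult_exp_exp)
  show ?thesis
  proof
    have "AE z in M. cmod (?w z) \<le> exp (k * (1 - measure M E))"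
      using abs by eventually_elim (use v0 in auto)
    then show "?w \<in> bounded_hardy"
      using hardy2_cmult[OF w(1)] by (auto simp: bounded_hardy_def)
    show "AE z in M. z \<notin> E \<longrightarrow> cmod (?w z) = exp (- k * measure M E)"
      using abs by eventually_elim (auto simp: v_def right_diff_distrib)
    show "fourier_coeff ?w 0 = 1"
      using w(3) fourier_coeff_cmult[OF sq_int_measurable[OF hardy2D(1)[OF w(1)]]]
      by (simp add: a_def flip: of_real_mult exp_add)
  qed
qed


text \<open>On the circle \<open>1/z\<close> is approximated off \<open>E\<close> by \<open>(1 - W z) / z\<close>, where \<open>W(0) = 1\<close>
  and \<open>W\<close> is an outer function that is tiny off \<open>E\<close>.\<close>

theorem bounded_hardy_dense_L2:
  assumes E: "E \<in> sets M" "0 < measure M E" and h: "sq_int h" and e: "0 < e"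
  obtains s where "s \<in> bounded_hardy" "fourier_coeff s 0 = 0"
    "norm2 (\<lambda>z. indicator (- E) z * (h z - s z)) < e"
proof -
  have CE[measurable]: "- E \<in> sets M" by (rule Compl_sets_circle_measure[OF E(1)])
  obtain N where N: "norm2 (\<lambda>z. fejer N h z - h z) < e / 8"
    using order_tendstoD(2)[OF fejer_L2_convergence[OF h], of "e / 8"] e
    by (auto simp: eventually_sequentially)
  \<comment> \<open>Multiplication by z^N clears the negative powers of the Fejer mean.\<close>
  define P where "P = (\<Sum>a\<le>N. \<Sum>b\<le>N. monom (fourier_coeff h (int a - int b) / of_nat (Suc N)) (N + a - b))"
  have P: "fejer N h z = poly P z * (inverse z) ^ N" if "cmod z = 1" for z
  proof -
    have z: "z \<noteq> 0" using that by auto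
    have "z powi (int a - int b) = z ^ (N + a - b) * inverse z ^ N" if "b \<le> N" for a b
    proof -
      have "z ^ (N + a - b) * inverse z ^ N = z powi (int (N + a - b)) * z powi (- int N)"
        by (simp add: power_int_minus power_inverse)
      also have "\<dots> = z powi (int (N + a - b) - int N)"
        using z by (subst power_int_add[symmetric]) auto
      also have "int (N + a - b) - int N = int a - int b" using that by auto
      finally show ?thesis ..
    qed
    then show ?thesis
      by (simp add: fejer_def P_def poly_sum poly_monom sum_distrib_right sum_divide_distrib mult.assoc del: of_nat_Suc)
  qed
  obtain B where B: "0 < B" "AE z in M. cmod (poly P z) \<le> B"
    using bounded_hardy_bound[OF poly_bounded_hardy] by blast
  define eta where "eta = sqrt (e / 8) / B"
  have eta: "0 < eta" "(B * eta)\<^sup>2 = e / 8" using e B(1) by (auto simp: eta_def)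
  have "isCont (\<lambda>x::complex. (1 - x) ^ Suc N) 0" by (intro continuous_intros)
  then obtain d where d: "0 < d" "\<And>x::complex. cmod x < d \<Longrightarrow> cmod ((1 - x) ^ Suc N - 1) < eta"
    using eta(1) unfolding continuous_at_eps_delta dist_norm by force
  \<comment> \<open>Gives \<open>w\<close> a modulus below \<open>d\<close> off \<open>E\<close>;
    the absolute value keeps \<open>k\<close> nonnegative when \<open>d\<close> is large.\<close>
  define k where "k = (1 + \<bar>ln d\<bar>) / measure M E"
  have k: "exp (- k * measure M E) < d" "0 \<le> k"
  proof -
    have "exp (- k * measure M E) = exp (- 1 - \<bar>ln d\<bar>)" using E(2) by (simp add: k_def)
    also have "\<dots> < exp (ln d)" unfolding exp_less_cancel_iff by linarith
    finally show "exp (- k * measure M E) < d" using d(1) by simp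
    show "0 \<le> k" by (simp add: k_def)
  qed
  obtain w where w: "w \<in> bounded_hardy" "AE z in M. z \<notin> E \<longrightarrow> cmod (w z) = exp (- k * measure M E)"
    "fourier_coeff w 0 = 1"
    using outer_set[OF E(1) k(2)] by metis
  have hw: "w \<in> hardy2" using w(1) by (rule bounded_hardyD)
  define u0 where "u0 z = 1 - w z" for z
  have u0H: "u0 \<in> hardy2"
    using hardy2_diff[OF poly_hardy2[of 1] hw] by (simp add: u0_def[abs_def])
  have [measurable]: "u0 \<in> borel_measurable M" using hardy2D(1)[OF u0H] by (rule sq_int_measurable)
  have u00: "fourier_coeff u0 0 = 0"
    using fourier_coeff_lin(2)[of "\<lambda>_. 1" w 0] sq_int_integrable(1)[OF hardy2D(1)[OF hw]] w(3)
    by (simp add: u0_def[abs_def] fourier_coeff_const)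
  \<comment> \<open>Since w(0) = 1, the coefficient of index 0 of 1 - w vanishes and division by z
    stays in H2.\<close>
  define u where "u z = u0 z * z powi (- 1)" for z
  have u: "u \<in> bounded_hardy"
  proof -
    obtain C where C: "0 < C" "AE z in M. cmod (w z) \<le> C" using bounded_hardy_bound[OF w(1)] .
    have b: "AE z in M. cmod (u z) \<le> 1 + C"
      using C(2) AE_circle_norm
    proof eventually_elim
      case (elim z)
      then show ?case using norm_triangle_ineq4[of 1 "w z"]
        by (simp add: u_def u0_def norm_mult norm_divide norm_inverse)
    qed
    have "fourier_coeff u m = 0" if "m < 0" for m
    proof -
      have "fourier_coeff u m = fourier_coeff u0 (m + 1)"
        unfolding u_def by (subst fourier_coeff_mult_powi) auto
      then show ?thesis using that u00 hardy2D(2)[OF u0H, of "m + 1"] by (cases "m = -1") auto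
    qed
    moreover have "sq_int u" by (rule sq_int_bounded[OF _ b]) (unfold u_def, measurable)
    ultimately show ?thesis using b by (auto simp: bounded_hardy_def hardy2_iff)
  qed
  \<comment> \<open>The factor z gives the value 0 at the origin. The exponent \<open>Suc N\<close>
    instead of \<open>N\<close> compensates for it, because \<open>u\<close> is close to 1/z off
    \<open>E\<close>.\<close>
  define s where "s z = poly ([:0, 1:] * P) z * u z ^ Suc N" for z
  have uN: "(\<lambda>z. u z ^ Suc N) \<in> bounded_hardy" by (rule bounded_hardy_power[OF u])
  have sH: "s \<in> bounded_hardy"
    unfolding s_def[abs_def] by (rule bounded_hardy_mult(1)[OF poly_bounded_hardy uN])
  have s0: "fourier_coeff s 0 = 0"
    using bounded_hardy_mult(2)[OF poly_bounded_hardy uN, of "[:0, 1:] * P"]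
    unfolding s_def[abs_def] by (simp add: fourier_coeff_poly)
  have ss: "sq_int s" using sH by (intro hardy2D bounded_hardyD)
  have close: "AE z in M. cmod (indicator (- E) z * (fejer N h z - s z)) \<le> B * eta"
    using w(2) B(2) AE_circle_norm
  proof eventually_elim
    case (elim z)
    show ?case
    proof (cases "z \<in> E")
      case True
      then show ?thesis using B(1) eta(1) by simp
    next
      case False
      have z: "z \<noteq> 0" using elim by auto
      have "s z = poly P z * (inverse z) ^ N * (1 - w z) ^ Suc N"
        using z by (simp add: s_def u_def u0_def power_mult_distrib power_int_minus field_simps)
      then have "fejer N h z - s z = poly P z * (inverse z) ^ N * - ((1 - w z) ^ Suc N - 1)"
        by (simp only: P[OF elim(3)]) (simp add: algebra_simps)
      then have "cmod (fejer N h z - s z) = cmod (poly P z) * cmod ((1 - w z) ^ Suc N - 1)"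
        using elim(3) by (simp only: norm_mult norm_minus_cancel norm_power norm_inverse) simp
      also have "\<dots> \<le> B * eta"
        using elim False d(2)[of "w z"] k(1) B(1) by (intro mult_mono) auto
      finally show ?thesis using False by simp
    qed
  qed
  have d1: "sq_int (\<lambda>z. h z - fejer N h z)" and d2: "sq_int (\<lambda>z. fejer N h z - s z)"
    by (intro sq_int_diff h sq_int_fejer ss)+
  have "norm2 (\<lambda>z. indicator (- E) z * (fejer N h z - s z)) \<le> (LINT z|M. (B * eta)\<^sup>2)"
    unfolding norm2_def
  proof (rule integral_mono_AE)
    show "AE z in M. (cmod (indicator (- E) z * (fejer N h z - s z)))\<^sup>2 \<le> (B * eta)\<^sup>2"
      using close by eventually_elim (auto intro: power_mono)
  qed (use sq_int_indicator(1)[OF CE d2] in \<open>auto simp: sq_int_def\<close>)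
  then have b2: "norm2 (\<lambda>z. indicator (- E) z * (fejer N h z - s z)) \<le> e / 8" using eta by simp
  have "norm2 (\<lambda>z. indicator (- E) z * (h z - s z))
      = norm2 (\<lambda>z. indicator (- E) z * (h z - fejer N h z) + indicator (- E) z * (fejer N h z - s z))"
    by (simp flip: distrib_left)
  also have "\<dots> \<le> 2 * norm2 (\<lambda>z. indicator (- E) z * (h z - fejer N h z)) + 2 * norm2 (\<lambda>z. indicator (- E) z * (fejer N h z - s z))"
    by (intro sq_int_add(2) sq_int_indicator(1) CE d1 d2)
  also have "\<dots> < e" using b2 N sq_int_indicator(2)[OF CE d1] norm2_commute[of h "fejer N h"] e by simp
  finally show ?thesis using that[OF sH s0] by blast
qed

text \<open>Truncating \<open>h\<close> costs little in L1 and makes it square integrable; as the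
  total mass is 1, the L2-error then dominates the L1-error.\<close>

lemma bounded_hardy_dense_L1:
  assumes E: "E \<in> sets M" "0 < measure M E" and h: "integrable M h" and e: "0 < e"
  obtains s where "s \<in> bounded_hardy" "fourier_coeff s 0 = 0"
    "(LINT z|M. indicator (- E) z * cmod (h z - s z)) < e"
proof -
  have CE[measurable]: "- E \<in> sets M" by (rule Compl_sets_circle_measure[OF E(1)])
  obtain n where n: "(LINT z|M. cmod (h z - clip (real n) (h z))) < e / 2"
    using L1_clip_approx[OF h, of "e / 2"] e by auto
  define g where "g z = clip (real n) (h z)" for z
  have "g \<in> borel_measurable M" unfolding g_def using h by (intro clip_measurable) auto
  then have g: "sq_int g"
    by (rule sq_int_bounded[where B = "real n"]) (simp add: g_def clip(1))
  obtain s where s: "s \<in> bounded_hardy" "fourier_coeff s 0 = 0"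
    "norm2 (\<lambda>z. indicator (- E) z * (g z - s z)) < (e / 2)\<^sup>2"
    using bounded_hardy_dense_L2[OF E g, of "(e / 2)\<^sup>2"] e by auto
  have ss: "sq_int s" using s(1) by (intro hardy2D bounded_hardyD)
  have gs: "sq_int (\<lambda>z. g z - s z)" using g ss by (rule sq_int_diff)
  have [measurable]: "g \<in> borel_measurable M" "s \<in> borel_measurable M" "h \<in> borel_measurable M"
    using g ss h by (auto simp: sq_int_def)
  have igs: "sq_int (\<lambda>z. indicator (- E) z * (g z - s z))"
    by (rule sq_int_indicator(1)[OF CE gs])
  have "(LINT z|M. cmod (indicator (- E) z * (g z - s z))) \<le> sqrt (norm2 (\<lambda>z. indicator (- E) z * (g z - s z)))"
    by (rule sq_int_integrable(3)[OF igs])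
  also have "\<dots> < e / 2" using s(3) e by (intro real_less_lsqrt) auto
  finally have b: "(LINT z|M. cmod (indicator (- E) z * (g z - s z))) < e / 2" .
  have ihs: "integrable M (\<lambda>z. cmod (h z - s z))" using h sq_int_integrable(1)[OF ss] by auto
  have ihg: "integrable M (\<lambda>z. cmod (h z - g z))" using h sq_int_integrable(1)[OF g] by auto
  have "(LINT z|M. indicator (- E) z * cmod (h z - s z))
      \<le> (LINT z|M. cmod (h z - g z) + cmod (indicator (- E) z * (g z - s z)))"
  proof (rule integral_mono)
    show "integrable M (\<lambda>z. indicator (- E) z * cmod (h z - s z))"
      by (rule Bochner_Integration.integrable_bound[OF ihs]) (measurable, auto simp: indicator_def)
    show "integrable M (\<lambda>z. cmod (h z - g z) + cmod (indicator (- E) z * (g z - s z)))"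
      using ihg sq_int_integrable(2)[OF igs] by simp
    show "indicator (- E) z * cmod (h z - s z) \<le> cmod (h z - g z) + cmod (indicator (- E) z * (g z - s z))" for z
      by (auto simp: indicator_def intro: norm_diff_triangle_le)
  qed
  also have "\<dots> < e"
    using b n ihg sq_int_integrable(2)[OF igs] by (simp add: g_def)
  finally show ?thesis using that s by blast
qed

text \<open>The weight \<open>G\<close> is merely integrable, so smallness of \<open>u\<close> in L2
  alone is not enough: the part of \<open>G\<close> above n is paid for with the uniform bound 2,
  the part below n with the L2-norm. The bound 2 is that of |w - 1| when |w| \<le> 1.\<close>

lemma integral_weighted_small:
  fixes G :: "complex \<Rightarrow> real"
  assumes G: "integrable M G" "\<And>z. 0 \<le> G z" and e: "0 < e"
  obtains d where "0 < d"
    "\<And>u. sq_int u \<Longrightarrow> AE z in M. cmod (u z) \<le> 2 \<Longrightarrow> norm2 u < d \<Longrightarrow> (LINT z|M. G z * cmod (u z)) < e"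
proof -
  have [measurable]: "G \<in> borel_measurable M" using G by auto
  have imin: "integrable M (\<lambda>z. min (G z) (real n))" for n
    by (rule Bochner_Integration.integrable_bound[OF G(1)]) (use G in auto)
  have "(\<lambda>n. LINT z|M. G z - min (G z) (real n)) \<longlonglongrightarrow> (LINT z|M. 0)"
  proof (rule integral_dominated_convergence[where w = G])
    show "AE z in M. (\<lambda>n. G z - min (G z) (real n)) \<longlonglongrightarrow> 0"
    proof (rule AE_I2)
      fix z
      obtain n0 where n0: "G z \<le> real n0" using real_arch_simple by blast
      have "eventually (\<lambda>n. G z - min (G z) (real n) = 0) sequentially"
        using eventually_ge_at_top[of n0] by eventually_elim (use n0 in auto)
      then show "(\<lambda>n. G z - min (G z) (real n)) \<longlonglongrightarrow> 0" by (rule tendsto_eventually)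
    qed
  qed (use G in auto)
  then have "eventually (\<lambda>n. (LINT z|M. G z - min (G z) (real n)) < e / 4) sequentially"
    using e by (intro order_tendstoD(2)) auto
  then obtain n where n: "(LINT z|M. G z - min (G z) (real n)) < e / 4"
    by (auto simp: eventually_sequentially)
  define d where "d = (e / (2 * (1 + real n)))\<^sup>2"
  show ?thesis
  proof (rule that[of d])
    show "0 < d" using e by (simp add: d_def)
    fix u assume u: "sq_int u" "AE z in M. cmod (u z) \<le> 2" "norm2 u < d"
    have [measurable]: "u \<in> borel_measurable M" using u(1) by (rule sq_int_measurable)
    have "(LINT z|M. cmod (u z)) \<le> sqrt (norm2 u)" by (rule sq_int_integrable(3)[OF u(1)])
    also have "\<dots> < e / (2 * (1 + real n))"
      using u(3) e by (intro real_less_lsqrt) (auto simp: d_def)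
    finally have "(1 + real n) * (LINT z|M. cmod (u z)) < e / 2"
      by (simp add: field_simps)
    moreover have "0 \<le> (LINT z|M. cmod (u z))" by simp
    ultimately have small: "real n * (LINT z|M. cmod (u z)) < e / 2"
      unfolding distrib_right mult_1 by linarith
    have iu: "integrable M (\<lambda>z. cmod (u z))" by (rule sq_int_integrable(2)[OF u(1)])
    have "(LINT z|M. G z * cmod (u z)) \<le> (LINT z|M. 2 * (G z - min (G z) (real n)) + real n * cmod (u z))"
    proof (rule integral_mono_AE)
      show "integrable M (\<lambda>z. G z * cmod (u z))"
        by (rule Bochner_Integration.integrable_bound[where f = "\<lambda>z. 2 * G z"])
          (use G u(2) in \<open>auto elim!: eventually_mono simp: mult.commute[of "G _"] intro: mult_right_mono\<close>)
      show "integrable M (\<lambda>z. 2 * (G z - min (G z) (real n)) + real n * cmod (u z))"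
        using iu imin G(1) by auto
      show "AE z in M. G z * cmod (u z) \<le> 2 * (G z - min (G z) (real n)) + real n * cmod (u z)"
        using u(2)
      proof eventually_elim
        case (elim z)
        have "G z * cmod (u z) = (G z - min (G z) (real n)) * cmod (u z) + min (G z) (real n) * cmod (u z)"
          by (simp add: algebra_simps)
        also have "\<dots> \<le> (G z - min (G z) (real n)) * 2 + real n * cmod (u z)"
          using elim by (intro add_mono mult_mono) auto
        finally show ?case by simp
      qed
    qed
    also have "\<dots> = 2 * (LINT z|M. G z - min (G z) (real n)) + real n * (LINT z|M. cmod (u z))"
      using iu imin G(1) by simp
    also have "\<dots> < e" using n small by simp
    finally show "(LINT z|M. G z * cmod (u z)) < e" .
  qed
qed

lemma ln_max_1_le: "0 \<le> ln (max 1 t)" "0 \<le> t \<Longrightarrow> ln (max 1 t) \<le> (t::real)"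
proof -
  show "0 \<le> ln (max 1 t)" by simp
  show "ln (max 1 t) \<le> t" if "0 \<le> t"
    using that ln_le_minus_one[of "max 1 t"] by (auto simp: max_def split: if_splits)
qed

text \<open>An outer factor with modulus \<open>min 1 (1 / |g|)\<close> on a small neighbourhood \<open>U\<close> of \<open>J\<close> costs
  little, because \<open>U - J\<close> is small, and makes the bound hold on \<open>U\<close>; then it survives
  the Fejer means up to a factor tending to 1.\<close>

theorem polynomials_dense_bounded_hardy:
  fixes J :: "complex set"
  assumes J: "closed J" and g: "g \<in> hardy2" and gJ: "AE z in M. z \<in> J \<longrightarrow> cmod (g z) \<le> 1"
    and e: "0 < e"
  obtains p where "\<And>z. z \<in> J \<Longrightarrow> cmod z = 1 \<Longrightarrow> cmod (poly p z) \<le> 1"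
    "norm2 (\<lambda>z. poly p z - g z) < e"
proof -
  have sg: "sq_int g" using g by (rule hardy2D)
  have [measurable]: "g \<in> borel_measurable M" using sg by (rule sq_int_measurable)
  have ig: "integrable M (\<lambda>z. (cmod (g z))\<^sup>2)" using sg by (simp add: sq_int_def)
  obtain d where d: "0 < d"
    "\<And>u. sq_int u \<Longrightarrow> AE z in M. cmod (u z) \<le> 2 \<Longrightarrow> norm2 u < d \<Longrightarrow> (LINT z|M. (cmod (g z))\<^sup>2 * cmod (u z)) < e / 8"
    using integral_weighted_small[OF ig, of "e / 8"] e by auto
  define U where "U n = (\<Union>s\<in>J. ball s (1 / real (Suc n)))" for n
  have "open (U n)" for n unfolding U_def by (intro open_UN ballI open_ball)
  then have [measurable]: "U n \<in> sets M" "J \<in> sets M" for n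
    using J by (intro sets_circle_measure_borel borel_open borel_closed; simp)+
  define v where "v n z = indicator (U n - J) z * ln (max 1 (cmod (g z)))" for n z
  have mv[measurable]: "v n \<in> borel_measurable M" for n unfolding v_def by measurable
  have v0: "0 \<le> v n z" for n z using ln_max_1_le by (simp add: v_def)
  have vg: "v n z \<le> cmod (g z)" for n z
    using ln_max_1_le[of "cmod (g z)"] by (auto simp: v_def indicator_def)
  have v2: "integrable M (\<lambda>z. (v n z)\<^sup>2)" for n
    by (rule Bochner_Integration.integrable_bound[OF ig]) (use v0 vg in \<open>auto intro: power_mono\<close>)
  have "(\<lambda>n. LINT z|M. v n z) \<longlonglongrightarrow> (LINT z|M. 0)"
  \<comment> \<open>Each point off J leaves \<open>U n\<close> eventually because J is closed; on J
    the function vanishes by construction.\<close>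
  proof (rule integral_dominated_convergence[where w = "\<lambda>z. cmod (g z)"])
    show "AE z in M. (\<lambda>n. v n z) \<longlonglongrightarrow> 0"
    proof (rule AE_I2)
      fix z
      show "(\<lambda>n. v n z) \<longlonglongrightarrow> 0"
      proof (cases "z \<in> J")
        case False
        then obtain r where r: "0 < r" "ball z r \<inter> J = {}"
          using J open_contains_ball[of "- J"] by blast
        obtain n0 where n0: "1 / real (Suc n0) < r" using nat_approx_posE[OF r(1)] by blast
        have "v n z = 0" if "n \<ge> n0" for n
        proof -
          have "1 / real (Suc n) \<le> 1 / real (Suc n0)" using that by (simp add: frac_le)
          have "z \<notin> U n"
          proof
            assume "z \<in> U n"
            then obtain s where s: "s \<in> J" "dist s z < 1 / real (Suc n)" unfolding U_def by auto
            then have "s \<in> ball z r" using n0 \<open>1 / real (Suc n) \<le> 1 / real (Suc n0)\<close> by (simp add: dist_commute)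
            then show False using r(2) s(1) by blast
          qed
          then show ?thesis by (simp add: v_def)
        qed
        then have "eventually (\<lambda>n. v n z = 0) sequentially" by (auto simp: eventually_sequentially)
        then show ?thesis by (rule tendsto_eventually)
      qed (simp add: v_def)
    qed
    show "AE z in M. norm (v n z) \<le> cmod (g z)" for n using v0 vg by simp
  qed (use sq_int_integrable(2)[OF sg] in auto)
  then have "eventually (\<lambda>n. (LINT z|M. v n z) < d / 2) sequentially"
    using d(1) by (intro order_tendstoD(2)) auto
  then obtain n where n: "(LINT z|M. v n z) < d / 2" by (auto simp: eventually_sequentially)
  obtain w where w: "w \<in> hardy2" "AE z in M. cmod (w z) = exp (- v n z)" "AE z in M. cmod (w z) \<le> 1"
    "fourier_coeff w 0 = of_real (exp (- (LINT z|M. v n z)))"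
    "norm2 (\<lambda>z. w z - 1) \<le> 2 * (LINT z|M. v n z)"
    by (rule outer_function[OF mv[of n] v2[of n] v0[of n]])
  have sw: "sq_int w" using w(1) by (rule hardy2D)
  have [measurable]: "w \<in> borel_measurable M" using sw by (rule sq_int_measurable)
  have sw1: "sq_int (\<lambda>z. w z - 1)"
    using sq_int_diff(1)[OF sw sq_int_constant[of 1]] by simp
  have w2: "AE z in M. cmod (w z - 1) \<le> 2"
    using w(3)
  proof eventually_elim
    case (elim z)
    then show ?case using norm_triangle_ineq4[of "w z" 1] by simp
  qed
  define g1 where "g1 z = w z * g z" for z
  have g1: "g1 \<in> hardy2" unfolding g1_def[abs_def] by (rule hardy2_mult_bounded[OF g w(1,3)])
  have sg1: "sq_int g1" using g1 by (rule hardy2D)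
  \<comment> \<open>As \<open>g\<close> may be unbounded, |g|^2 is kept as an integrable weight; one
    of the two factors |w - 1| is bounded by 2.\<close>
  have "norm2 (\<lambda>z. g1 z - g z) \<le> (LINT z|M. 2 * ((cmod (g z))\<^sup>2 * cmod (w z - 1)))"
    unfolding norm2_def
  proof (rule integral_mono_AE)
    show "integrable M (\<lambda>z. (cmod (g1 z - g z))\<^sup>2)"
      using sq_int_diff(1)[OF sg1 sg] by (simp add: sq_int_def)
    show "integrable M (\<lambda>z. 2 * ((cmod (g z))\<^sup>2 * cmod (w z - 1)))"
    proof (rule Bochner_Integration.integrable_bound)
      show "integrable M (\<lambda>z. 4 * (cmod (g z))\<^sup>2)" using ig by simp
      show "AE z in M. norm (2 * ((cmod (g z))\<^sup>2 * cmod (w z - 1))) \<le> norm (4 * (cmod (g z))\<^sup>2)"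
        using w2
      proof eventually_elim
        case (elim z)
        then show ?case using mult_left_mono[OF elim, of "(cmod (g z))\<^sup>2"] by (simp add: mult.commute)
      qed
    qed measurable
    show "AE z in M. (cmod (g1 z - g z))\<^sup>2 \<le> 2 * ((cmod (g z))\<^sup>2 * cmod (w z - 1))"
      using w2
    proof eventually_elim
      case (elim z)
      have "g1 z - g z = g z * (w z - 1)" by (simp add: g1_def algebra_simps)
      then have "(cmod (g1 z - g z))\<^sup>2 = (cmod (g z))\<^sup>2 * (cmod (w z - 1) * cmod (w z - 1))"
        by (simp add: norm_mult power2_eq_square)
      also have "\<dots> \<le> (cmod (g z))\<^sup>2 * (2 * cmod (w z - 1))"
        using elim by (intro mult_left_mono mult_right_mono) auto
      finally show ?case by simp
    qed
  qed
  also have "\<dots> = 2 * (LINT z|M. (cmod (g z))\<^sup>2 * cmod (w z - 1))" by simp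
  also have "\<dots> < e / 4" using d(2)[OF sw1 w2] w(5) n by simp
  finally have g1g: "norm2 (\<lambda>z. g1 z - g z) < e / 4" .
  have g1U: "AE z in M. z \<in> U n \<longrightarrow> cmod (g1 z) \<le> 1"
    using w(2,3) gJ
  proof eventually_elim
    case (elim z)
    show ?case
    proof
      assume z: "z \<in> U n"
      show "cmod (g1 z) \<le> 1"
      proof (cases "z \<in> J")
        case True
        then show ?thesis using elim by (simp add: g1_def norm_mult mult_le_one)
      next
        case False
        then have "cmod (w z) = inverse (max 1 (cmod (g z)))"
          using elim(1) z by (simp add: v_def exp_minus)
        then show ?thesis by (simp add: g1_def norm_mult field_simps max_def)
      qed
    qed
  qed
  define C where "C = 4 / (1 / real (Suc n))\<^sup>2 * (LINT z|M. cmod (g1 z))"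
  have C0: "0 \<le> C" by (simp add: C_def)
  \<comment> \<open>The reciprocal of the local bound on J, which exceeds 1 only by C / (N + 1);
    scaling by it restores the constraint exactly.\<close>
  define c where "c N = 1 / (1 + C / real (Suc N))" for N
  have c: "0 < c N" "c N \<le> 1" for N
    using C0 by (auto simp: c_def add_pos_nonneg simp del: of_nat_Suc)
  have c1: "c \<longlonglongrightarrow> 1"
  proof -
    have "(\<lambda>N. C / real (Suc N)) \<longlonglongrightarrow> 0"
      using tendsto_mult[OF tendsto_const[of C] LIMSEQ_inverse_real_of_nat] by (simp add: divide_inverse)
    then have "(\<lambda>N. 1 / (1 + C / real (Suc N))) \<longlonglongrightarrow> 1 / (1 + 0)" by (intro tendsto_intros) auto
    then show ?thesis by (simp add: c_def[abs_def])
  qed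
  define p where "p N = smult (of_real (c N)) (fejer_poly N g1)" for N
  have pJ: "cmod (poly (p N) z) \<le> 1" if "z \<in> J" "cmod z = 1" for N z
  proof -
    have "cmod (fejer N g1 z) \<le> 1 + 4 / (1 / real (Suc n))\<^sup>2 * (LINT z|M. cmod (g1 z)) / Suc N"
    proof (rule fejer_local_bound[OF sq_int_integrable(1)[OF sg1] that(2)])
      show "AE s in M. cmod (z - s) < 1 / real (Suc n) \<longrightarrow> cmod (g1 s) \<le> 1"
        using g1U that(1) by (auto simp: U_def dist_norm elim!: eventually_mono)
    qed auto
    then have "cmod (fejer N g1 z) \<le> 1 + C / real (Suc N)" by (simp only: C_def)
    then have "c N * cmod (fejer N g1 z) \<le> c N * (1 + C / real (Suc N))"
      using c(1)[of N] by (intro mult_left_mono) auto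
    also have "\<dots> = 1" using C0 by (simp add: c_def add_pos_nonneg less_imp_neq[symmetric] del: of_nat_Suc)
    finally show ?thesis
      using c(1)[of N] by (simp add: p_def poly_fejer_poly[OF g1] norm_mult)
  qed
  have bound: "norm2 (\<lambda>z. poly (p N) z - g1 z)
      \<le> 2 * norm2 (\<lambda>z. poly (fejer_poly N g1) z - g1 z) + 2 * ((1 - c N)\<^sup>2 * norm2 g1)" for N
  proof -
    let ?q = "poly (fejer_poly N g1)"
    have s: "sq_int (\<lambda>z. ?q z - g1 z)" by (intro sq_int_diff sq_int_poly sg1)
    have "poly (p N) z - g1 z = of_real (c N) * (?q z - g1 z) + of_real (c N - 1) * g1 z" for z
      by (simp add: p_def algebra_simps)
    then have "norm2 (\<lambda>z. poly (p N) z - g1 z) \<le>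
        2 * norm2 (\<lambda>z. of_real (c N) * (?q z - g1 z)) + 2 * norm2 (\<lambda>z. of_real (c N - 1) * g1 z)"
      using sq_int_add(2)[OF sq_int_cmult(1)[OF s, of "of_real (c N)"] sq_int_cmult(1)[OF sg1, of "of_real (c N - 1)"]]
      by simp
    also have "\<dots> = 2 * ((c N)\<^sup>2 * norm2 (\<lambda>z. ?q z - g1 z)) + 2 * ((1 - c N)\<^sup>2 * norm2 g1)"
      unfolding sq_int_cmult(2)[OF s] sq_int_cmult(2)[OF sg1] norm_of_real power2_abs
      by (simp add: power2_commute)
    also have "(c N)\<^sup>2 * norm2 (\<lambda>z. ?q z - g1 z) \<le> 1 * norm2 (\<lambda>z. ?q z - g1 z)"
      using c[of N] by (intro mult_right_mono) (auto simp: power_le_one)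
    finally show ?thesis by simp
  qed
  have "(\<lambda>N. 2 * norm2 (\<lambda>z. poly (fejer_poly N g1) z - g1 z) + 2 * ((1 - c N)\<^sup>2 * norm2 g1))
      \<longlonglongrightarrow> 2 * 0 + 2 * ((1 - 1)\<^sup>2 * norm2 g1)"
    by (intro tendsto_add tendsto_mult tendsto_const tendsto_power tendsto_diff c1 hardy2_poly_approx g1)
  then have "eventually (\<lambda>N. 2 * norm2 (\<lambda>z. poly (fejer_poly N g1) z - g1 z) + 2 * ((1 - c N)\<^sup>2 * norm2 g1) < e / 4) sequentially"
    using e by (intro order_tendstoD(2)) auto
  then obtain N where "2 * norm2 (\<lambda>z. poly (fejer_poly N g1) z - g1 z) + 2 * ((1 - c N)\<^sup>2 * norm2 g1) < e / 4"
    by (auto simp: eventually_sequentially)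
  then have "norm2 (\<lambda>z. poly (p N) z - g z) < e"
    using bound[of N] g1g norm2_triangle[OF sq_int_poly sg1 sg, of "p N"] e by simp
  then show ?thesis using that[of "p N"] pJ by blast
qed

section \<open>The extremal problems\<close>

lemma norm2_expand:
  assumes a: "sq_int a" and b: "sq_int b"
  shows "norm2 (\<lambda>z. a z - of_real t * b z) = norm2 a - 2 * t * Re (LINT z|M. cnj (a z) * b z) + t\<^sup>2 * norm2 b"
proof -
  have i: "integrable M (\<lambda>z. cnj (a z) * b z)"
    by (intro sq_int_mult_integrable sq_int_cnj a b)
  have i2: "integrable M (\<lambda>z. (cmod (a z))\<^sup>2)" "integrable M (\<lambda>z. (cmod (b z))\<^sup>2)"
    using a b by (auto simp: sq_int_def)
  have eq: "(cmod (a z - of_real t * b z))\<^sup>2 = (cmod (a z))\<^sup>2 - 2 * t * Re (cnj (a z) * b z) + t\<^sup>2 * (cmod (b z))\<^sup>2" for z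
    unfolding cmod_power2 by (simp add: power2_eq_square algebra_simps)
  show ?thesis
    unfolding norm2_def eq using i2 integrable_Re[OF i] integral_Re[OF i] by simp
qed

text \<open>Up to a small \<open>L\<^sup>1\<close> error off \<open>I\<close>, each test function is the trace of a bounded
  \<open>s \<in> H\<^sup>2\<close> with \<open>s(0) = 0\<close>, and \<open>d\<^sub>n s\<close> has integral 0 over the whole circle.\<close>

theorem weak_convergence_off_set:
  assumes I: "I \<in> sets M" "0 < measure M I"
    and d: "\<And>n. d n \<in> hardy2" and d2: "\<And>n. AE z in M. z \<notin> I \<longrightarrow> cmod (d n z) \<le> 2"
    and lim: "(\<lambda>n. norm2 (\<lambda>z. indicator I z * d n z)) \<longlonglongrightarrow> 0"
    and h: "integrable M h"
  shows "(\<lambda>n. LINT z|M. indicator (- I) z * (d n z * h z)) \<longlonglongrightarrow> 0"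
proof (rule LIMSEQ_I)
  fix e :: real assume e: "0 < e"
  have CI[measurable]: "- I \<in> sets M" by (rule Compl_sets_circle_measure[OF I(1)])
  note I(1)[measurable]
  obtain s where s: "s \<in> bounded_hardy" "fourier_coeff s 0 = 0"
    "(LINT z|M. indicator (- I) z * cmod (h z - s z)) < e / 4"
    using bounded_hardy_dense_L1[OF I h, of "e / 4"] e by auto
  have ss: "sq_int s" using s(1) by (intro hardy2D bounded_hardyD)
  have sd: "sq_int (d n)" for n using d by (rule hardy2D)
  have [measurable]: "h \<in> borel_measurable M" "s \<in> borel_measurable M" "d n \<in> borel_measurable M" for n
    using h ss sd[of n] by (auto simp: sq_int_def)
  have ihs: "integrable M (\<lambda>z. cmod (h z - s z))" using h sq_int_integrable(1)[OF ss] by auto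
  have iind: "integrable M (\<lambda>z. indicator (- I) z * cmod (h z - s z))"
    by (rule Bochner_Integration.integrable_bound[OF ihs]) (measurable, auto simp: indicator_def)
  have bound: "cmod (LINT z|M. indicator (- I) z * (d n z * h z))
      \<le> e / 2 + sqrt (norm2 (\<lambda>z. indicator I z * d n z)) * sqrt (norm2 s)" for n
  proof -
    have ds0: "(LINT z|M. d n z * s z) = 0"
      using hardy2_mult(2)[OF bounded_hardyD[OF s(1)] d[of n]] s(2) by (simp add: fourier_coeff_0)
    have ids: "integrable M (\<lambda>z. d n z * s z)" by (rule sq_int_mult_integrable(1)[OF sd ss])
    have sI: "sq_int (\<lambda>z. indicator I z * d n z)" by (rule sq_int_indicator[OF I(1) sd])
    have iI: "integrable M (\<lambda>z. (indicator I z * d n z) * s z)"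
      by (rule sq_int_mult_integrable(1)[OF sI ss])
    have iJ: "integrable M (\<lambda>z. indicator (- I) z * (d n z * (h z - s z)))"
    proof (rule Bochner_Integration.integrable_bound)
      show "integrable M (\<lambda>z. 2 * (indicator (- I) z * cmod (h z - s z)))" using iind by simp
      show "AE z in M. norm (indicator (- I) z * (d n z * (h z - s z))) \<le> norm (2 * (indicator (- I) z * cmod (h z - s z)))"
        using d2[of n] by eventually_elim (auto simp: indicator_def norm_mult intro: mult_right_mono)
    qed measurable
    \<comment> \<open>Off \<open>I\<close>, d h = d (h - s) + d s. Since d s has mean 0, its
      integral off \<open>I\<close> is minus the one over \<open>I\<close>, where d tends to 0 in
      L2.\<close>
    have "(LINT z|M. indicator (- I) z * (d n z * h z))
        = (LINT z|M. indicator (- I) z * (d n z * (h z - s z)) + (d n z * s z - (indicator I z * d n z) * s z))"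
      by (intro Bochner_Integration.integral_cong) (auto simp: indicator_def algebra_simps)
    also have "\<dots> = (LINT z|M. indicator (- I) z * (d n z * (h z - s z))) - (LINT z|M. (indicator I z * d n z) * s z)"
      using iJ iI ids ds0 by simp
    finally have "cmod (LINT z|M. indicator (- I) z * (d n z * h z))
        \<le> cmod (LINT z|M. indicator (- I) z * (d n z * (h z - s z))) + cmod (LINT z|M. (indicator I z * d n z) * s z)"
      by (simp only: norm_triangle_ineq4)
    moreover have "cmod (LINT z|M. indicator (- I) z * (d n z * (h z - s z))) \<le> (LINT z|M. cmod (indicator (- I) z * (d n z * (h z - s z))))"
      by (rule integral_norm_bound)
    moreover have "(LINT z|M. cmod (indicator (- I) z * (d n z * (h z - s z)))) \<le> (LINT z|M. 2 * (indicator (- I) z * cmod (h z - s z)))"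
    proof (rule integral_mono_AE)
      show "AE z in M. cmod (indicator (- I) z * (d n z * (h z - s z))) \<le> 2 * (indicator (- I) z * cmod (h z - s z))"
        using d2[of n] by eventually_elim (auto simp: indicator_def norm_mult intro: mult_right_mono)
    qed (use iJ iind in auto)
    moreover have "(LINT z|M. 2 * (indicator (- I) z * cmod (h z - s z))) \<le> e / 2" using s(3) by simp
    moreover have "cmod (LINT z|M. (indicator I z * d n z) * s z) \<le> sqrt (norm2 (\<lambda>z. indicator I z * d n z)) * sqrt (norm2 s)"
      by (rule sq_int_mult_integrable(4)[OF sI ss])
    ultimately show ?thesis by linarith
  qed
  have "(\<lambda>n. sqrt (norm2 (\<lambda>z. indicator I z * d n z)) * sqrt (norm2 s)) \<longlonglongrightarrow> sqrt 0 * sqrt (norm2 s)"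
    by (intro tendsto_mult tendsto_real_sqrt lim tendsto_const)
  then have "eventually (\<lambda>n. sqrt (norm2 (\<lambda>z. indicator I z * d n z)) * sqrt (norm2 s) < e / 2) sequentially"
    using e by (intro order_tendstoD(2)) auto
  then have "eventually (\<lambda>n. norm ((LINT z|M. indicator (- I) z * (d n z * h z)) - 0) < e) sequentially"
  proof eventually_elim
    case (elim n)
    then show ?case using bound[of n] by simp
  qed
  then show "\<exists>n0. \<forall>n\<ge>n0. norm ((LINT z|M. indicator (- I) z * (d n z * h z)) - 0) < e"
    by (simp add: eventually_sequentially)
qed

text \<open>Were the real part R positive, the quadratic
  \<open>norm2 (\<lambda>z. psi z - of_real t * b z)\<close> in \<open>t\<close> would start with
  the slope -2R < 0.\<close>

lemma variational_inequality:
  assumes psi: "sq_int psi" and b: "sq_int b"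
    and min: "\<And>t. 0 < t \<Longrightarrow> t \<le> 1 \<Longrightarrow> norm2 psi \<le> norm2 (\<lambda>z. psi z - of_real t * b z)"
  shows "Re (LINT z|M. cnj (psi z) * b z) \<le> 0"
proof (rule ccontr)
  define R where "R = Re (LINT z|M. cnj (psi z) * b z)"
  assume "\<not> Re (LINT z|M. cnj (psi z) * b z) \<le> 0"
  then have R: "0 < R" by (simp add: R_def)
  \<comment> \<open>Small enough that the quadratic term \<open>t * norm2 b\<close> stays below R
    and cannot make up for 2R; the summand 1 avoids division by 0.\<close>
  define t where "t = min 1 (R / (norm2 b + 1))"
  have b1: "0 < norm2 b + 1" by (simp add: add_nonneg_pos)
  have t: "0 < t" "t \<le> 1" "t * (norm2 b + 1) \<le> R"
  proof -
    show "0 < t" "t \<le> 1" using R b1 by (auto simp: t_def)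
    have "t \<le> R / (norm2 b + 1)" unfolding t_def by (rule min.cobounded2)
    then show "t * (norm2 b + 1) \<le> R" using b1 by (simp only: pos_le_divide_eq)
  qed
  have "0 \<le> t * (t * norm2 b - 2 * R)"
    using min[OF t(1,2)] norm2_expand[OF psi b, of t] by (simp add: R_def power2_eq_square algebra_simps)
  then have "2 * R \<le> t * norm2 b" using t(1) by (simp add: zero_le_mult_iff)
  then show False using t(1,3) R by (simp add: algebra_simps)
qed

text \<open>The left-hand side is min t a: what truncation at height \<open>a\<close> by an outer
  factor leaves of a modulus \<open>t\<close>.\<close>

lemma min_div_max: "0 \<le> t \<Longrightarrow> 0 < a \<Longrightarrow> exp (- ln (max 1 (t / a))) * t \<le> (a::real)"
  by (auto simp: exp_minus max_def field_simps)

text \<open>The first order optimality condition of the bounded extremal problem says that the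
  functional \<open>s \<mapsto> \<langle>s, \<psi>\<rangle>\<close> on bounded \<open>s \<in> H\<^sup>2\<close> is controlled by the supremum of \<open>|s|\<close> over
  \<open>Y\<close>. If the remaining set \<open>E\<close> has positive measure, this forces \<open>\<psi> = 0\<close>: approximate
  \<open>\<psi>\<close> off \<open>E\<close> by such \<open>s\<close>, and use an outer factor to truncate \<open>s\<close> on \<open>Y\<close>, where \<open>\<psi> = 0\<close>.\<close>

lemma functional_controlled_on_proper_subset_zero:
  assumes E: "E \<in> sets M" "0 < measure M E" and Y: "Y \<in> sets M" "Y \<inter> E = {}"
    and psi: "sq_int psi" "\<And>z. z \<in> Y \<union> E \<Longrightarrow> psi z = 0"
    and K: "\<And>s a. s \<in> bounded_hardy \<Longrightarrow> 0 < a \<Longrightarrow> AE z in M. z \<in> Y \<longrightarrow> cmod (s z) \<le> a \<Longrightarrow>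
      Re (LINT z|M. cnj (psi z) * s z) \<le> a * K"
  shows "norm2 psi = 0"
proof -
  have CE[measurable]: "- E \<in> sets M" by (rule Compl_sets_circle_measure[OF E(1)])
  note Y(1)[measurable]
  have [measurable]: "psi \<in> borel_measurable M" using psi(1) by (rule sq_int_measurable)
  have ipsi: "integrable M (\<lambda>z. (cmod (psi z))\<^sup>2)" using psi(1) by (simp add: sq_int_def)
  have key: "norm2 psi \<le> a * K + eta" if a: "0 < a" and eta: "0 < eta" for a eta
  proof -
    obtain d where d: "0 < d"
      "\<And>u. sq_int u \<Longrightarrow> AE z in M. cmod (u z) \<le> 2 \<Longrightarrow> norm2 u < d \<Longrightarrow> (LINT z|M. (cmod (psi z))\<^sup>2 * cmod (u z)) < eta / 2"
      using integral_weighted_small[OF ipsi, of "eta / 2"] eta by auto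
    \<comment> \<open>The first entry brings the mean of \<open>v\<close> below
      \<open>d / 2\<close>; the second keeps the pairing of \<open>psi\<close> with the error
      \<open>D\<close> within \<open>eta / 4\<close>.\<close>
    define x where "x = min (a * d / 4) (eta / (4 * (1 + sqrt (norm2 psi))))"
    have x: "0 < x" "x \<le> a * d / 4" "sqrt (norm2 psi) * x \<le> eta / 4"
    proof -
      have p: "0 < 1 + sqrt (norm2 psi)" by (simp add: add_pos_nonneg)
      show "0 < x" using a d eta p by (simp add: x_def)
      show "x \<le> a * d / 4" unfolding x_def by (rule min.cobounded1)
      have "(1 + sqrt (norm2 psi)) * x \<le> (1 + sqrt (norm2 psi)) * (eta / (4 * (1 + sqrt (norm2 psi))))"
        using p by (intro mult_left_mono) (auto simp: x_def)
      also have "\<dots> = eta / 4" using p by (simp add: field_simps)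
      finally show "sqrt (norm2 psi) * x \<le> eta / 4" using \<open>0 < x\<close> by (simp add: distrib_right)
    qed
    obtain s where s: "s \<in> bounded_hardy" "norm2 (\<lambda>z. indicator (- E) z * (psi z - s z)) < x\<^sup>2"
      using bounded_hardy_dense_L2[OF E psi(1), of "x\<^sup>2"] x(1) by auto
    have ss: "sq_int s" using s(1) by (intro hardy2D bounded_hardyD)
    have [measurable]: "s \<in> borel_measurable M" using ss by (rule sq_int_measurable)
    define D where "D z = indicator (- E) z * (psi z - s z)" for z
    have sD: "sq_int D" unfolding D_def[abs_def]
      by (rule sq_int_indicator(1)[OF CE sq_int_diff(1)[OF psi(1) ss]])
    have Dx: "sqrt (norm2 D) < x" using s(2) x(1) by (intro real_less_lsqrt) (auto simp: D_def[abs_def])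
    define v where "v z = indicator Y z * ln (max 1 (cmod (s z) / a))" for z
    have mv[measurable]: "v \<in> borel_measurable M" unfolding v_def by measurable
    have v0: "0 \<le> v z" for z using ln_max_1_le by (simp add: v_def)
    \<comment> \<open>As \<open>psi\<close> vanishes on \<open>Y\<close>, the approximation error
      there is -s: the function \<open>s\<close> is small on \<open>Y\<close> in mean, so truncating
      it is cheap.\<close>
    have vD: "v z \<le> cmod (D z) / a" for z
    proof (cases "z \<in> Y")
      case True
      then have "z \<notin> E" using Y(2) by auto
      then have "D z = - s z" using psi(2)[of z] True by (simp add: D_def)
      then show ?thesis using True ln_max_1_le(2)[of "cmod (s z) / a"] a by (simp add: v_def)
    qed (use a in \<open>simp add: v_def\<close>)
    have iD: "integrable M (\<lambda>z. (cmod (D z))\<^sup>2)" using sD by (simp add: sq_int_def)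
    have v2: "integrable M (\<lambda>z. (v z)\<^sup>2)"
    proof (rule Bochner_Integration.integrable_bound)
      show "integrable M (\<lambda>z. (cmod (D z))\<^sup>2 / a\<^sup>2)" using iD by simp
      have "(v z)\<^sup>2 \<le> (cmod (D z) / a)\<^sup>2" for z using v0 vD by (intro power_mono)
      then show "AE z in M. norm ((v z)\<^sup>2) \<le> norm ((cmod (D z))\<^sup>2 / a\<^sup>2)"
        by (simp add: power_divide)
    qed measurable
    have iv: "(LINT z|M. v z) < d / 2"
    proof -
      have "(LINT z|M. v z) \<le> (LINT z|M. cmod (D z) / a)"
      proof (rule integral_mono_AE')
        show "integrable M (\<lambda>z. cmod (D z) / a)" using sq_int_integrable(2)[OF sD] by simp
      qed (use vD v0 a in auto)
      also have "\<dots> \<le> sqrt (norm2 D) / a"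
        using sq_int_integrable(3)[OF sD] a by (simp add: divide_right_mono)
      also have "\<dots> < x / a" using Dx a by (rule divide_strict_right_mono)
      also have "\<dots> \<le> d / 4" using x(2) a by (simp add: field_simps)
      finally show ?thesis using d(1) by simp
    qed
    obtain w where w: "w \<in> hardy2" "AE z in M. cmod (w z) = exp (- v z)" "AE z in M. cmod (w z) \<le> 1"
      "fourier_coeff w 0 = of_real (exp (- (LINT z|M. v z)))"
    "norm2 (\<lambda>z. w z - 1) \<le> 2 * (LINT z|M. v z)"
    by (rule outer_function[OF mv v2 v0])
    have wb: "w \<in> bounded_hardy" using w(1,3) by (auto simp: bounded_hardy_def)
    have sw: "sq_int w" using w(1) by (rule hardy2D)
    have [measurable]: "w \<in> borel_measurable M" using sw by (rule sq_int_measurable)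
    have sw1: "sq_int (\<lambda>z. w z - 1)" by (rule sq_int_diff(1)[OF sw sq_int_constant])
    have w2: "AE z in M. cmod (w z - 1) \<le> 2"
      using w(3)
    proof eventually_elim
      case (elim z)
      then show ?case using norm_triangle_ineq4[of "w z" 1] by simp
    qed
    have wsb: "(\<lambda>z. w z * s z) \<in> bounded_hardy" by (rule bounded_hardy_mult(1)[OF wb s(1)])
    have "AE z in M. z \<in> Y \<longrightarrow> cmod (w z * s z) \<le> a"
      using w(2) by eventually_elim (auto simp: v_def norm_mult intro!: min_div_max a)
    from K[OF wsb a this] have up: "Re (LINT z|M. cnj (psi z) * (w z * s z)) \<le> a * K" .
    have spw: "sq_int (\<lambda>z. w z * psi z)"
      by (rule sq_int_mult_bounded[OF _ _ psi(1) w(3)]) measurable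
    have swD: "sq_int (\<lambda>z. w z * D z)"
      by (rule sq_int_mult_bounded[OF _ _ sD w(3)]) (use sD in \<open>auto simp: sq_int_def\<close>)
    have nwD: "norm2 (\<lambda>z. w z * D z) \<le> norm2 D" unfolding norm2_def
    proof (rule integral_mono_AE)
      show "AE z in M. (cmod (w z * D z))\<^sup>2 \<le> (cmod (D z))\<^sup>2"
        using w(3) by eventually_elim (auto simp: norm_mult intro!: power_mono mult_left_le_one_le)
    qed (use swD sD in \<open>auto simp: sq_int_def\<close>)
    have i1: "integrable M (\<lambda>z. cnj (psi z) * (w z * D z))"
      by (intro sq_int_mult_integrable sq_int_cnj psi swD)
    have i2: "integrable M (\<lambda>z. cnj (psi z) * ((w z - 1) * psi z))"
      using sq_int_mult_integrable(1)[OF sq_int_cnj[OF psi(1)] sq_int_diff(1)[OF spw psi(1)]]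
      by (simp add: left_diff_distrib)
    have i3: "integrable M (\<lambda>z. cnj (psi z) * psi z)"
      by (intro sq_int_mult_integrable sq_int_cnj psi)
    \<comment> \<open>Off \<open>E\<close> this substitutes s = psi - D; on \<open>E\<close> every
      term contains the factor cnj(psi) = 0.\<close>
    have "cnj (psi z) * (w z * s z) = cnj (psi z) * psi z + cnj (psi z) * ((w z - 1) * psi z) - cnj (psi z) * (w z * D z)" for z
      using psi(2)[of z] by (cases "z \<in> E") (auto simp: D_def algebra_simps)
    then have "(LINT z|M. cnj (psi z) * (w z * s z))
        = (LINT z|M. cnj (psi z) * psi z) + (LINT z|M. cnj (psi z) * ((w z - 1) * psi z)) - (LINT z|M. cnj (psi z) * (w z * D z))"
      using i1 i2 i3 by simp
    then have eq: "Re (LINT z|M. cnj (psi z) * (w z * s z))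
        = Re (LINT z|M. cnj (psi z) * psi z) + Re (LINT z|M. cnj (psi z) * ((w z - 1) * psi z)) - Re (LINT z|M. cnj (psi z) * (w z * D z))"
      by simp
    have n: "Re (LINT z|M. cnj (psi z) * psi z) = norm2 psi"
    proof -
      have "cnj (psi z) * psi z = complex_of_real ((cmod (psi z))\<^sup>2)" for z
        using complex_norm_square[of "psi z"] by (simp add: mult.commute)
      then show ?thesis by (simp only: integral_complex_of_real norm2_def Re_complex_of_real)
    qed
    have "\<bar>Re (LINT z|M. cnj (psi z) * (w z * D z))\<bar> \<le> cmod (LINT z|M. cnj (psi z) * (w z * D z))"
      by (rule abs_Re_le_cmod)
    also have "\<dots> \<le> sqrt (norm2 (\<lambda>z. cnj (psi z))) * sqrt (norm2 (\<lambda>z. w z * D z))"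
      by (rule sq_int_mult_integrable(4)[OF sq_int_cnj[OF psi(1)] swD])
    also have "\<dots> \<le> sqrt (norm2 psi) * x"
    proof (rule mult_mono)
      show "sqrt (norm2 (\<lambda>z. w z * D z)) \<le> x"
        using real_sqrt_le_mono[OF nwD] Dx by linarith
    qed (auto simp: norm2_def)
    finally have e1: "\<bar>Re (LINT z|M. cnj (psi z) * (w z * D z))\<bar> \<le> eta / 4" using x(3) by simp
    have "\<bar>Re (LINT z|M. cnj (psi z) * ((w z - 1) * psi z))\<bar> \<le> cmod (LINT z|M. cnj (psi z) * ((w z - 1) * psi z))"
      by (rule abs_Re_le_cmod)
    also have "\<dots> \<le> (LINT z|M. cmod (cnj (psi z) * ((w z - 1) * psi z)))"
      by (rule integral_norm_bound)
    also have "\<dots> = (LINT z|M. (cmod (psi z))\<^sup>2 * cmod (w z - 1))"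
      by (intro Bochner_Integration.integral_cong) (auto simp: norm_mult power2_eq_square)
    also have "\<dots> < eta / 2" using d(2)[OF sw1 w2] w(5) iv by simp
    finally show ?thesis using eq up n e1 eta by linarith
  qed
  have "norm2 psi \<le> 0 + e" if e: "0 < e" for e
  proof -
    \<comment> \<open>The bound \<open>K\<close> depends on neither \<open>a\<close> nor
      \<open>eta\<close>, so both can be made small independently.\<close>
    define a where "a = e / (2 * (1 + \<bar>K\<bar>))"
    have a: "0 < a" using e by (simp add: a_def add_pos_nonneg)
    have "a * K \<le> a * (1 + \<bar>K\<bar>)" using a by (intro mult_left_mono) auto
    also have "\<dots> = e / 2" by (simp add: a_def field_simps)
    finally show ?thesis using key[OF a, of "e / 2"] e by simp
  qed
  then have "norm2 psi \<le> 0" by (rule field_le_epsilon)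
  then show ?thesis using norm2_nonneg[of psi] by linarith
qed

section \<open>Arcs as subsets of the circle\<close>

lemma cis_shift: "cis (t - 2 * pi * of_int k) = cis t"
  using cis_multiple_2pi[of "of_int k"] by (simp add: cis_divide[symmetric])

text \<open>The complement of the arc is the image of the closed interval from b to a + 2 pi, hence
  compact; for b = a + 2 pi it is a single point.\<close>

lemma open_arc_complement:
  assumes "open_arc A"
  shows "A \<subseteq> sphere 0 1" "closed (sphere 0 1 - A)"
proof -
  obtain a b where ab: "a < b" "b \<le> a + 2 * pi" "A = cis ` {a<..<b}"
    using assms by (auto simp: open_arc_def)
  show "A \<subseteq> sphere 0 1" using ab by auto
  have "sphere 0 1 - A = cis ` {b..a + 2 * pi}"
  proof (intro equalityI subsetI)
    fix z assume z: "z \<in> sphere 0 1 - A"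
    define u where "u = Arg z"
    have u: "cis u = z" using z rcis_cmod_Arg[of z] by (simp add: u_def rcis_def)
    define k where "k = \<lfloor>(u - a) / (2 * pi)\<rfloor>"
    define t where "t = u - 2 * pi * of_int k"
    have t: "cis t = z" using u by (simp add: t_def cis_shift)
    have "of_int k \<le> (u - a) / (2 * pi)" "(u - a) / (2 * pi) < of_int k + 1"
      by (auto simp: k_def)
    then have ta: "a \<le> t" "t < a + 2 * pi"
      by (auto simp: t_def field_simps)
    have "t \<notin> {a<..<b}" using z t ab(3) by auto
    then consider "t = a" | "b \<le> t" using ta by force
    then show "z \<in> cis ` {b..a + 2 * pi}"
    proof cases
      case 1
      \<comment> \<open>The endpoint a is represented by a + 2 pi, the right end of the closed
        interval.\<close>
      then have "cis (a + 2 * pi) = z" using t cis_shift[of a "-1"] by simp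
      then show ?thesis using ab by (intro image_eqI[of _ _ "a + 2 * pi"]) auto
    next
      case 2
      then show ?thesis using t ta by (intro image_eqI[of _ _ t]) auto
    qed
  next
    fix z assume "z \<in> cis ` {b..a + 2 * pi}"
    then obtain t where t: "z = cis t" "b \<le> t" "t \<le> a + 2 * pi" by auto
    have "z \<notin> A"
    proof
      assume "z \<in> A"
      then obtain s where s: "z = cis s" "a < s" "s < b" using ab by auto
      have "cis (t - s) = 1" using t(1) s(1) by (simp add: cis_divide[symmetric])
      then have "cos (t - s) = 1" by (metis cis.simps(1) one_complex.simps(1))
      then obtain k :: int where k: "t - s = of_int k * 2 * pi" by (auto simp: cos_one_2pi_int)
      then have "of_int k * (2 * pi) = t - s" by simp
      then have "0 < of_int k * (2 * pi)" "of_int k * (2 * pi) < 1 * (2 * pi)"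
        using t(2,3) s(2,3) by linarith+
      then have "(0::real) < of_int k" "(of_int k::real) < 1"
        using pi_gt_zero by (auto simp: zero_less_mult_iff)
      then show False by simp
    qed
    then show "z \<in> sphere 0 1 - A" using t by simp
  qed
  moreover have "compact (cis ` {b..a + 2 * pi})"
    by (intro compact_continuous_image continuous_intros) auto
  ultimately show "closed (sphere 0 1 - A)" by (simp add: compact_imp_closed)
qed

lemma open_arc_borel:
  assumes "open_arc A"
  shows "A \<in> sets borel"
proof -
  have "A = sphere 0 1 - (sphere 0 1 - A)" using open_arc_complement(1)[OF assms] by blast
  then show ?thesis
    using open_arc_complement(2)[OF assms] by (metis borel_closed closed_sphere sets.Diff)
qed

text \<open>The parameter interval (a, b) need not lie in [0, 2 pi). Its midpoint is shifted there
  by a multiple of 2 pi; an interval to the right of the shifted point, cut off at 2 pi, still maps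
  into the arc.\<close>

lemma open_arc_emeasure_pos:
  assumes "open_arc A"
  shows "0 < emeasure M A"
proof -
  obtain a b where ab: "a < b" "b \<le> a + 2 * pi" "A = cis ` {a<..<b}"
    using assms by (auto simp: open_arc_def)
  define m where "m = (a + b) / 2"
  define k where "k = \<lfloor>m / (2 * pi)\<rfloor>"
  define t where "t = m - 2 * pi * of_int k"
  have "of_int k \<le> m / (2 * pi)" "m / (2 * pi) < of_int k + 1" by (auto simp: k_def)
  then have t: "0 \<le> t" "t < 2 * pi" by (auto simp: t_def field_simps)
  define r where "r = min (t + (b - a) / 2) (2 * pi)"
  have tr: "t < r" "r \<le> t + (b - a) / 2" "r \<le> 2 * pi" using t ab(1) by (auto simp: r_def)
  have "{t<..<r} \<subseteq> {0..<2 * pi} \<inter> cis -` A"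
  proof
    fix x assume x: "x \<in> {t<..<r}"
    have "cis x = cis (x + 2 * pi * of_int k)" using cis_shift[of x "- k"] by simp
    moreover have "x + 2 * pi * of_int k \<in> {a<..<b}"
      using x tr ab(1) by (auto simp: t_def m_def field_simps)
    ultimately show "x \<in> {0..<2 * pi} \<inter> cis -` A" using x tr t ab(3) by auto
  qed
  moreover have "{0..<2 * pi} \<inter> cis -` A \<in> sets lborel"
    using measurable_sets[OF cis_borel_measurable open_arc_borel[OF assms]] by simp
  ultimately have "emeasure lborel {t<..<r} \<le> emeasure lborel ({0..<2 * pi} \<inter> cis -` A)"
    by (intro emeasure_mono)
  then have "0 < emeasure lborel ({0..<2 * pi} \<inter> cis -` A)"
    using tr(1) by (auto intro: less_le_trans[rotated])
  then show ?thesis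
    by (simp add: emeasure_circle_measure[OF open_arc_borel[OF assms]] ennreal_zero_less_divide)
qed

lemma finite_union_of_arcs_props:
  assumes "finite_union_of_arcs I"
  shows "I \<in> sets M" "0 < measure M I" "closed (sphere 0 1 - I)"
proof -
  obtain \<A> where A: "finite \<A>" "\<A> \<noteq> {}" "\<And>A. A \<in> \<A> \<Longrightarrow> open_arc A" "I = \<Union>\<A>"
    using assms by (auto simp: finite_union_of_arcs_def)
  have "I \<in> sets borel" using A open_arc_borel by (auto intro: sets.finite_Union)
  then show I: "I \<in> sets M" by (rule sets_circle_measure_borel)
  obtain A where "A \<in> \<A>" using A(2) by blast
  then have "emeasure M A \<le> emeasure M I" using A(4) I by (intro emeasure_mono) auto
  then have "0 < emeasure M I"
    using open_arc_emeasure_pos[OF A(3)[OF \<open>A \<in> \<A>\<close>]] by (rule less_le_trans[rotated])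
  then show "0 < measure M I" by (simp add: circle.emeasure_eq_measure)
  have "sphere 0 1 - I = (\<Inter>A\<in>\<A>. sphere 0 1 - A)" using A(2,4) by blast
  moreover have "closed (\<Inter>A\<in>\<A>. sphere 0 1 - A)"
    by (intro closed_INT ballI open_arc_complement(2) A(3))
  ultimately show "closed (sphere 0 1 - I)" by (simp only:)
qed

section \<open>Norms on subsets of the circle\<close>

lemma Lp_norm_2:
  "Lp_norm 2 E u = sqrt (norm2 (\<lambda>z. indicator E z * u z))"
proof -
  have "indicator E z *\<^sub>R (cmod (u z) powr 2) = (cmod (indicator E z * u z))\<^sup>2" for z
    by (auto simp: indicator_def)
  then have "(LINT z:E|M. cmod (u z) powr 2) = norm2 (\<lambda>z. indicator E z * u z)"
    by (simp add: set_lebesgue_integral_def norm2_def)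
  then show ?thesis by (simp add: Lp_norm_def powr_half_sqrt)
qed

lemma Lp_space_2_sq_int:
  assumes "f \<in> Lp_space 2 E"
  shows "sq_int (\<lambda>z. indicator E z * f z)"
proof -
  have "indicator E z *\<^sub>R (cmod (f z) powr 2) = (cmod (indicator E z * f z))\<^sup>2"
    "indicator E z *\<^sub>R f z = indicator E z * f z" for z
    by (auto simp: indicator_def)
  then show ?thesis
    using assms by (simp add: Lp_space_def sq_int_def set_borel_measurable_def set_integrable_def)
qed

lemma Lp_space_1_integrable:
  assumes "h \<in> Lp_space 1 E"
  shows "integrable M (\<lambda>z. indicator E z * cnj (h z))"
proof -
  have [measurable]: "(\<lambda>z. indicator E z *\<^sub>R h z) \<in> borel_measurable M"
    and i: "integrable M (\<lambda>z. indicator E z *\<^sub>R (cmod (h z) powr 1))"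
    using assms by (auto simp: Lp_space_def set_borel_measurable_def set_integrable_def)
  have "(\<lambda>z. cnj (indicator E z *\<^sub>R h z)) \<in> borel_measurable M" by measurable
  moreover have "cnj (indicator E z *\<^sub>R h z) = indicator E z * cnj (h z)" for z
    by (auto simp: indicator_def)
  ultimately have m: "(\<lambda>z. indicator E z * cnj (h z)) \<in> borel_measurable M" by simp
  show ?thesis
    by (rule Bochner_Integration.integrable_bound[OF i m]) (auto simp: indicator_def)
qed

text \<open>For t > d write t^p = t^(p-2) t^2; the first factor is at most d^(p-2) if p \<le> 2 and
  at most 2^(p-2) if p > 2 and t \<le> 2. Adding both constants lets one inequality serve both the
  low exponents and the bounded functions.\<close>

lemma powr_le_interpolate:
  fixes t p d :: real
  assumes "0 \<le> t" "1 \<le> p" "0 < d" "p \<le> 2 \<or> t \<le> 2"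
  shows "t powr p \<le> d powr p + (d powr (p - 2) + 2 powr (p - 2)) * t\<^sup>2"
proof (cases "t \<le> d")
  case True
  then have "t powr p \<le> d powr p" using assms by (intro powr_mono2) auto
  then show ?thesis by (simp add: add_increasing2)
next
  case False
  then have t: "0 < t" using assms by simp
  have "t powr p = t powr (p - 2) * t\<^sup>2"
    using t by (simp add: powr_diff)
  also have "t powr (p - 2) \<le> d powr (p - 2) + 2 powr (p - 2)"
  proof (cases "p \<le> 2")
    case True
    then have "t powr (p - 2) \<le> d powr (p - 2)"
      using False assms by (intro powr_mono2') auto
    then show ?thesis by (simp add: add_increasing2)
  next
    case False
    then have "t powr (p - 2) \<le> 2 powr (p - 2)"
      using assms t by (intro powr_mono2) auto
    then show ?thesis by (simp add: add_increasing)
  qed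
  finally have "t powr p \<le> (d powr (p - 2) + 2 powr (p - 2)) * t\<^sup>2" by (simp add: mult_right_mono)
  then show ?thesis by (simp add: add_increasing)
qed

lemma Lp_norm_tendsto_0:
  assumes E[measurable]: "E \<in> sets M" and u: "\<And>n. sq_int (\<lambda>z. indicator E z * u n z)"
    and p: "1 \<le> p" "p \<le> 2 \<or> (\<forall>n. AE z in M. z \<in> E \<longrightarrow> cmod (u n z) \<le> 2)"
    and lim: "(\<lambda>n. norm2 (\<lambda>z. indicator E z * u n z)) \<longlonglongrightarrow> 0"
  shows "(\<lambda>n. Lp_norm p E (u n)) \<longlonglongrightarrow> 0"
proof -
  define U where "U n z = indicator E z * u n z" for n z
  have U: "sq_int (U n)" for n using u[of n] by (simp add: U_def[abs_def])
  have [measurable]: "U n \<in> borel_measurable M" for n using U by (rule sq_int_measurable)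
  have eq: "indicator E z *\<^sub>R (cmod (u n z) powr p) = cmod (U n z) powr p" for n z
    using p(1) by (auto simp: U_def indicator_def)
  have "(\<lambda>n. LINT z|M. cmod (U n z) powr p) \<longlonglongrightarrow> 0"
  proof (rule LIMSEQ_I)
    fix e :: real assume e: "0 < e"
    \<comment> \<open>Then \<open>d powr p\<close> is half of \<open>e\<close>, which suffices
      because the total mass is 1.\<close>
    define d where "d = (e / 2) powr (1 / p)"
    have d: "0 < d" "d powr p = e / 2" using e p(1) by (auto simp: d_def powr_powr)
    define C where "C = d powr (p - 2) + 2 powr (p - 2)"
    have le: "AE z in M. cmod (U n z) powr p \<le> e / 2 + C * (cmod (U n z))\<^sup>2" for n
    proof -
      have "AE z in M. p \<le> 2 \<or> cmod (U n z) \<le> 2"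
      proof (cases "p \<le> 2")
        case False
        then have "AE z in M. z \<in> E \<longrightarrow> cmod (u n z) \<le> 2" using p(2) by auto
        then show ?thesis by eventually_elim (auto simp: U_def indicator_def)
      qed simp
      then show ?thesis
      proof eventually_elim
        case (elim z)
        then show ?case
          using powr_le_interpolate[OF norm_ge_zero p(1) d(1), of "U n z"] d(2) by (simp add: C_def)
      qed
    qed
    have "(\<lambda>n. e / 2 + C * norm2 (U n)) \<longlonglongrightarrow> e / 2 + C * 0"
      using lim unfolding U_def[abs_def] by (intro tendsto_intros)
    from order_tendstoD(2)[OF this, of e]
    have "eventually (\<lambda>n. e / 2 + C * norm2 (U n) < e) sequentially"
      using e by simp
    then have "eventually (\<lambda>n. norm ((LINT z|M. cmod (U n z) powr p) - 0) < e) sequentially"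
    proof eventually_elim
      case (elim n)
      have "(LINT z|M. cmod (U n z) powr p) \<le> (LINT z|M. e / 2 + C * (cmod (U n z))\<^sup>2)"
      proof (rule integral_mono_AE'[OF _ le])
        show "AE z in M. 0 \<le> e / 2 + C * (cmod (U n z))\<^sup>2" using e by (simp add: C_def)
      qed (use U[of n] in \<open>auto simp: sq_int_def\<close>)
      also have "\<dots> = e / 2 + C * norm2 (U n)"
        using U[of n] by (simp add: sq_int_def norm2_def)
      finally show ?case using elim by simp
    qed
    then show "\<exists>n0. \<forall>n\<ge>n0. norm ((LINT z|M. cmod (U n z) powr p) - 0) < e"
      by (simp add: eventually_sequentially)
  qed
  then have "(\<lambda>n. (LINT z|M. cmod (U n z) powr p) powr (1 / p)) \<longlonglongrightarrow> 0 powr (1 / p)"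
    using p(1) by (intro tendsto_powr') auto
  then show ?thesis
    using p(1) unfolding Lp_norm_def set_lebesgue_integral_def eq by simp
qed

section \<open>First order optimality in the analytic problem\<close>

lemma best_L2_approximant_le:
  assumes "best_L2_approximant I f C k" "g \<in> C"
  shows "norm2 (\<lambda>z. indicator I z * (f z - k z)) \<le> norm2 (\<lambda>z. indicator I z * (f z - g z))"
proof -
  have "(INF g\<in>C. Lp_norm 2 I (\<lambda>z. f z - g z)) \<le> Lp_norm 2 I (\<lambda>z. f z - g z)"
    using assms(2) by (intro cINF_lower bdd_belowI2[where m = 0]) (auto simp: Lp_norm_def)
  moreover have "Lp_norm 2 I (\<lambda>z. f z - k z) = (INF g\<in>C. Lp_norm 2 I (\<lambda>z. f z - g z))"
    using assms(1) by (simp add: best_L2_approximant_def)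
  ultimately have "Lp_norm 2 I (\<lambda>z. f z - k z) \<le> Lp_norm 2 I (\<lambda>z. f z - g z)" by simp
  then show ?thesis by (simp add: Lp_norm_2)
qed

lemma bounded_by_1_on_convex:
  assumes "f \<in> bounded_by_1_on J hardy2" "g \<in> bounded_by_1_on J hardy2" "0 \<le> t" "t \<le> 1"
  shows "(\<lambda>z. f z + of_real t * (g z - f z)) \<in> bounded_by_1_on J hardy2"
proof -
  have f: "f \<in> hardy2" "AE z in M. z \<in> J \<longrightarrow> cmod (f z) \<le> 1"
    and g: "g \<in> hardy2" "AE z in M. z \<in> J \<longrightarrow> cmod (g z) \<le> 1"
    using assms by (auto simp: bounded_by_1_on_def)
  have "(\<lambda>z. f z + of_real t * (g z - f z)) \<in> hardy2"
    by (intro hardy2_add hardy2_cmult hardy2_diff f g)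
  moreover have "AE z in M. z \<in> J \<longrightarrow> cmod (f z + of_real t * (g z - f z)) \<le> 1"
    using f(2) g(2)
  proof eventually_elim
    case (elim z)
    show ?case
    proof
      assume z: "z \<in> J"
      have "f z + of_real t * (g z - f z) = of_real (1 - t) * f z + of_real t * g z"
        by (simp add: algebra_simps)
      then have "cmod (f z + of_real t * (g z - f z)) \<le> (1 - t) * cmod (f z) + t * cmod (g z)"
        using norm_triangle_ineq[of "of_real (1 - t) * f z" "of_real t * g z"] assms(3,4) 
        by (simp add: norm_mult flip: of_real_diff)
      also have "\<dots> \<le> (1 - t) * 1 + t * 1"
        using elim z assms(3,4) by (intro add_mono mult_left_mono) auto
      finally show "cmod (f z + of_real t * (g z - f z)) \<le> 1" by simp
    qed
  qed
  ultimately show ?thesis by (simp add: bounded_by_1_on_def)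
qed

text \<open>Convexity keeps the segment from \<open>g0\<close> to \<open>g\<close> admissible, so
  moving along it cannot decrease the distance to \<open>f\<close>. Extending the residual by 0
  turns the inner product on \<open>I\<close> into an integral over the circle.\<close>

lemma solves_ABEP_variational:
  assumes I: "I \<in> sets M" and f: "f \<in> Lp_space 2 I" and g0: "solves_ABEP I J f g0"
    and g: "g \<in> bounded_by_1_on J hardy2"
  defines "psi \<equiv> \<lambda>z. indicator I z * (f z - g0 z)"
  shows "Re (LINT z|M. cnj (psi z) * (g z - g0 z)) \<le> 0"
proof -
  have g0C: "g0 \<in> bounded_by_1_on J hardy2"
    using g0 by (simp add: solves_ABEP_def best_L2_approximant_def)
  have s: "sq_int g" "sq_int g0" using g g0C by (auto simp: bounded_by_1_on_def hardy2D(1))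
  have "sq_int (\<lambda>z. indicator I z * f z - indicator I z * g0 z)"
    by (intro sq_int_diff(1) Lp_space_2_sq_int f sq_int_indicator(1) I s)
  then have spsi: "sq_int psi" by (simp add: psi_def right_diff_distrib)
  define b where "b z = indicator I z * (g z - g0 z)" for z
  have sb: "sq_int b" unfolding b_def[abs_def] by (intro sq_int_indicator(1) I sq_int_diff(1) s)
  have "Re (LINT z|M. cnj (psi z) * b z) \<le> 0"
  proof (rule variational_inequality[OF spsi sb])
    fix t :: real assume t: "0 < t" "t \<le> 1"
    have "norm2 psi \<le> norm2 (\<lambda>z. indicator I z * (f z - (g0 z + of_real t * (g z - g0 z))))"
      unfolding psi_def
      by (rule best_L2_approximant_le[OF g0[unfolded solves_ABEP_def] bounded_by_1_on_convex[OF g0C g]])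
        (use t in auto)
    then show "norm2 psi \<le> norm2 (\<lambda>z. psi z - of_real t * b z)"
      by (simp add: psi_def b_def algebra_simps)
  qed
  moreover have "cnj (psi z) * b z = cnj (psi z) * (g z - g0 z)" for z
    by (auto simp: psi_def b_def indicator_def)
  ultimately show ?thesis by simp
qed

text \<open>Where \<open>|g\<^sub>0| < 1\<close> on \<open>J\<close> there is room for a perturbation; elsewhere on \<open>J\<close> room is made
  by shrinking \<open>g\<^sub>0\<close>.\<close>

theorem solves_ABEP_unimodular:
  assumes I: "I \<in> sets M" and J: "J \<in> sets M" "J \<inter> I = {}"
    and f: "f \<in> Lp_space 2 I" and g0: "solves_ABEP I J f g0"
    and ne: "\<not> (AE z in M. z \<in> I \<longrightarrow> f z = g0 z)"
  shows "AE z in M. z \<in> J \<longrightarrow> cmod (g0 z) = 1"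
proof (rule ccontr)
  assume neg: "\<not> (AE z in M. z \<in> J \<longrightarrow> cmod (g0 z) = 1)"
  note J(1)[measurable]
  have g0C: "g0 \<in> hardy2" "AE z in M. z \<in> J \<longrightarrow> cmod (g0 z) \<le> 1"
    using g0 by (auto simp: solves_ABEP_def best_L2_approximant_def bounded_by_1_on_def)
  have sg0: "sq_int g0" using g0C(1) by (rule hardy2D)
  have [measurable]: "g0 \<in> borel_measurable M" using sg0 by (rule sq_int_measurable)
  define psi where "psi z = indicator I z * (f z - g0 z)" for z
  have "sq_int (\<lambda>z. indicator I z * f z - indicator I z * g0 z)"
    by (intro sq_int_diff(1) Lp_space_2_sq_int f sq_int_indicator(1) I sg0)
  then have spsi: "sq_int psi" by (simp add: psi_def[abs_def] right_diff_distrib)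
  \<comment> \<open>These sets exhaust the part of \<open>J\<close> where |g_0| < 1, so one of them
    has positive measure if that part does.\<close>
  define E where "E n = {z \<in> J. cmod (g0 z) \<le> 1 - 1 / real (Suc n)}" for n
  have E[measurable]: "E n \<in> sets M" for n
  proof -
    have "{z \<in> space M. z \<in> J \<and> cmod (g0 z) \<le> 1 - 1 / real (Suc n)} \<in> sets M" by measurable
    then show ?thesis by (simp add: E_def)
  qed
  have "\<exists>n. 0 < measure M (E n)"
  proof (rule ccontr)
    assume "\<not> (\<exists>n. 0 < measure M (E n))"
    then have "measure M (E n) = 0" for n by (simp add: not_less measure_le_0_iff)
    then have "AE z in M. z \<notin> E n" for n
      using circle.emeasure_eq_measure by (intro AE_not_in) (auto simp: null_sets_def)
    then have "AE z in M. \<forall>n. z \<notin> E n" by (simp add: AE_all_countable)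
    then have "AE z in M. z \<in> J \<longrightarrow> cmod (g0 z) = 1"
      using g0C(2)
    proof eventually_elim
      case (elim z)
      show ?case
      proof (rule impI, rule ccontr)
        assume z: "z \<in> J" and "cmod (g0 z) \<noteq> 1"
        then have "0 < 1 - cmod (g0 z)" using elim(2) by simp
        then obtain n where "1 / real (Suc n) < 1 - cmod (g0 z)" using nat_approx_posE by blast
        then have "z \<in> E n" using z by (simp add: E_def)
        then show False using elim(1) by simp
      qed
    qed
    then show False using neg by simp
  qed
  then obtain n where n: "0 < measure M (E n)" by blast
  define eps where "eps = 1 / real (Suc n)"
  have eps: "0 < eps" "eps \<le> 1" by (auto simp: eps_def)
  define K where "K = Re (LINT z|M. cnj (psi z) * g0 z)"
  have "norm2 psi = 0"
  proof (rule functional_controlled_on_proper_subset_zero[OF E n, where Y = "J - E n" and K = K])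
    fix s a assume s: "s \<in> bounded_hardy" and a: "0 < a" and sY: "AE z in M. z \<in> J - E n \<longrightarrow> cmod (s z) \<le> a"
    obtain B where B: "0 < B" "AE z in M. cmod (s z) \<le> B" using bounded_hardy_bound[OF s] .
    have ss: "sq_int s" using s by (intro hardy2D bounded_hardyD)
    \<comment> \<open>The first entry keeps \<open>l * cmod (s z)\<close> within the room
      \<open>eps\<close> available on \<open>E n\<close>; the second keeps the factor
      \<open>1 - l * a\<close> nonnegative.\<close>
    define l where "l = min (eps / B) (1 / a)"
    have l: "0 < l" "l * B \<le> eps" "l * a \<le> 1"
    proof -
      show "0 < l" using eps(1) B(1) a by (simp add: l_def)
      have "l \<le> eps / B" "l \<le> 1 / a" by (auto simp: l_def)
      then show "l * B \<le> eps" "l * a \<le> 1" using B(1) a by (auto simp: pos_le_divide_eq)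
    qed
    \<comment> \<open>Shrinking \<open>g0\<close> costs \<open>l * a * K\<close> in the variational
      inequality; after division by \<open>l\<close> this is the required bound
      \<open>a * K\<close>.\<close>
    define g where "g z = of_real (1 - l * a) * g0 z + of_real l * s z" for z
    have gH: "g \<in> hardy2" unfolding g_def[abs_def]
      by (intro hardy2_add hardy2_cmult g0C(1) bounded_hardyD s)
    have "AE z in M. z \<in> J \<longrightarrow> cmod (g z) \<le> 1"
      using sY B(2) g0C(2)
    proof eventually_elim
      case (elim z)
      show ?case
      proof
        assume z: "z \<in> J"
        have "cmod (g z) \<le> (1 - l * a) * cmod (g0 z) + l * cmod (s z)"
          unfolding g_def
          using norm_triangle_ineq[of "of_real (1 - l * a) * g0 z" "of_real l * s z"] l
          unfolding norm_mult norm_of_real by simp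
        also have "\<dots> \<le> 1"
        proof (cases "z \<in> E n")
          case True
          then have "cmod (g0 z) \<le> 1 - eps" by (simp add: E_def eps_def)
          moreover have "(1 - l * a) * cmod (g0 z) \<le> 1 * cmod (g0 z)"
            using l a by (intro mult_right_mono) auto
          moreover have "l * cmod (s z) \<le> l * B" using elim(2) l(1) by (intro mult_left_mono) auto
          ultimately show ?thesis using l(2) by linarith
        next
          case False
          have "(1 - l * a) * cmod (g0 z) \<le> 1 - l * a"
            using elim(3) z l(3) by (intro mult_left_le) auto
          moreover have "l * cmod (s z) \<le> l * a" using elim(1) z False l(1) by (intro mult_left_mono) auto
          ultimately show ?thesis by linarith
        qed
        finally show "cmod (g z) \<le> 1" .
      qed
    qed
    then have gC: "g \<in> bounded_by_1_on J hardy2" using gH by (simp add: bounded_by_1_on_def)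
    have i: "integrable M (\<lambda>z. cnj (psi z) * s z)" "integrable M (\<lambda>z. cnj (psi z) * g0 z)"
      by (intro sq_int_mult_integrable sq_int_cnj spsi ss sg0)+
    have "cnj (psi z) * (g z - g0 z) = of_real l * (cnj (psi z) * s z) - of_real (l * a) * (cnj (psi z) * g0 z)" for z
      by (simp add: g_def algebra_simps)
    then have "(LINT z|M. cnj (psi z) * (g z - g0 z))
        = of_real l * (LINT z|M. cnj (psi z) * s z) - of_real (l * a) * (LINT z|M. cnj (psi z) * g0 z)"
      using i by simp
    then have "Re (LINT z|M. cnj (psi z) * (g z - g0 z)) = l * Re (LINT z|M. cnj (psi z) * s z) - l * a * K"
      by (simp add: K_def)
    then have "l * Re (LINT z|M. cnj (psi z) * s z) \<le> l * (a * K)"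
      using solves_ABEP_variational[OF I f g0 gC] by (simp add: psi_def)
    then show "Re (LINT z|M. cnj (psi z) * s z) \<le> a * K" using l(1) by simp
  next
    fix z assume "z \<in> (J - E n) \<union> E n"
    then show "psi z = 0" using J(2) by (auto simp: psi_def E_def indicator_def)
  qed (use spsi in auto)
  then have "AE z in M. (cmod (psi z))\<^sup>2 = 0"
    using spsi integral_nonneg_eq_0_iff_AE[of M "\<lambda>z. (cmod (psi z))\<^sup>2"] by (simp add: norm2_def sq_int_def)
  then have "AE z in M. z \<in> I \<longrightarrow> f z = g0 z"
    by eventually_elim (auto simp: psi_def)
  then show False using ne by simp
qed

theorem theorem3:
  fixes I J :: "complex set" and f g0 :: "complex \<Rightarrow> complex" and k :: "nat \<Rightarrow> complex \<Rightarrow> complex"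
  assumes I: "finite_union_of_arcs I"
    and J: "J = sphere 0 1 - I"
    and J_int: "top_of_set (sphere 0 1) interior_of J \<noteq> {}"
    and f: "f \<in> Lp_space 2 I"
    and k: "\<And>n. solves_PBEP I J f n (k n)"
    and g0: "solves_ABEP I J f g0"
  shows "(\<forall>p. 1 \<le> p \<and> p \<le> 2 \<longrightarrow> (\<lambda>n. Lp_norm p I (\<lambda>z. g0 z - k n z)) \<longlonglongrightarrow> 0) \<and>
    (\<forall>h \<in> Lp_space 1 J. (\<lambda>n. pairing J (k n) h) \<longlonglongrightarrow> pairing J g0 h) \<and>
    (\<not> (\<exists>g \<in> bounded_by_1_on J hardy2. AE z in circle_measure. z \<in> I \<longrightarrow> f z = g z) \<longrightarrow>
      (\<forall>p\<ge>1. (\<lambda>n. Lp_norm p J (\<lambda>z. g0 z - k n z)) \<longlonglongrightarrow> 0)) \<and>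
    (\<not> (AE z in circle_measure. z \<in> I \<longrightarrow> f z = g0 z) \<longrightarrow>
      (\<forall>p\<ge>1. (\<lambda>n. Lp_norm p J (\<lambda>z. g0 z - k n z)) \<longlonglongrightarrow> 0))"
proof -
  have Im[measurable]: "I \<in> sets M" and Ipos: "0 < measure M I" and Jc: "closed J"
    using finite_union_of_arcs_props[OF I] J by auto
  have Jm[measurable]: "J \<in> sets M" using Jc by (intro sets_circle_measure_borel) auto
  have JI: "J \<inter> I = {}" using J by auto
  \<comment> \<open>The plane outside the circle is null, so the complement of \<open>I\<close> in
    the plane may replace \<open>J\<close>.\<close>
  have AEJ: "AE z in M. z \<in> J \<longleftrightarrow> z \<notin> I"
    using AE_circle_norm by eventually_elim (auto simp: J)
  define C where "C = bounded_by_1_on J hardy2"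
  have g0C: "g0 \<in> C" using g0 by (simp add: C_def solves_ABEP_def best_L2_approximant_def)
  have kP: "k n \<in> bounded_by_1_on J (poly_space n)" for n
    using k[of n] by (simp add: solves_PBEP_def best_L2_approximant_def)
  \<comment> \<open>Polynomials belong to H2, so each \<open>k n\<close> competes in the analytic
    problem and its error is never below that of \<open>g0\<close>.\<close>
  have kC: "k n \<in> C" for n
    using kP[of n] poly_hardy2 by (auto simp: C_def bounded_by_1_on_def poly_space_def)
  have CD: "g \<in> hardy2" "sq_int g" "AE z in M. z \<in> J \<longrightarrow> cmod (g z) \<le> 1" if "g \<in> C" for g
    using that by (auto simp: C_def bounded_by_1_on_def hardy2D(1))
  define psi where "psi g z = indicator I z * (f z - g z)" for g :: "complex \<Rightarrow> complex" and z
  have spsi: "sq_int (psi g)" if "sq_int g" for g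
  proof -
    have "sq_int (\<lambda>z. indicator I z * f z - indicator I z * g z)"
      by (intro sq_int_diff(1) Lp_space_2_sq_int f sq_int_indicator(1) Im that)
    then show ?thesis by (simp add: psi_def[abs_def] right_diff_distrib)
  qed
  have min0: "norm2 (psi g0) \<le> norm2 (psi g)" if "g \<in> C" for g
    using best_L2_approximant_le[OF g0[unfolded solves_ABEP_def]] that by (simp add: C_def psi_def[abs_def])
  have mink: "norm2 (psi (k n)) \<le> norm2 (psi g)" if "g \<in> bounded_by_1_on J (poly_space n)" for n g
    using best_L2_approximant_le[OF k[unfolded solves_PBEP_def] that] by (simp add: psi_def[abs_def])
  define d where "d n z = k n z - g0 z" for n z
  have dH: "d n \<in> hardy2" for n unfolding d_def[abs_def] by (intro hardy2_diff CD kC g0C)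
  have sd: "sq_int (d n)" for n using dH by (rule hardy2D)
  have dJ: "AE z in M. z \<in> J \<longrightarrow> cmod (d n z) \<le> 2" for n
    using CD(3)[OF kC[of n]] CD(3)[OF g0C]
  proof eventually_elim
    case (elim z)
    then show ?case using norm_triangle_ineq4[of "k n z" "g0 z"] by (auto simp: d_def)
  qed
  have dJ': "AE z in M. z \<notin> I \<longrightarrow> cmod (d n z) \<le> 2" for n
    using dJ[of n] AEJ by eventually_elim auto

  have lim_value: "(\<lambda>n. norm2 (psi (k n))) \<longlonglongrightarrow> norm2 (psi g0)"
  proof (rule LIMSEQ_I)
    fix e :: real assume e: "0 < e"
    define R where "R = sqrt (norm2 (psi g0))"
    \<comment> \<open>Moving by at most x in L2 raises the distance R to \<open>f\<close> to at most
      R + x, and its square by at most 2 R x + x^2 \<le> (2 R + 1) x < e.\<close>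
    define x where "x = min 1 (e / (2 * R + 2))"
    have R: "0 \<le> R" "R\<^sup>2 = norm2 (psi g0)" by (auto simp: R_def)
    have x: "0 < x" "x \<le> 1" using e R by (auto simp: x_def)
    have "x * (2 * R + 2) \<le> e"
    proof -
      have "x \<le> e / (2 * R + 2)" unfolding x_def by (rule min.cobounded2)
      then show ?thesis using R(1) by (simp only: pos_le_divide_eq)
    qed
    then have x3: "2 * R * x + x\<^sup>2 < e"
    proof -
      have "x * x \<le> x * 1" using x by (intro mult_left_mono) auto
      moreover have "x * (2 * R + 2) = 2 * R * x + 2 * x" by (simp add: algebra_simps)
      ultimately show ?thesis using \<open>x * (2 * R + 2) \<le> e\<close> x(1) unfolding power2_eq_square by linarith
    qed
    obtain p where p: "\<And>z. z \<in> J \<Longrightarrow> cmod z = 1 \<Longrightarrow> cmod (poly p z) \<le> 1"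
      "norm2 (\<lambda>z. poly p z - g0 z) < x\<^sup>2"
      using polynomials_dense_bounded_hardy[OF Jc CD(1)[OF g0C] CD(3)[OF g0C], of "x\<^sup>2"] x(1) by auto
    define b where "b z = indicator I z * (poly p z - g0 z)" for z
    have s: "sq_int (\<lambda>z. poly p z - g0 z)" by (intro sq_int_diff sq_int_poly CD g0C)
    have sb: "sq_int b" unfolding b_def[abs_def] by (rule sq_int_indicator(1)[OF Im s])
    have nb: "norm2 b \<le> x\<^sup>2"
      using sq_int_indicator(2)[OF Im s] p(2) by (simp add: b_def[abs_def])
    have "norm2 (psi (poly p)) = norm2 (\<lambda>z. psi g0 z - of_real 1 * b z)"
      by (simp add: psi_def[abs_def] b_def algebra_simps)
    also have "\<dots> = norm2 (psi g0) - 2 * 1 * Re (LINT z|M. cnj (psi g0 z) * b z) + 1\<^sup>2 * norm2 b"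
      by (intro norm2_expand spsi CD g0C sb)
    also have "\<dots> \<le> norm2 (psi g0) + 2 * (R * x) + x\<^sup>2"
    proof -
      have "\<bar>Re (LINT z|M. cnj (psi g0 z) * b z)\<bar> \<le> cmod (LINT z|M. cnj (psi g0 z) * b z)"
        by (rule abs_Re_le_cmod)
      also have "\<dots> \<le> sqrt (norm2 (\<lambda>z. cnj (psi g0 z))) * sqrt (norm2 b)"
        by (intro sq_int_mult_integrable(4) sq_int_cnj spsi CD g0C sb)
      also have "\<dots> \<le> R * x"
        using nb x(1) by (intro mult_mono) (auto simp: R_def norm2_def intro: real_le_lsqrt)
      finally show ?thesis using nb by simp
    qed
    finally have pe: "norm2 (psi (poly p)) < norm2 (psi g0) + e" using x3 by simp
    have "norm2 (psi (k n)) < norm2 (psi g0) + e" if "n \<ge> degree p" for n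
    proof -
      have "AE z in M. z \<in> J \<longrightarrow> cmod (poly p z) \<le> 1"
        using AE_circle_norm by eventually_elim (use p(1) in auto)
      then have "poly p \<in> bounded_by_1_on J (poly_space n)"
        using that by (auto simp: bounded_by_1_on_def poly_space_def)
      from mink[OF this] pe show ?thesis by simp
    qed
    moreover have "norm2 (psi g0) \<le> norm2 (psi (k n))" for n by (rule min0[OF kC])
    ultimately show "\<exists>n0. \<forall>n\<ge>n0. norm (norm2 (psi (k n)) - norm2 (psi g0)) < e"
      by (intro exI[of _ "degree p"]) (auto simp: abs_less_iff algebra_simps add_increasing)
  qed

  have limI: "(\<lambda>n. norm2 (\<lambda>z. indicator I z * d n z)) \<longlonglongrightarrow> 0"
  proof (rule Lim_null_comparison)
    show "(\<lambda>n. norm2 (psi (k n)) - norm2 (psi g0)) \<longlonglongrightarrow> 0"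
      using lim_value by (simp add: LIM_zero_iff)
    \<comment> \<open>Quantitative form of the convexity argument: in the expansion around
      \<open>g0\<close> the variational inequality makes the cross term nonnegative, so the excess
      of the squared error alone dominates the squared norm of \<open>d n\<close> on
      \<open>I\<close>.\<close>
    have "norm2 (\<lambda>z. indicator I z * d n z) \<le> norm2 (psi (k n)) - norm2 (psi g0)" for n
    proof -
      define b where "b z = indicator I z * d n z" for z
      have sb: "sq_int b" unfolding b_def[abs_def] by (rule sq_int_indicator(1)[OF Im sd])
      have "norm2 (psi (k n)) = norm2 (\<lambda>z. psi g0 z - of_real 1 * b z)"
        by (simp add: psi_def[abs_def] b_def d_def algebra_simps)
      also have "\<dots> = norm2 (psi g0) - 2 * 1 * Re (LINT z|M. cnj (psi g0 z) * b z) + 1\<^sup>2 * norm2 b"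
        by (intro norm2_expand spsi CD g0C sb)
      also have "(LINT z|M. cnj (psi g0 z) * b z) = (LINT z|M. cnj (psi g0 z) * (k n z - g0 z))"
        by (intro Bochner_Integration.integral_cong) (auto simp: psi_def b_def d_def indicator_def)
      finally show ?thesis
        using solves_ABEP_variational[OF Im f g0 kC[of n, unfolded C_def]]
        by (simp add: psi_def[abs_def] b_def[abs_def])
    qed
    then show "\<forall>\<^sub>F n in sequentially. norm (norm2 (\<lambda>z. indicator I z * d n z)) \<le> norm2 (psi (k n)) - norm2 (psi g0)"
      by simp
  qed

  have weak: "(\<lambda>n. LINT z|M. indicator J z * (d n z * h z)) \<longlonglongrightarrow> 0" if h: "integrable M h" for h
  proof -
    have [measurable]: "h \<in> borel_measurable M" "d n \<in> borel_measurable M" for n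
      using h sq_int_measurable[OF sd] by auto
    have "(LINT z|M. indicator J z * (d n z * h z)) = (LINT z|M. indicator (- I) z * (d n z * h z))" for n
    proof (rule integral_cong_AE)
      have "- I \<in> sets M" by (rule Compl_sets_circle_measure[OF Im])
      then show "(\<lambda>z. indicator (- I) z * (d n z * h z)) \<in> borel_measurable M" by measurable
      show "AE z in M. indicator J z * (d n z * h z) = indicator (- I) z * (d n z * h z)"
        using AEJ by eventually_elim (auto simp: indicator_def)
    qed measurable
    then show ?thesis using weak_convergence_off_set[OF Im Ipos dH dJ' limI h] by simp
  qed

  have part1: "(\<lambda>n. Lp_norm p I (\<lambda>z. g0 z - k n z)) \<longlonglongrightarrow> 0" if "1 \<le> p" "p \<le> 2" for p
  proof -
    have "(\<lambda>n. Lp_norm p I (d n)) \<longlonglongrightarrow> 0"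
      by (rule Lp_norm_tendsto_0[OF Im _ that(1) _ limI]) (use that sq_int_indicator(1)[OF Im sd] in auto)
    then show ?thesis by (simp add: Lp_norm_def d_def norm_minus_commute)
  qed

  have part2: "(\<lambda>n. pairing J (k n) h) \<longlonglongrightarrow> pairing J g0 h" if h: "h \<in> Lp_space 1 J" for h
  proof -
    define H where "H z = indicator J z * cnj (h z)" for z
    have iH: "integrable M H" using Lp_space_1_integrable[OF h] by (simp add: H_def[abs_def])
    have [measurable]: "H \<in> borel_measurable M" using iH by auto
    have int: "integrable M (\<lambda>z. g z * H z)" if "g \<in> C" for g
    proof (rule Bochner_Integration.integrable_bound[OF iH])
      have [measurable]: "g \<in> borel_measurable M" using CD(2)[OF that] by (rule sq_int_measurable)
      show "(\<lambda>z. g z * H z) \<in> borel_measurable M" by measurable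
      show "AE z in M. norm (g z * H z) \<le> norm (H z)"
        using CD(3)[OF that] by eventually_elim (auto simp: H_def norm_mult indicator_def intro: mult_left_le_one_le)
    qed
    have pair: "pairing J g h = (LINT z|M. g z * H z)" for g
      unfolding pairing_def set_lebesgue_integral_def
      by (intro Bochner_Integration.integral_cong) (auto simp: H_def indicator_def)
    have "pairing J (k n) h - pairing J g0 h = (LINT z|M. indicator J z * (d n z * H z))" for n
    proof -
      have "pairing J (k n) h - pairing J g0 h = (LINT z|M. k n z * H z - g0 z * H z)"
        unfolding pair using int[OF kC] int[OF g0C] by simp
      also have "\<dots> = (LINT z|M. indicator J z * (d n z * H z))"
        by (intro Bochner_Integration.integral_cong) (auto simp: d_def H_def indicator_def algebra_simps)
      finally show ?thesis .
    qed
    then have "(\<lambda>n. pairing J (k n) h - pairing J g0 h) \<longlonglongrightarrow> 0" using weak[OF iH] by simp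
    then show ?thesis by (simp add: LIM_zero_iff)
  qed

  have part4: "(\<lambda>n. Lp_norm p J (\<lambda>z. g0 z - k n z)) \<longlonglongrightarrow> 0"
    if ne: "\<not> (AE z in M. z \<in> I \<longrightarrow> f z = g0 z)" and p: "1 \<le> p" for p
  proof -
    have uni: "AE z in M. z \<in> J \<longrightarrow> cmod (g0 z) = 1"
      by (rule solves_ABEP_unimodular[OF Im Jm JI f g0 ne])
    \<comment> \<open>The test function for weak convergence is the conjugate of \<open>g0\<close>
      itself, integrable because \<open>g0\<close> is square integrable and the total mass is
      1.\<close>
    have icg: "integrable M (\<lambda>z. cnj (g0 z))" by (intro sq_int_integrable sq_int_cnj CD g0C)
    have "norm2 (\<lambda>z. indicator J z * d n z) \<le> - 2 * Re (LINT z|M. indicator J z * (d n z * cnj (g0 z)))" for n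
    proof -
      have sJ: "sq_int (\<lambda>z. indicator J z * d n z)" by (rule sq_int_indicator(1)[OF Jm sd])
      have i: "integrable M (\<lambda>z. indicator J z * (d n z * cnj (g0 z)))"
        using sq_int_mult_integrable(1)[OF sJ sq_int_cnj[OF CD(2)[OF g0C]]] by (simp add: mult.assoc)
      have "norm2 (\<lambda>z. indicator J z * d n z) \<le> (LINT z|M. - 2 * Re (indicator J z * (d n z * cnj (g0 z))))"
        unfolding norm2_def
      proof (rule integral_mono_AE)
        show "integrable M (\<lambda>z. (cmod (indicator J z * d n z))\<^sup>2)" using sJ by (simp add: sq_int_def)
        show "integrable M (\<lambda>z. - 2 * Re (indicator J z * (d n z * cnj (g0 z))))"
          by (intro integrable_mult_right integrable_Re i)
        show "AE z in M. (cmod (indicator J z * d n z))\<^sup>2 \<le> - 2 * Re (indicator J z * (d n z * cnj (g0 z)))"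
          using uni CD(3)[OF kC[of n]]
        proof eventually_elim
          case (elim z)
          show ?case
          proof (cases "z \<in> J")
            case True
            have "(cmod (d n z))\<^sup>2 = (cmod (k n z))\<^sup>2 - (cmod (g0 z))\<^sup>2 - 2 * Re (d n z * cnj (g0 z))"
              unfolding cmod_power2 by (simp add: d_def power2_eq_square algebra_simps)
            moreover have "(cmod (k n z))\<^sup>2 \<le> 1" using elim True by (simp add: abs_square_le_1)
            ultimately show ?thesis using elim True by simp
          qed simp
        qed
      qed
      also have "\<dots> = - 2 * Re (LINT z|M. indicator J z * (d n z * cnj (g0 z)))"
        by (simp only: integral_mult_right_zero integral_Re[OF i])
      finally show ?thesis .
    qed
    then have bound: "\<forall>n. norm (norm2 (\<lambda>z. indicator J z * d n z)) \<le> - 2 * Re (LINT z|M. indicator J z * (d n z * cnj (g0 z)))"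
      by (simp only: real_norm_def abs_of_nonneg[OF norm2_nonneg] simp_thms)
    have "(\<lambda>n. - 2 * Re (LINT z|M. indicator J z * (d n z * cnj (g0 z)))) \<longlonglongrightarrow> - 2 * Re 0"
      by (intro tendsto_mult tendsto_const tendsto_Re weak icg)
    then have "(\<lambda>n. - 2 * Re (LINT z|M. indicator J z * (d n z * cnj (g0 z)))) \<longlonglongrightarrow> 0"
      by (simp only: zero_complex.sel mult_zero_right)
    then have limJ: "(\<lambda>n. norm2 (\<lambda>z. indicator J z * d n z)) \<longlonglongrightarrow> 0"
      by (rule Lim_null_comparison[OF always_eventually[OF bound]])
    have "(\<lambda>n. Lp_norm p J (d n)) \<longlonglongrightarrow> 0"
      by (rule Lp_norm_tendsto_0[OF Jm _ p _ limJ]) (use dJ sq_int_indicator(1)[OF Jm sd] in auto)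
    then show ?thesis by (simp add: Lp_norm_def d_def norm_minus_commute)
  qed

  \<comment> \<open>As \<open>g0\<close> is itself admissible, an \<open>f\<close> that agrees on
    \<open>I\<close> with no admissible function differs from \<open>g0\<close>; both versions of
    strong convergence thus follow from \<open>part4\<close>.\<close>
  have "\<not> (AE z in M. z \<in> I \<longrightarrow> f z = g0 z)"
    if "\<not> (\<exists>g \<in> bounded_by_1_on J hardy2. AE z in M. z \<in> I \<longrightarrow> f z = g z)"
    using that g0C unfolding C_def by blast
  then show ?thesis using part1 part2 part4 by blast
qed

end
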